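(* An immersion $x:M^m\to\mathbb{R}^{m+p}$ is a $\xi$-submanifold if and only if there exists a parallel normal vector field $\xi\in\Gamma(T^\perp M)$ along $x$ such that $x$ is a critical point of both functionals $V_\xi$ and $\bar V_\xi$ for all compact normal variations of $x$ (i.e. $V_\xi'(0)=0$ and $\bar V_\xi'(0)=0$ for every such variation).
   Context: Let $x:M^m\to\mathbb{R}^{m+p}$ be a smooth immersion with mean curvature vector $H$ (the trace of the second fundamental form) and normal connection $D^\perp$; $x^\perp$ is the normal component of the position vector. $x$ is a $\xi$-submanifold if $H+x^\perp=\xi$ for some normal field $\xi$ with $D^\perp\xi=0$ (i.e. $H+x^\perp$ is parallel). For a fixed map $\xi:M\to\mathbb{R}^{m+p}$ and an immersion $y:M\to\mathbb{R}^{m+p}$, put $f_y=\tfrac12|y-\xi|^2$, $\bar f_y=f_y-\tfrac12|\xi|^2$, $V_\xi(y)=\int_M e^{-f_y}dV_y$, $\bar V_\xi(y)=\int_M e^{-\bar f_y}dV_y$, where $dV_y$ is the volume element of the metric induced by $y$. A variation of $x$ is a smooth map $F:M\times(-\varepsilon,\varepsilon)\to\mathbb{R}^{m+p}$ with $F(\cdot,0)=x$ and every $x_t=F(\cdot,t)$ an immersion; it is compact if there is a relatively compact open $B\subset M$ containing the support of $\partial F/\partial t(\cdot,t)$ for every $t$, and normal if $\partial F/\partial t|_{t=0}$ is a normal field along $x$. $V_\xi'(0)$, $\bar V_\xi'(0)$ denote derivatives at $t=0$ of $V_\xi(x_t)$, $\bar V_\xi(x_t)$, with $\xi$ independent of $t$;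 when the functionals are infinite they mean $\int_M\frac{\partial}{\partial t}|_{t=0}(e^{-f_{x_t}}dV_{x_t})$ and the analogous integral with $\bar f$. *)

theory Defs
  imports "HOL-Analysis.Analysis"
begin

section \<open>Smooth maps and smooth manifolds\<close>

text \<open>Differentiability classes on an open set \<open>S\<close>; only open sets are used below.\<close>

primrec C_k_on :: "nat \<Rightarrow> 'a::real_normed_vector set \<Rightarrow> ('a \<Rightarrow> 'b::real_normed_vector) \<Rightarrow> bool" where
  "C_k_on 0 S f \<longleftrightarrow> continuous_on S f"
| "C_k_on (Suc k) S f \<longleftrightarrow>
     (\<forall>x\<in>S. f differentiable (at x)) \<and>
     (\<forall>v. C_k_on k S (\<lambda>x. frechet_derivative f (at x) v))"

definition smooth_on :: "'a::real_normed_vector set \<Rightarrow> ('a \<Rightarrow> 'b::real_normed_vector) \<Rightarrow> bool" where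
  "smooth_on S f \<longleftrightarrow> (\<forall>k. C_k_on k S f)"

text \<open>
  A manifold \<open>M\<close> of dimension \<open>m = CARD('m)\<close> is a Hausdorff, second countable type \<open>'a\<close> with
  a smooth atlas. A chart is a pair of its domain and its coordinate map; the values of the
  coordinate map outside the domain are irrelevant.
\<close>

type_synonym ('a, 'm) chart = "'a set \<times> ('a \<Rightarrow> real ^ 'm)"

abbreviation chart_dom :: "('a, 'm) chart \<Rightarrow> 'a set" where
  "chart_dom c \<equiv> fst c"

abbreviation chart_map :: "('a, 'm) chart \<Rightarrow> 'a \<Rightarrow> real ^ 'm" where
  "chart_map c \<equiv> snd c"

definition chart_img :: "('a, 'm) chart \<Rightarrow> (real ^ 'm) set" where
  "chart_img c = chart_map c ` chart_dom c"

definition chart_inv :: "('a, 'm) chart \<Rightarrow> real ^ 'm \<Rightarrow> 'a" where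
  "chart_inv c = the_inv_into (chart_dom c) (chart_map c)"

definition is_chart :: "('a::topological_space, 'm::finite) chart \<Rightarrow> bool" where
  "is_chart c \<longleftrightarrow> open (chart_dom c) \<and> open (chart_img c) \<and>
     homeomorphism (chart_dom c) (chart_img c) (chart_map c) (chart_inv c)"

definition smooth_atlas ::
  "('a::{t2_space,second_countable_topology}, 'm::finite) chart set \<Rightarrow> bool" where
  "smooth_atlas A \<longleftrightarrow>
     (\<forall>c\<in>A. is_chart c) \<and> (\<Union>c\<in>A. chart_dom c) = UNIV \<and>
     (\<forall>c\<in>A. \<forall>d\<in>A. smooth_on (chart_map c ` (chart_dom c \<inter> chart_dom d))
                        (chart_map d \<circ> chart_inv c))"

definition local_rep :: "('a, 'm) chart \<Rightarrow> ('a \<Rightarrow> 'b) \<Rightarrow> real ^ 'm \<Rightarrow> 'b" where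
  "local_rep c f = f \<circ> chart_inv c"

definition smooth_map ::
  "('a, 'm::finite) chart set \<Rightarrow> ('a \<Rightarrow> 'b::real_normed_vector) \<Rightarrow> bool" where
  "smooth_map A f \<longleftrightarrow> (\<forall>c\<in>A. smooth_on (chart_img c) (local_rep c f))"

text \<open>The differential at \<open>q\<close>, applied to the tangent vector with components \<open>a\<close> in the chart \<open>c\<close>.\<close>

definition differential ::
  "('a, 'm::finite) chart \<Rightarrow> ('a \<Rightarrow> 'b::real_normed_vector) \<Rightarrow> 'a \<Rightarrow> real ^ 'm \<Rightarrow> 'b" where
  "differential c f q a = frechet_derivative (local_rep c f) (at (chart_map c q)) a"

definition immersion ::
  "('a, 'm::finite) chart set \<Rightarrow> ('a \<Rightarrow> 'b::real_normed_vector) \<Rightarrow> bool" where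
  "immersion A x \<longleftrightarrow> smooth_map A x \<and>
     (\<forall>c\<in>A. \<forall>q\<in>chart_dom c. inj (differential c x q))"

definition chart_at :: "('a, 'm) chart set \<Rightarrow> 'a \<Rightarrow> ('a, 'm) chart" where
  "chart_at A q = (SOME c. c \<in> A \<and> q \<in> chart_dom c)"


section \<open>Extrinsic geometry of an immersion\<close>

text \<open>
  The union over all charts at \<open>q\<close> is a union of equal sets, since the image of the differential
  of \<open>x\<close> does not depend on the chart.
\<close>

definition tangent_space ::
  "('a, 'm::finite) chart set \<Rightarrow> ('a \<Rightarrow> real ^ 'n) \<Rightarrow> 'a \<Rightarrow> (real ^ 'n) set" where
  "tangent_space A x q = (\<Union>c\<in>{c\<in>A. q \<in> chart_dom c}. range (differential c x q))"

definition normal_space ::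
  "('a, 'm::finite) chart set \<Rightarrow> ('a \<Rightarrow> real ^ 'n) \<Rightarrow> 'a \<Rightarrow> (real ^ 'n) set" where
  "normal_space A x q = {w. \<forall>v\<in>tangent_space A x q. orthogonal w v}"

definition normal_part ::
  "('a, 'm::finite) chart set \<Rightarrow> ('a \<Rightarrow> real ^ 'n) \<Rightarrow> 'a \<Rightarrow> real ^ 'n \<Rightarrow> real ^ 'n" where
  "normal_part A x q v = (THE w. w \<in> normal_space A x q \<and> v - w \<in> tangent_space A x q)"

definition partial ::
  "'m::finite \<Rightarrow> (real ^ 'm \<Rightarrow> 'b::real_normed_vector) \<Rightarrow> real ^ 'm \<Rightarrow> 'b" where
  "partial i g u = frechet_derivative g (at u) (axis i 1)"

definition metric_coeffs ::
  "('a, 'm::finite) chart \<Rightarrow> ('a \<Rightarrow> real ^ 'n) \<Rightarrow> real ^ 'm \<Rightarrow> real ^ 'm ^ 'm" where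
  "metric_coeffs c x u = (\<chi> i j. inner (partial i (local_rep c x) u) (partial j (local_rep c x) u))"

text \<open>
  By the Gauss formula, the second fundamental form on the coordinate fields of \<open>c\<close> is the normal
  part of the second partial derivatives of \<open>x\<close>.
\<close>

definition second_fundamental_form ::
  "('a, 'm::finite) chart set \<Rightarrow> ('a, 'm) chart \<Rightarrow> ('a \<Rightarrow> real ^ 'n) \<Rightarrow> 'a \<Rightarrow> 'm \<Rightarrow> 'm \<Rightarrow> real ^ 'n" where
  "second_fundamental_form A c x q i j =
     normal_part A x q (partial i (partial j (local_rep c x)) (chart_map c q))"

text \<open>The metric trace of the second fundamental form, without the factor \<open>1/m\<close>; being a trace,
  it does not depend on the chosen chart at \<open>q\<close>.\<close>

definition mean_curvature ::
  "('a, 'm::finite) chart set \<Rightarrow> ('a \<Rightarrow> real ^ 'n) \<Rightarrow> 'a \<Rightarrow> real ^ 'n" where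
  "mean_curvature A x q =
     (let c = chart_at A q; G = matrix_inv (metric_coeffs c x (chart_map c q))
      in \<Sum>i\<in>UNIV. \<Sum>j\<in>UNIV. (G $ i $ j) *\<^sub>R second_fundamental_form A c x q i j)"

text \<open>\<open>D\<^sup>\<bottom>\<close> applied to \<open>\<xi>\<close>, in the direction of the tangent vector with components \<open>a\<close> in \<open>c\<close>.\<close>

definition normal_connection ::
  "('a, 'm::finite) chart set \<Rightarrow> ('a, 'm) chart \<Rightarrow> ('a \<Rightarrow> real ^ 'n) \<Rightarrow> ('a \<Rightarrow> real ^ 'n)
     \<Rightarrow> 'a \<Rightarrow> real ^ 'm \<Rightarrow> real ^ 'n" where
  "normal_connection A c x \<xi> q a = normal_part A x q (differential c \<xi> q a)"

definition normal_field ::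
  "('a, 'm::finite) chart set \<Rightarrow> ('a \<Rightarrow> real ^ 'n) \<Rightarrow> ('a \<Rightarrow> real ^ 'n) \<Rightarrow> bool" where
  "normal_field A x \<xi> \<longleftrightarrow> smooth_map A \<xi> \<and> (\<forall>q. \<xi> q \<in> normal_space A x q)"

definition parallel_normal_field ::
  "('a, 'm::finite) chart set \<Rightarrow> ('a \<Rightarrow> real ^ 'n) \<Rightarrow> ('a \<Rightarrow> real ^ 'n) \<Rightarrow> bool" where
  "parallel_normal_field A x \<xi> \<longleftrightarrow> normal_field A x \<xi> \<and>
     (\<forall>c\<in>A. \<forall>q\<in>chart_dom c. \<forall>a. normal_connection A c x \<xi> q a = 0)"

definition xi_submanifold ::
  "('a, 'm::finite) chart set \<Rightarrow> ('a \<Rightarrow> real ^ 'n) \<Rightarrow> bool" where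
  "xi_submanifold A x \<longleftrightarrow>
     (\<exists>\<xi>. parallel_normal_field A x \<xi> \<and>
          (\<forall>q. mean_curvature A x q + normal_part A x q (x q) = \<xi> q))"


section \<open>Weighted volumes and their first variation\<close>

text \<open>
  The volume measure of the induced metric: the unique Borel measure that is
  \<open>sqrt (det g) du\<close> in every chart.
\<close>

definition volume_measure ::
  "('a::topological_space, 'm::finite) chart set \<Rightarrow> ('a \<Rightarrow> real ^ 'n) \<Rightarrow> 'a measure" where
  "volume_measure A y = (THE \<mu>. sets \<mu> = sets borel \<and>
     (\<forall>c\<in>A. \<forall>E\<in>sets borel. E \<subseteq> chart_dom c \<longrightarrow>
        emeasure \<mu> E =
          (\<integral>\<^sup>+ u\<in>chart_map c ` E. ennreal (sqrt (det (metric_coeffs c y u))) \<partial>lborel)))"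

text \<open>The function \<open>J\<close> with \<open>dV\<^sub>y = J dV\<^sub>x\<close>; the quotient does not depend on the chosen chart.\<close>

definition volume_ratio ::
  "('a, 'm::finite) chart set \<Rightarrow> ('a \<Rightarrow> real ^ 'n) \<Rightarrow> ('a \<Rightarrow> real ^ 'n) \<Rightarrow> 'a \<Rightarrow> real" where
  "volume_ratio A x y q = (let c = chart_at A q; u = chart_map c q
     in sqrt (det (metric_coeffs c y u)) / sqrt (det (metric_coeffs c x u)))"

definition f_weight :: "('a \<Rightarrow> real ^ 'n) \<Rightarrow> ('a \<Rightarrow> real ^ 'n) \<Rightarrow> 'a \<Rightarrow> real" where
  "f_weight \<xi> y q = 1/2 * (norm (y q - \<xi> q))\<^sup>2"

definition f_bar_weight :: "('a \<Rightarrow> real ^ 'n) \<Rightarrow> ('a \<Rightarrow> real ^ 'n) \<Rightarrow> 'a \<Rightarrow> real" where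
  "f_bar_weight \<xi> y q = f_weight \<xi> y q - 1/2 * (norm (\<xi> q))\<^sup>2"

text \<open>With \<open>\<Phi> = f_weight \<xi>\<close> and \<open>\<Phi> = f_bar_weight \<xi>\<close> this gives \<open>V\<^sub>\<xi>\<close> and its barred version.
  It is meaningful only where the integral is finite.\<close>

definition weighted_volume ::
  "('a::topological_space, 'm::finite) chart set \<Rightarrow> (('a \<Rightarrow> real ^ 'n) \<Rightarrow> 'a \<Rightarrow> real)
     \<Rightarrow> ('a \<Rightarrow> real ^ 'n) \<Rightarrow> real" where
  "weighted_volume A \<Phi> y = (\<integral>q. exp (- \<Phi> y q) \<partial>volume_measure A y)"

definition weighted_volume_finite ::
  "('a::topological_space, 'm::finite) chart set \<Rightarrow> (('a \<Rightarrow> real ^ 'n) \<Rightarrow> 'a \<Rightarrow> real)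
     \<Rightarrow> ('a \<Rightarrow> real ^ 'n) \<Rightarrow> bool" where
  "weighted_volume_finite A \<Phi> y \<longleftrightarrow> integrable (volume_measure A y) (\<lambda>q. exp (- \<Phi> y q))"

definition variation ::
  "('a, 'm::finite) chart set \<Rightarrow> ('a \<Rightarrow> real ^ 'n) \<Rightarrow> real \<Rightarrow> ('a \<Rightarrow> real \<Rightarrow> real ^ 'n) \<Rightarrow> bool" where
  "variation A x \<epsilon> F \<longleftrightarrow> \<epsilon> > 0 \<and>
     (\<forall>c\<in>A. smooth_on (chart_img c \<times> {-\<epsilon><..<\<epsilon>}) (\<lambda>(u, t). F (chart_inv c u) t)) \<and>
     (\<forall>q. F q 0 = x q) \<and>
     (\<forall>t\<in>{-\<epsilon><..<\<epsilon>}. immersion A (\<lambda>q. F q t))"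

definition velocity :: "('a \<Rightarrow> real \<Rightarrow> real ^ 'n) \<Rightarrow> real \<Rightarrow> 'a \<Rightarrow> real ^ 'n" where
  "velocity F t q = vector_derivative (F q) (at t)"

definition compact_variation ::
  "real \<Rightarrow> ('a::topological_space \<Rightarrow> real \<Rightarrow> real ^ 'n) \<Rightarrow> bool" where
  "compact_variation \<epsilon> F \<longleftrightarrow>
     (\<exists>B. open B \<and> compact (closure B) \<and>
          (\<forall>t\<in>{-\<epsilon><..<\<epsilon>}. closure {q. velocity F t q \<noteq> 0} \<subseteq> B))"

definition normal_variation ::
  "('a, 'm::finite) chart set \<Rightarrow> ('a \<Rightarrow> real ^ 'n) \<Rightarrow> ('a \<Rightarrow> real \<Rightarrow> real ^ 'n) \<Rightarrow> bool" where
  "normal_variation A x F \<longleftrightarrow> (\<forall>q. velocity F 0 q \<in> normal_space A x q)"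

text \<open>
  The derivative at \<open>t = 0\<close> of the weighted volume of \<open>x\<^sub>t\<close> exists and equals \<open>v\<close>. If the weighted
  volumes are infinite, this is by convention the integral of the derivative at \<open>t = 0\<close> of
  \<open>exp (- \<Phi> x\<^sub>t) dV\<^bsub>x\<^sub>t\<^esub>\<close>, the latter being written as a density with respect to \<open>dV\<^sub>x\<close>. Outside a
  relatively compact set a compact variation changes nothing, so the volumes are finite
  either for all \<open>t\<close> or for none.
\<close>

definition has_first_variation ::
  "('a::topological_space, 'm::finite) chart set \<Rightarrow> (('a \<Rightarrow> real ^ 'n) \<Rightarrow> 'a \<Rightarrow> real)
     \<Rightarrow> ('a \<Rightarrow> real ^ 'n) \<Rightarrow> real \<Rightarrow> ('a \<Rightarrow> real \<Rightarrow> real ^ 'n) \<Rightarrow> real \<Rightarrow> bool" where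
  "has_first_variation A \<Phi> x \<epsilon> F v \<longleftrightarrow>
     (if \<forall>t\<in>{-\<epsilon><..<\<epsilon>}. weighted_volume_finite A \<Phi> (\<lambda>q. F q t)
      then ((\<lambda>t. weighted_volume A \<Phi> (\<lambda>q. F q t)) has_real_derivative v) (at 0)
      else has_bochner_integral (volume_measure A x)
             (\<lambda>q. deriv (\<lambda>t. exp (- \<Phi> (\<lambda>q. F q t) q) * volume_ratio A x (\<lambda>q. F q t) q) 0) v)"

definition critical_point ::
  "('a::topological_space, 'm::finite) chart set \<Rightarrow> (('a \<Rightarrow> real ^ 'n) \<Rightarrow> 'a \<Rightarrow> real)
     \<Rightarrow> ('a \<Rightarrow> real ^ 'n) \<Rightarrow> bool" where
  "critical_point A \<Phi> x \<longleftrightarrow>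
     (\<forall>\<epsilon> F. variation A x \<epsilon> F \<and> compact_variation \<epsilon> F \<and> normal_variation A x F \<longrightarrow>
        has_first_variation A \<Phi> x \<epsilon> F 0)"

end

theory Submission
  imports Defs
begin

text \<open>
  For a compact normal variation with initial velocity \<open>W\<close>, Jacobi's formula and
  \<open>\<langle>\<partial>\<^sub>i W, \<partial>\<^sub>j x\<rangle> = - \<langle>W, \<partial>\<^sub>i \<partial>\<^sub>j x\<rangle>\<close> give
  \<open>V\<^sub>\<xi>'(0) = - \<integral> e\<^bsup>-f\<^esup> \<langle>W, H + x\<^sup>\<bottom> - \<xi>\<rangle> dV\<close>. The barred functional only changes the weight by a
  positive factor independent of \<open>t\<close>, so both are critical when \<open>H + x\<^sup>\<bottom> = \<xi>\<close>. Conversely, suppose that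
  \<open>h = H + x\<^sup>\<bottom> - \<xi>\<close> does not vanish at \<open>q\<^sub>0\<close>, and let \<open>v = h(q\<^sub>0)\<close>. The velocity \<open>W\<close> is taken to be
  a bump function times the normal part of \<open>v\<close>. The integrand is continuous, whatever chart is
  used to compute \<open>H\<close>, because it is also the \<open>t\<close>-derivative of the weighted volume density; a first
  variation of this kind thus shows \<open>\<langle>v, h\<rangle> > 0\<close> near \<open>q\<^sub>0\<close>, and a second one, supported there,
  has nonzero first variation.
\<close>

section \<open>Calculus of \<open>C\<^sup>k\<close> maps\<close>

text \<open>The volume measure is fixed only by a definite description, so before anything can be
  differentiated a Borel measure with the prescribed density in every chart must be shown to exist
  and to be unique; agreement of the charts on overlaps is the change of variables formula.
  Afterwards the volume measure of every \<open>x_t\<close> is a density with respect to that of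
  \<open>x\<close>, so the weighted volumes along a variation become integrals of one function
  \<open>\<psi> q t\<close> against a fixed measure. Outside a compact set \<open>\<psi>\<close> is
  constant in \<open>t\<close>; hence the difference quotients are dominated by a multiple of an
  indicator, and finite volumes lead to the very integral that the convention prescribes for
  infinite ones. The computation of the integrand needs the \<open>t\<close>-derivative of the
  coordinate vectors as a coordinate derivative of the velocity, so symmetry of second derivatives
  is proved for the present notion of smoothness, which rests on iterated directional
  derivatives.\<close>

lemma C_k_on_transform:
  assumes "open S" "\<And>x. x \<in> S \<Longrightarrow> f x = g x" "C_k_on k S f"
  shows "C_k_on k S g"
  using assms(2,3)
proof (induction k arbitrary: f g)
  case 0
  then show ?case using continuous_on_cong[of S S f g] by auto
next
  case (Suc k)
  have der: "(g has_derivative frechet_derivative f (at x)) (at x)" if "x \<in> S" for x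
    using Suc.prems that assms(1)
    by (auto intro!: has_derivative_transform_within_open[of f _ x UNIV S g]
        simp: frechet_derivative_works[symmetric])
  have eq: "frechet_derivative f (at x) = frechet_derivative g (at x)" if "x \<in> S" for x
    using der[OF that] by (rule frechet_derivative_at)
  show ?case
    unfolding C_k_on.simps
  proof (intro conjI ballI allI)
    show "g differentiable at x" if "x \<in> S" for x
      using der[OF that] by (rule differentiableI)
    show "C_k_on k S (\<lambda>x. frechet_derivative g (at x) v)" for v
      using Suc.IH[of "\<lambda>x. frechet_derivative f (at x) v" "\<lambda>x. frechet_derivative g (at x) v"]
        Suc.prems(2) eq by simp
  qed
qed

text \<open>Admits an explicit formula \<open>f'\<close> in place of
  \<open>frechet_derivative\<close>, so that each closure property below reduces to one
  differentiation rule and the induction hypothesis.\<close>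

lemma C_k_on_SucI:
  assumes "open S" "\<And>x. x \<in> S \<Longrightarrow> (f has_derivative f' x) (at x)"
    and "\<And>v. C_k_on k S (\<lambda>x. f' x v)"
  shows "C_k_on (Suc k) S f"
  unfolding C_k_on.simps
proof (intro conjI ballI allI)
  show "f differentiable at x" if "x \<in> S" for x
    using assms(2)[OF that] by (rule differentiableI)
  show "C_k_on k S (\<lambda>x. frechet_derivative f (at x) v)" for v
    by (rule C_k_on_transform[OF assms(1) _ assms(3)[of v]])
      (use assms(2) frechet_derivative_at in fastforce)
qed

lemma C_k_on_SucD: "C_k_on (Suc k) S f \<Longrightarrow> C_k_on k S f"
proof (induction k arbitrary: f)
  case 0
  then show ?case
    by (simp add: continuous_at_imp_continuous_on differentiable_imp_continuous_within)
next
  case (Suc k)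
  have "C_k_on k S (\<lambda>x. frechet_derivative f (at x) v)" for v
    using Suc.prems C_k_on.simps(2)[of "Suc k" S f] Suc.IH by blast
  then show ?case using Suc.prems by simp
qed

lemma C_k_on_has_derivative:
  "C_k_on (Suc k) S f \<Longrightarrow> x \<in> S \<Longrightarrow> (f has_derivative frechet_derivative f (at x)) (at x)"
  by (simp add: frechet_derivative_works[symmetric])

lemma C_k_on_subset: "C_k_on k S f \<Longrightarrow> T \<subseteq> S \<Longrightarrow> C_k_on k T f"
  by (induction k arbitrary: f) (auto intro: continuous_on_subset)

text \<open>Serves functions given by different formulas on different open sets, such as fields
  extended by zero.\<close>

lemma C_k_on_open_cover:
  assumes "\<And>x. x \<in> S \<Longrightarrow> \<exists>U. open U \<and> x \<in> U \<and> C_k_on k U f"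
  shows "C_k_on k S f"
  using assms
proof (induction k arbitrary: f)
  case 0
  show ?case
    unfolding C_k_on.simps
  proof (rule continuous_at_imp_continuous_on, rule ballI)
    fix x assume "x \<in> S"
    then obtain U where "open U" "x \<in> U" "continuous_on U f" using 0 by auto
    then show "isCont f x" by (simp add: continuous_on_eq_continuous_at)
  qed
next
  case (Suc k)
  show ?case
    unfolding C_k_on.simps
  proof (intro conjI ballI allI)
    fix x assume "x \<in> S"
    then show "f differentiable at x" using Suc.prems[of x] by auto
  next
    fix v
    show "C_k_on k S (\<lambda>x. frechet_derivative f (at x) v)"
    proof (rule Suc.IH)
      fix x assume "x \<in> S"
      from Suc.prems[OF this] obtain U where "open U" "x \<in> U" "C_k_on (Suc k) U f" by blast
      then show "\<exists>U. open U \<and> x \<in> U \<and> C_k_on k U (\<lambda>x. frechet_derivative f (at x) v)"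
        by auto
    qed
  qed
qed

lemma C_k_on_const: "open S \<Longrightarrow> C_k_on k S (\<lambda>x. c)"
proof (induction k arbitrary: c)
  case (Suc k)
  show ?case by (rule C_k_on_SucI[of _ _ "\<lambda>_ _. 0"]) (use Suc in auto)
qed simp

lemma C_k_on_bounded_linear:
  assumes "open S" "bounded_linear L" shows "C_k_on k S L"
proof (cases k)
  case 0
  then show ?thesis by (simp add: assms linear_continuous_on)
next
  case (Suc j)
  show ?thesis unfolding Suc
    by (rule C_k_on_SucI[of _ _ "\<lambda>_. L"])
      (use assms bounded_linear_imp_has_derivative C_k_on_const in auto)
qed

lemma C_k_on_add:
  assumes "open S" "C_k_on k S f" "C_k_on k S g"
  shows "C_k_on k S (\<lambda>x. f x + g x)"
  using assms(2,3)
proof (induction k arbitrary: f g)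
  case (Suc k)
  show ?case
    by (rule C_k_on_SucI[OF assms(1) has_derivative_add[OF C_k_on_has_derivative C_k_on_has_derivative],
          OF Suc.prems(1) _ Suc.prems(2)]) (use Suc in auto)
qed (auto intro: continuous_intros)

text \<open>One induction for products, scalar multiples and inner products: the Leibniz rule yields
  two terms of the same bilinear shape, and the factor left undifferentiated is lowered by one class
  to match.\<close>

lemma C_k_on_bilinear:
  assumes "bounded_bilinear h" "open S" "C_k_on k S f" "C_k_on k S g"
  shows "C_k_on k S (\<lambda>x. h (f x) (g x))"
  using assms(3,4)
proof (induction k arbitrary: f g)
  case 0
  then show ?case using bounded_bilinear.continuous_on[OF assms(1)] by auto
next
  case (Suc k)
  show ?case
  proof (rule C_k_on_SucI[OF assms(2)])
    show "((\<lambda>x. h (f x) (g x)) has_derivative (\<lambda>v. h (f x) (frechet_derivative g (at x) v)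
        + h (frechet_derivative f (at x) v) (g x))) (at x)" if "x \<in> S" for x
      by (rule bounded_bilinear.FDERIV[OF assms(1)])
        (rule C_k_on_has_derivative[OF _ that], rule Suc.prems)+
  next
    fix v
    show "C_k_on k S (\<lambda>x. h (f x) (frechet_derivative g (at x) v) + h (frechet_derivative f (at x) v) (g x))"
      using Suc.prems C_k_on_SucD[OF Suc.prems(1)] C_k_on_SucD[OF Suc.prems(2)]
      by (intro C_k_on_add assms Suc.IH) auto
  qed
qed

lemma C_k_on_linear_comp:
  assumes "bounded_linear L" "open S" "C_k_on k S f"
  shows "C_k_on k S (\<lambda>x. L (f x))"
  using assms(3)
proof (induction k arbitrary: f)
  case 0
  then show ?case using bounded_linear.continuous_on[OF assms(1)] by auto
next
  case (Suc k)
  show ?case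
    by (rule C_k_on_SucI[OF assms(2) bounded_linear.has_derivative[OF assms(1) C_k_on_has_derivative], OF Suc.prems])
      (use Suc in auto)
qed

lemma C_k_on_sum:
  assumes "open S" "\<And>i. i \<in> I \<Longrightarrow> C_k_on k S (f i)"
  shows "C_k_on k S (\<lambda>x. \<Sum>i\<in>I. f i x)"
  using assms(2) by (induction I rule: infinite_finite_induct) (auto intro: C_k_on_const C_k_on_add assms(1))

lemma C_k_on_prod:
  fixes f :: "'i \<Rightarrow> 'a::real_normed_vector \<Rightarrow> real"
  assumes "open S" "\<And>i. i \<in> I \<Longrightarrow> C_k_on k S (f i)"
  shows "C_k_on k S (\<lambda>x. \<Prod>i\<in>I. f i x)"
  using assms(2)
  by (induction I rule: infinite_finite_induct)
    (auto intro: C_k_on_const C_k_on_bilinear[OF bounded_bilinear_mult] assms(1))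

text \<open>In the chain rule both the base point and the direction of the derivative of
  \<open>f\<close> vary, whereas the definition of \<open>C_k_on\<close> speaks of fixed directions.
  Expanding the direction in the Euclidean basis leaves coordinates of the derivative of
  \<open>g\<close> times fixed directional derivatives of \<open>f\<close> composed with
  \<open>g\<close>, to which the induction hypothesis applies.\<close>

lemma C_k_on_compose:
  fixes f :: "'b::euclidean_space \<Rightarrow> 'c::real_normed_vector"
  assumes S: "open S" and T: "open T" and gST: "g ` S \<subseteq> T" and "C_k_on k S g" "C_k_on k T f"
  shows "C_k_on k S (\<lambda>x. f (g x))"
  using assms(4,5)
proof (induction k arbitrary: f)
  case 0
  then show ?case using continuous_on_compose2[of T f S g] gST by auto
next
  case (Suc k)
  let ?f = "\<lambda>y. frechet_derivative f (at y)" and ?g = "\<lambda>x. frechet_derivative g (at x)"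
  show ?case
  proof (rule C_k_on_SucI[OF S])
    fix x assume x: "x \<in> S"
    show "((\<lambda>x. f (g x)) has_derivative (\<lambda>v. \<Sum>i\<in>Basis. (?g x v \<bullet> i) *\<^sub>R ?f (g x) i)) (at x)"
    proof -
      have f: "(f has_derivative ?f (g x)) (at (g x))"
        using C_k_on_has_derivative[OF Suc.prems(2)] gST x by auto
      have "((\<lambda>x. f (g x)) has_derivative (\<lambda>v. ?f (g x) (?g x v))) (at x)"
        by (rule has_derivative_compose[OF C_k_on_has_derivative[OF Suc.prems(1) x] f])
      moreover have "?f (g x) (?g x v) = (\<Sum>i\<in>Basis. (?g x v \<bullet> i) *\<^sub>R ?f (g x) i)" for v
        using linear_sum[OF has_derivative_linear[OF f], of "\<lambda>i. (?g x v \<bullet> i) *\<^sub>R i" Basis]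
          linear_cmul[OF has_derivative_linear[OF f]]
        by (simp add: euclidean_representation)
      ultimately show ?thesis by simp
    qed
  next
    fix v
    show "C_k_on k S (\<lambda>x. \<Sum>i\<in>Basis. (?g x v \<bullet> i) *\<^sub>R ?f (g x) i)"
      using Suc.prems C_k_on_SucD[OF Suc.prems(1)]
      by (intro C_k_on_sum S C_k_on_bilinear[OF bounded_bilinear_scaleR]
          C_k_on_linear_comp[OF bounded_linear_inner_left] Suc.IH) auto
  qed
qed

text \<open>The second difference is symmetric in the two directions, so its limit gives the symmetry of
  second derivatives.\<close>

lemma second_difference_limit:
  fixes f :: "'a::real_normed_vector \<Rightarrow> real"
  assumes S: "open S" "x \<in> S" and f: "C_k_on 2 S f"
  defines "D \<equiv> \<lambda>v y. frechet_derivative f (at y) v"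
  shows "((\<lambda>s. (f (x + s *\<^sub>R v + s *\<^sub>R w) - f (x + s *\<^sub>R v) - f (x + s *\<^sub>R w) + f x) / s\<^sup>2)
     \<longlongrightarrow> frechet_derivative (D v) (at x) w) (at_right 0)"
proof -
  have f1: "C_k_on (Suc (Suc 0)) S f" using f by (simp add: numeral_2_eq_2)
  have Df: "(f has_derivative (\<lambda>v. D v y)) (at y)" if "y \<in> S" for y
    using C_k_on_has_derivative[OF f1 that] by (simp add: D_def)
  have D1: "C_k_on (Suc 0) S (D v)" using f1 by (simp add: D_def)
  have DD: "(D v has_derivative frechet_derivative (D v) (at y)) (at y)" if "y \<in> S" for y
    using C_k_on_has_derivative[OF D1 that] .
  have cont: "continuous_on S (\<lambda>y. frechet_derivative (D v) (at y) w)"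
    using D1 by simp
  have line: "((\<lambda>\<sigma>. g (a + \<sigma> *\<^sub>R u)) has_real_derivative g' u) (at \<sigma>)"
    if "(g has_derivative g') (at (a + \<sigma> *\<^sub>R u))" for g :: "'a \<Rightarrow> real" and g' a u \<sigma>
  proof -
    have "((\<lambda>\<sigma>. a + \<sigma> *\<^sub>R u) has_derivative (\<lambda>h. h *\<^sub>R u)) (at \<sigma>)"
      by (auto intro!: derivative_eq_intros)
    from has_derivative_compose[OF this that]
    have "((\<lambda>\<sigma>. g (a + \<sigma> *\<^sub>R u)) has_derivative (\<lambda>h. g' (h *\<^sub>R u))) (at \<sigma>)" .
    moreover have "(\<lambda>h. g' (h *\<^sub>R u)) = (*) (g' u)"
      using linear_cmul[OF has_derivative_linear[OF that]] by (auto simp: mult.commute)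
    ultimately show ?thesis by (simp add: has_field_derivative_def)
  qed
  show ?thesis
    unfolding tendsto_iff
  proof (intro allI impI)
    fix e :: real assume "e > 0"
    have "continuous (at x) (\<lambda>y. frechet_derivative (D v) (at y) w)"
      using cont S by (simp add: continuous_on_eq_continuous_at)
    then obtain d1 where d1: "d1 > 0" "\<And>y. dist y x < d1 \<Longrightarrow>
        dist (frechet_derivative (D v) (at y) w) (frechet_derivative (D v) (at x) w) < e"
      using \<open>e > 0\<close> unfolding continuous_at_eps_delta by blast
    obtain d2 where d2: "d2 > 0" "ball x d2 \<subseteq> S" using S openE by blast
    \<comment> \<open>For \<open>s < d\<close> the parallelogram spanned at \<open>x\<close> by
      \<open>s *\<^sub>R v\<close> and \<open>s *\<^sub>R w\<close> stays within
      \<open>min d1 d2\<close> of \<open>x\<close>; the summand 1 keeps the denominator positive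
      when both directions vanish.\<close>
    define d where "d = min d1 d2 / (norm v + norm w + 1)"
    have nz: "norm v + norm w + 1 > 0" by (smt (verit) norm_ge_zero)
    have "d > 0" using d1 d2 nz by (simp add: d_def)
    show "\<forall>\<^sub>F s in at_right 0. dist ((f (x + s *\<^sub>R v + s *\<^sub>R w) - f (x + s *\<^sub>R v) - f (x + s *\<^sub>R w) + f x) / s\<^sup>2)
        (frechet_derivative (D v) (at x) w) < e"
      unfolding eventually_at_right_field
    proof (intro exI conjI allI impI)
      show "d > 0" by fact
      fix s assume s: "0 < s" "s < d"
      have near: "dist (x + \<sigma> *\<^sub>R v + \<tau> *\<^sub>R w) x < min d1 d2" if "0 \<le> \<sigma>" "\<sigma> \<le> s" "0 \<le> \<tau>" "\<tau> \<le> s" for \<sigma> \<tau>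
      proof -
        have "dist (x + \<sigma> *\<^sub>R v + \<tau> *\<^sub>R w) x = norm (\<sigma> *\<^sub>R v + \<tau> *\<^sub>R w)"
          by (simp add: dist_norm algebra_simps)
        also have "\<dots> \<le> \<sigma> * norm v + \<tau> * norm w"
          using norm_triangle_ineq[of "\<sigma> *\<^sub>R v" "\<tau> *\<^sub>R w"] that by simp
        also have "\<dots> \<le> s * norm v + s * norm w"
          using that by (intro add_mono mult_right_mono) auto
        also have "\<dots> < d * (norm v + norm w + 1)"
        proof -
          have "s * (norm v + norm w + 1) < d * (norm v + norm w + 1)"
            using s nz by (intro mult_strict_right_mono) auto
          then show ?thesis using s by (simp add: algebra_simps)
        qed
        also have "\<dots> = min d1 d2" using nz by (simp add: d_def)
        finally show ?thesis .
      qed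
      have inS: "x + \<sigma> *\<^sub>R v + \<tau> *\<^sub>R w \<in> S" if "0 \<le> \<sigma>" "\<sigma> \<le> s" "0 \<le> \<tau>" "\<tau> \<le> s" for \<sigma> \<tau>
        using near[OF that] d2(2) by (auto simp: dist_commute subset_eq)
      \<comment> \<open>The increment of \<open>g\<close> over \<open>[0, s]\<close> is the second
        difference. The mean value theorem is applied to it in direction \<open>v\<close>, then to
        the resulting first derivative in direction \<open>w\<close>.\<close>
      define g where "g \<sigma> = f (x + s *\<^sub>R w + \<sigma> *\<^sub>R v) - f (x + \<sigma> *\<^sub>R v)" for \<sigma>
      have g': "(g has_real_derivative D v (x + s *\<^sub>R w + \<sigma> *\<^sub>R v) - D v (x + \<sigma> *\<^sub>R v)) (at \<sigma>)"
        if "0 \<le> \<sigma>" "\<sigma> \<le> s" for \<sigma>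
        unfolding g_def
        by (intro DERIV_diff line[where g=f and g'="\<lambda>v. D v y" for y] Df)
          (use inS[OF that, of 0] inS[OF that, of s] s in \<open>auto simp: algebra_simps\<close>)
      from MVT2[OF s(1), of g, OF g'] obtain \<sigma> where \<sigma>: "0 < \<sigma>" "\<sigma> < s"
        "g s - g 0 = s * (D v (x + s *\<^sub>R w + \<sigma> *\<^sub>R v) - D v (x + \<sigma> *\<^sub>R v))"
        by auto
      have h': "((\<lambda>\<tau>. D v (x + \<sigma> *\<^sub>R v + \<tau> *\<^sub>R w)) has_real_derivative
          frechet_derivative (D v) (at (x + \<sigma> *\<^sub>R v + \<tau> *\<^sub>R w)) w) (at \<tau>)" if "0 \<le> \<tau>" "\<tau> \<le> s" for \<tau>
        by (intro line DD inS) (use \<sigma> that in auto)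
      from MVT2[OF s(1), of "\<lambda>\<tau>. D v (x + \<sigma> *\<^sub>R v + \<tau> *\<^sub>R w)", OF h'] obtain \<tau> where \<tau>: "0 < \<tau>" "\<tau> < s"
        "D v (x + \<sigma> *\<^sub>R v + s *\<^sub>R w) - D v (x + \<sigma> *\<^sub>R v) =
           s * frechet_derivative (D v) (at (x + \<sigma> *\<^sub>R v + \<tau> *\<^sub>R w)) w"
        by auto
      have "f (x + s *\<^sub>R v + s *\<^sub>R w) - f (x + s *\<^sub>R v) - f (x + s *\<^sub>R w) + f x = g s - g 0"
        by (simp add: g_def algebra_simps)
      also have "\<dots> = s * (s * frechet_derivative (D v) (at (x + \<sigma> *\<^sub>R v + \<tau> *\<^sub>R w)) w)"
        using \<sigma>(3) \<tau>(3) by (simp add: algebra_simps)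
      finally have "(f (x + s *\<^sub>R v + s *\<^sub>R w) - f (x + s *\<^sub>R v) - f (x + s *\<^sub>R w) + f x) / s\<^sup>2
          = frechet_derivative (D v) (at (x + \<sigma> *\<^sub>R v + \<tau> *\<^sub>R w)) w"
        using s by (simp add: power2_eq_square)
      then show "dist ((f (x + s *\<^sub>R v + s *\<^sub>R w) - f (x + s *\<^sub>R v) - f (x + s *\<^sub>R w) + f x) / s\<^sup>2)
          (frechet_derivative (D v) (at x) w) < e"
        using d1(2) near[of \<sigma> \<tau>] \<sigma> \<tau> by simp
    qed
  qed
qed

lemma second_derivative_symmetric_real:
  fixes f :: "'a::real_normed_vector \<Rightarrow> real"
  assumes "open S" "x \<in> S" "C_k_on 2 S f"
  shows "frechet_derivative (\<lambda>y. frechet_derivative f (at y) v) (at x) w =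
         frechet_derivative (\<lambda>y. frechet_derivative f (at y) w) (at x) v"
proof (rule tendsto_unique)
  have eq: "f (x + s *\<^sub>R w + s *\<^sub>R v) - f (x + s *\<^sub>R w) - f (x + s *\<^sub>R v) + f x =
      f (x + s *\<^sub>R v + s *\<^sub>R w) - f (x + s *\<^sub>R v) - f (x + s *\<^sub>R w) + f x" for s
    by (simp add: add.assoc add.commute[of "s *\<^sub>R v"])
  show "((\<lambda>s. (f (x + s *\<^sub>R v + s *\<^sub>R w) - f (x + s *\<^sub>R v) - f (x + s *\<^sub>R w) + f x) / s\<^sup>2)
     \<longlongrightarrow> frechet_derivative (\<lambda>y. frechet_derivative f (at y) w) (at x) v) (at_right 0)"
    by (rule second_difference_limit[OF assms, of w v, unfolded eq])
qed (use second_difference_limit[OF assms, of v w] in auto)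

lemma second_derivative_symmetric:
  fixes f :: "'a::real_normed_vector \<Rightarrow> 'b::real_inner"
  assumes S: "open S" "x \<in> S" and f: "C_k_on 2 S f"
  shows "frechet_derivative (\<lambda>y. frechet_derivative f (at y) v) (at x) w =
         frechet_derivative (\<lambda>y. frechet_derivative f (at y) w) (at x) v" (is "?l = ?r")
proof -
  have f2: "C_k_on (Suc (Suc 0)) S f" using f by (simp add: numeral_2_eq_2)
  \<comment> \<open>Pairing with a fixed vector commutes with both differentiations, which reduces
    the claim to real-valued functions.\<close>
  have inner: "frechet_derivative (\<lambda>y. frechet_derivative (\<lambda>y. f y \<bullet> b) (at y) v) (at x) w
     = frechet_derivative (\<lambda>y. frechet_derivative f (at y) v) (at x) w \<bullet> b" for v w b
  proof -
    have 1: "((\<lambda>y. f y \<bullet> b) has_derivative (\<lambda>v. frechet_derivative f (at y) v \<bullet> b)) (at y)" if "y \<in> S" for y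
      by (rule has_derivative_inner_left[OF C_k_on_has_derivative[OF f2 that]])
    have C: "C_k_on (Suc 0) S (\<lambda>y. frechet_derivative f (at y) v)" using f2 by simp
    have 2: "((\<lambda>y. frechet_derivative f (at y) v \<bullet> b) has_derivative
       (\<lambda>w. frechet_derivative (\<lambda>y. frechet_derivative f (at y) v) (at x) w \<bullet> b)) (at x)"
      by (rule has_derivative_inner_left[OF C_k_on_has_derivative[OF C S(2)]])
    have "((\<lambda>y. frechet_derivative (\<lambda>y. f y \<bullet> b) (at y) v) has_derivative
       (\<lambda>w. frechet_derivative (\<lambda>y. frechet_derivative f (at y) v) (at x) w \<bullet> b)) (at x)"
      by (rule has_derivative_transform_within_open[OF 2 S])
        (use frechet_derivative_at[OF 1] in metis)
    from frechet_derivative_at[OF this] show ?thesis by metis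
  qed
  have "?l \<bullet> b = ?r \<bullet> b" for b
    unfolding inner[symmetric]
    by (rule second_derivative_symmetric_real[OF S])
      (rule C_k_on_linear_comp[OF bounded_linear_inner_left S(1) f])
  then show ?thesis by (metis vector_eq_rdot)
qed

text \<open>The powers in the denominator make the family closed under differentiation.\<close>

definition flat_fun :: "nat \<Rightarrow> real \<Rightarrow> real" where
  "flat_fun n t = (if 0 < t then exp (- inverse t) / t ^ n else 0)"

text \<open>From the right, putting \<open>s = 1/t\<close> turns this into the decay of
  \<open>s^n / exp s\<close> at infinity.\<close>

lemma flat_fun_tendsto: "(flat_fun n \<longlongrightarrow> 0) (at 0)"
proof -
  have "((\<lambda>t. inverse t ^ n / exp (inverse t)) \<longlongrightarrow> 0) (at_right (0::real))"
    by (rule filterlim_compose[OF tendsto_power_div_exp_0 filterlim_inverse_at_top_right])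
  then have "(flat_fun n \<longlongrightarrow> 0) (at_right 0)"
    by (rule Lim_transform_eventually)
      (auto simp: flat_fun_def eventually_at_filter exp_minus field_simps)
  moreover have "(flat_fun n \<longlongrightarrow> 0) (at_left 0)"
    by (rule Lim_transform_eventually[OF tendsto_const])
      (auto simp: flat_fun_def eventually_at_filter)
  ultimately show ?thesis by (simp add: filterlim_at_split)
qed

lemma flat_fun_has_derivative:
  "(flat_fun n has_real_derivative flat_fun (n + 2) t - real n * flat_fun (n + 1) t) (at t)"
proof (cases t "0::real" rule: linorder_cases)
  case less
  have "((\<lambda>_. 0) has_real_derivative 0) (at t)" by simp
  then have "(flat_fun n has_real_derivative 0) (at t)"
    by (rule has_field_derivative_transform_within_open[where S="{..<0}"]) (use less in \<open>auto simp: flat_fun_def\<close>)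
  then show ?thesis using less by (simp add: flat_fun_def)
next
  case equal
  \<comment> \<open>At 0 the difference quotient of \<open>flat_fun n\<close> is
    \<open>flat_fun (Suc n)\<close>, whose limit is known.\<close>
  have "(\<lambda>h. (flat_fun n (0 + h) - flat_fun n 0) / h) \<midarrow>0\<rightarrow> 0"
    by (rule Lim_transform_eventually[OF flat_fun_tendsto[of "Suc n"]])
      (auto simp: flat_fun_def eventually_at_filter field_simps)
  then show ?thesis using equal by (simp add: DERIV_def flat_fun_def)
next
  case greater
  have "((\<lambda>t. exp (- inverse t) / t ^ n) has_real_derivative
      flat_fun (n + 2) t - real n * flat_fun (n + 1) t) (at t)"
    using greater
    apply (auto intro!: derivative_eq_intros simp: flat_fun_def)
    apply (cases n)
    apply (auto simp: field_simps power2_eq_square)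
    done
  then show ?thesis
    by (rule has_field_derivative_transform_within_open[where S="{0<..}"]) (use greater in \<open>auto simp: flat_fun_def\<close>)
qed

lemma C_k_on_flat_fun: "C_k_on k UNIV (flat_fun n)"
proof (induction k arbitrary: n)
  case 0
  show ?case
    by (auto intro!: continuous_at_imp_continuous_on DERIV_isCont flat_fun_has_derivative)
next
  case (Suc k)
  show ?case
  proof (rule C_k_on_SucI)
    fix t :: real
    show "(flat_fun n has_derivative (\<lambda>v. v * (flat_fun (n + 2) t + - real n * flat_fun (n + 1) t))) (at t)"
      using flat_fun_has_derivative[of n t]
      by (rule has_derivative_eq_rhs[OF has_field_derivative_imp_has_derivative]) (simp add: fun_eq_iff)
  next
    fix v
    show "C_k_on k UNIV (\<lambda>x. v * (flat_fun (n + 2) x + - real n * flat_fun (n + 1) x))"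
      by (intro C_k_on_bilinear[OF bounded_bilinear_mult] C_k_on_add C_k_on_const Suc.IH) auto
  qed simp
qed

section \<open>Change of variables over an arbitrary finite index type\<close>

text \<open>The change of variables theorem of the library needs a well-ordered index type; an arbitrary
  finite index type is replaced by a well-ordered copy of it.\<close>

typedef ('i::finite) ordcopy = "{..<CARD('i)}"
  by (rule exI[of _ 0]) simp

instantiation ordcopy :: (finite) linorder
begin
definition less_eq_ordcopy :: "'a ordcopy \<Rightarrow> 'a ordcopy \<Rightarrow> bool" where
  "less_eq_ordcopy a b \<longleftrightarrow> Rep_ordcopy a \<le> Rep_ordcopy b"
definition less_ordcopy :: "'a ordcopy \<Rightarrow> 'a ordcopy \<Rightarrow> bool" where
  "less_ordcopy a b \<longleftrightarrow> Rep_ordcopy a < Rep_ordcopy b"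
instance by standard (auto simp: less_eq_ordcopy_def less_ordcopy_def Rep_ordcopy_inject)
end

instance ordcopy :: (finite) finite
proof
  show "finite (UNIV :: 'a ordcopy set)"
    by (rule finite_surj[OF finite_lessThan equalityD1[OF type_definition.univ[OF type_definition_ordcopy]]])
qed

instance ordcopy :: (finite) wellorder
proof
  fix P :: "'a ordcopy \<Rightarrow> bool" and a
  assume step: "\<And>x. (\<And>y. y < x \<Longrightarrow> P y) \<Longrightarrow> P x"
  show "P a"
  proof (induction "Rep_ordcopy a" arbitrary: a rule: less_induct)
    case less
    then show ?case using step by (simp add: less_ordcopy_def)
  qed
qed

lemma ex_bij_ordcopy: "\<exists>b :: 'i::finite \<Rightarrow> 'i ordcopy. bij b"
proof -
  have "card (UNIV :: 'i ordcopy set) = CARD('i)"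
    using type_definition.card[OF type_definition_ordcopy] by simp
  then show ?thesis
    using finite_same_card_bij[of "UNIV :: 'i set" "UNIV :: 'i ordcopy set"] by auto
qed

section \<open>Determinants and Lebesgue measure under a relabelling of coordinates\<close>

text \<open>Conjugation by \<open>c\<close> carries the permutations of one index type bijectively
  to those of the other and preserves signs, so the two Leibniz sums agree term by term. Conjugation
  by \<open>inv c\<close> gives surjectivity.\<close>

lemma det_reindex:
  fixes A :: "'a::comm_ring_1^'m^'m" and c :: "'w::finite \<Rightarrow> 'm::finite"
  assumes c: "bij c"
  shows "det (\<chi> k l. A $ c k $ c l) = det A"
proof -
  let ?M = "map_permutation UNIV c"
  have app: "?M p (c x) = c (p x)" for p x
    using c by (simp add: map_permutation_apply bij_is_inj)
  have perm: "?M p permutes UNIV" if "p permutes UNIV" for p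
    using map_permutation_permutes[of c UNIV UNIV p] c that by simp
  have "det (\<chi> k l. A $ c k $ c l) =
      (\<Sum>p | p permutes UNIV. of_int (sign (?M p)) * (\<Prod>i\<in>UNIV. A $ i $ ?M p i))"
    unfolding det_def
  proof (rule sum.cong[OF refl])
    fix p :: "'w \<Rightarrow> 'w" assume "p \<in> {p. p permutes UNIV}"
    then have p: "p permutes UNIV" by simp
    have "sign (?M p) = sign p"
      using sign_map_permutation[of c UNIV p] c p by (simp add: bij_is_inj)
    moreover have "(\<Prod>i\<in>UNIV. A $ i $ ?M p i) = (\<Prod>k\<in>UNIV. A $ c k $ c (p k))"
      using prod.reindex_bij_betw[OF c, of "\<lambda>i. A $ i $ ?M p i"] by (simp add: app)
    ultimately show "of_int (sign p) * (\<Prod>i\<in>UNIV. (\<chi> k l. A $ c k $ c l) $ i $ p i) =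
        of_int (sign (?M p)) * (\<Prod>i\<in>UNIV. A $ i $ ?M p i)"
      by simp
  qed
  also have "\<dots> = det A"
    unfolding det_def
  proof (rule sum.reindex_bij_betw)
    have "inj_on ?M {p. p permutes UNIV}"
    proof (rule inj_onI)
      fix p q assume "?M p = ?M q"
      then have "c (p x) = c (q x)" for x using app by metis
      then show "p = q" using c by (auto simp: fun_eq_iff bij_def dest: injD)
    qed
    moreover have "r \<in> ?M ` {p. p permutes UNIV}" if "r permutes UNIV" for r
    proof -
      let ?q = "map_permutation UNIV (inv c) r"
      have q: "?q permutes UNIV"
        using map_permutation_permutes[of "inv c" UNIV UNIV r] c that by (simp add: bij_imp_bij_inv)
      have "?M ?q y = r y" for y
      proof -
        have "?q (inv c y) = inv c (r y)"
          using c by (intro map_permutation_apply) (auto simp: bij_imp_bij_inv bij_is_inj)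
        then have "?M ?q (c (inv c y)) = c (inv c (r y))" by (simp only: app)
        then show ?thesis using c by (simp add: bij_is_surj surj_f_inv_f)
      qed
      then show ?thesis using q by (intro image_eqI[of _ _ ?q]) (auto simp: fun_eq_iff)
    qed
    ultimately show "bij_betw ?M {p. p permutes UNIV} {p. p permutes UNIV}"
      using perm by (auto simp: bij_betw_def)
  qed
  finally show ?thesis .
qed

lemma prod_Basis_vec: "(\<Prod>b\<in>Basis. (v::real^'m) \<bullet> b) = (\<Prod>i\<in>UNIV. v $ i)"
proof -
  have "(Basis :: (real^'m) set) = range (\<lambda>i. axis i 1)" by (auto simp: Basis_vec_def)
  moreover have "inj (\<lambda>i::'m. axis i (1::real))" by (auto simp: inj_on_def axis_eq_axis)
  ultimately show ?thesis
    using prod.reindex[of "\<lambda>i::'m. axis i (1::real)" UNIV "\<lambda>b. v \<bullet> b"] by (simp add: o_def inner_axis)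
qed

lemma linear_vec_reindex: "linear (\<lambda>v::real^'m. (\<chi> k. v $ c k) :: real^'w)"
  by (rule linearI) (auto simp: vec_eq_iff)

text \<open>Lebesgue measure is characterized by its values on boxes, and relabelling coordinates
  merely permutes the side lengths of a box.\<close>

lemma lborel_vec_reindex:
  fixes c :: "'w::finite \<Rightarrow> 'm::finite"
  assumes c: "bij c"
  shows "distr lborel borel (\<lambda>v::real^'m. (\<chi> k. v $ c k) :: real^'w) = lborel"
proof (rule lborel_eqI[symmetric])
  let ?\<phi> = "\<lambda>v::real^'m. (\<chi> k. v $ c k) :: real^'w" and ?\<psi> = "\<lambda>w::real^'w. (\<chi> i. w $ inv c i) :: real^'m"
  have m: "?\<phi> \<in> borel_measurable borel"
    using linear_vec_reindex by (intro borel_measurable_continuous_onI linear_continuous_on)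
      (simp add: linear_conv_bounded_linear)
  have all: "(\<forall>i. P (c i) i) \<longleftrightarrow> (\<forall>i. P i (inv c i))" for P
    using c by (metis bij_inv_eq_iff)
  fix l u :: "real^'w" assume le: "\<And>b. b \<in> Basis \<Longrightarrow> l \<bullet> b \<le> u \<bullet> b"
  have vi: "?\<phi> -` box l u = box (?\<psi> l) (?\<psi> u)"
    unfolding set_eq_iff vimage_eq mem_box_cart vec_lambda_beta
  proof (intro allI)
    fix x show "(\<forall>i. l $ i < x $ c i \<and> x $ c i < u $ i) \<longleftrightarrow>
        (\<forall>i. l $ inv c i < x $ i \<and> x $ i < u $ inv c i)"
      using all[of "\<lambda>i j. l $ j < x $ i \<and> x $ i < u $ j"] .
  qed
  have "emeasure (distr lborel borel ?\<phi>) (box l u) = emeasure lborel (box (?\<psi> l) (?\<psi> u))"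
    using m by (simp add: emeasure_distr vi)
  also have "\<dots> = (\<Prod>b\<in>Basis. (?\<psi> u - ?\<psi> l) \<bullet> b)"
  proof (rule emeasure_lborel_box)
    have "l $ k \<le> u $ k" for k using le[of "axis k 1"] by (simp add: inner_axis axis_in_Basis_iff)
    then show "?\<psi> l \<bullet> b \<le> ?\<psi> u \<bullet> b" if "b \<in> Basis" for b
      using that by (auto simp: Basis_vec_def inner_axis)
  qed
  also have "(\<Prod>b\<in>Basis. (?\<psi> u - ?\<psi> l) \<bullet> b) = (\<Prod>i\<in>UNIV. (u - l) $ inv c i)"
    unfolding prod_Basis_vec by simp
  also have "\<dots> = (\<Prod>k\<in>UNIV. (u - l) $ k)"
    using prod.reindex_bij_betw[OF bij_imp_bij_inv[OF c], of "\<lambda>k. (u - l) $ k"] .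
  finally show "emeasure (distr lborel borel ?\<phi>) (box l u) = ennreal (\<Prod>b\<in>Basis. (u - l) \<bullet> b)"
    unfolding prod_Basis_vec .
qed simp

lemma nn_integral_vec_reindex:
  fixes c :: "'w::finite \<Rightarrow> 'm::finite"
  assumes c: "bij c" and h: "h \<in> borel_measurable borel"
  shows "(\<integral>\<^sup>+ w. h w \<partial>lborel) = (\<integral>\<^sup>+ v. h (\<chi> k. (v::real^'m) $ c k) \<partial>lborel)"
proof -
  have "(\<lambda>v::real^'m. (\<chi> k. v $ c k) :: real^'w) \<in> borel_measurable borel"
    using linear_vec_reindex by (intro borel_measurable_continuous_onI linear_continuous_on)
      (simp add: linear_conv_bounded_linear)
  then have "(\<integral>\<^sup>+ w. h w \<partial>distr lborel borel (\<lambda>v::real^'m. (\<chi> k. v $ c k) :: real^'w)) =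
      (\<integral>\<^sup>+ v. h (\<chi> k. (v::real^'m) $ c k) \<partial>lborel)"
    by (intro nn_integral_distr) (use h in auto)
  then show ?thesis unfolding lborel_vec_reindex[OF c] .
qed

section \<open>Change of variables for nonnegative integrals\<close>

text \<open>Translates between absolute integrability with respect to completed Lebesgue measure,
  the language of the change of variables theorem, and nonnegative integrals over
  \<open>lborel\<close>, the language of the volume measure. Borel measurability of the integrand
  makes the completion harmless.\<close>

lemma absolutely_integrable_on_iff_nn_integral:
  fixes h :: "'a::euclidean_space \<Rightarrow> real"
  assumes S: "S \<in> sets borel" and h: "(\<lambda>x. indicator S x * h x) \<in> borel_measurable borel"
    and nonneg: "\<And>x. x \<in> S \<Longrightarrow> 0 \<le> h x"
  shows "h absolutely_integrable_on S \<longleftrightarrow> (\<integral>\<^sup>+ x\<in>S. ennreal (h x) \<partial>lborel) < \<infinity>"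
    and "h absolutely_integrable_on S \<Longrightarrow> ennreal (integral S h) = (\<integral>\<^sup>+ x\<in>S. ennreal (h x) \<partial>lborel)"
proof -
  let ?k = "\<lambda>x. indicator S x *\<^sub>R h x"
  have h': "?k \<in> borel_measurable lborel" using h by simp
  have eq: "ennreal (?k x) = ennreal (h x) * indicator S x" for x
    by (cases "x \<in> S") auto
  have nn: "0 \<le> ?k x" for x using nonneg by (cases "x \<in> S") auto
  have int_eq: "(\<integral>\<^sup>+ x. ennreal (?k x) \<partial>lborel) = (\<integral>\<^sup>+ x\<in>S. ennreal (h x) \<partial>lborel)"
    by (rule nn_integral_cong) (rule eq)
  have norm_eq: "(\<integral>\<^sup>+ x. ennreal (norm (?k x)) \<partial>lborel) = (\<integral>\<^sup>+ x\<in>S. ennreal (h x) \<partial>lborel)"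
    unfolding int_eq[symmetric] by (rule nn_integral_cong) (simp only: real_norm_def abs_of_nonneg[OF nn])
  have iff: "h absolutely_integrable_on S \<longleftrightarrow> integrable lborel ?k"
    unfolding set_integrable_def by (rule integrable_completion[OF h'])
  show "h absolutely_integrable_on S \<longleftrightarrow> (\<integral>\<^sup>+ x\<in>S. ennreal (h x) \<partial>lborel) < \<infinity>"
    unfolding iff integrable_iff_bounded norm_eq using h' by blast
  assume int: "h absolutely_integrable_on S"
  have "integral S h = integral\<^sup>L lebesgue ?k"
    using set_lebesgue_integral_eq_integral(2)[OF int] by (simp only: set_lebesgue_integral_def)
  also have "\<dots> = integral\<^sup>L lborel ?k"
    by (rule integral_completion[OF h'])
  finally show "ennreal (integral S h) = (\<integral>\<^sup>+ x\<in>S. ennreal (h x) \<partial>lborel)"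
    using nn_integral_eq_integral[OF int[unfolded iff], OF AE_I2, OF nn] unfolding int_eq by simp
qed

text \<open>The classical theorem transfers both integrability and the value of the integral. If one
  side is not integrable then neither is the other, and for nonnegative functions this means that
  both integrals are infinite.\<close>

lemma nn_integral_change_of_variables_wellorder:
  fixes f :: "real^'w::{finite,wellorder} \<Rightarrow> real" and g :: "real^'w::_ \<Rightarrow> real^'w::_"
  assumes S: "S \<in> sets borel" and gS: "g ` S \<in> sets borel"
    and der: "\<And>x. x \<in> S \<Longrightarrow> (g has_derivative g' x) (at x within S)"
    and inj: "inj_on g S"
    and nonneg: "\<And>y. y \<in> g ` S \<Longrightarrow> 0 \<le> f y"
    and mf: "(\<lambda>y. indicator (g ` S) y * f y) \<in> borel_measurable borel"
    and mh: "(\<lambda>x. indicator S x * (\<bar>det (matrix (g' x))\<bar> * f (g x))) \<in> borel_measurable borel"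
  shows "(\<integral>\<^sup>+ y\<in>g ` S. ennreal (f y) \<partial>lborel) =
    (\<integral>\<^sup>+ x\<in>S. ennreal (\<bar>det (matrix (g' x))\<bar> * f (g x)) \<partial>lborel)"
proof -
  \<comment> \<open>The scalar function is read as a map into \<open>real^1\<close>, since the
    theorem is about vector-valued integrands.\<close>
  let ?F = "\<lambda>y. vec (f y) :: real^1" and ?h = "\<lambda>x. \<bar>det (matrix (g' x))\<bar> * f (g x)"
  have SL: "S \<in> sets lebesgue" using S by auto
  have vec: "\<bar>det (matrix (g' x))\<bar> *\<^sub>R ?F (g x) = vec (?h x)" for x
    by (simp add: vec_eq_iff)
  have cov: "?h absolutely_integrable_on S \<and> integral S ?h = b \<longleftrightarrow>
      f absolutely_integrable_on (g ` S) \<and> integral (g ` S) f = b" for b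
    using has_absolute_integral_change_of_variables[OF SL der inj, of ?F "vec b"]
    unfolding vec absolutely_integrable_on_1_iff integral_on_1_eq by simp
  have nnh: "\<And>x. x \<in> S \<Longrightarrow> 0 \<le> ?h x" using nonneg by auto
  note F = absolutely_integrable_on_iff_nn_integral[OF gS mf]
    and H = absolutely_integrable_on_iff_nn_integral[OF S mh]
  show ?thesis
  proof (cases "?h absolutely_integrable_on S")
    case True
    then have f: "f absolutely_integrable_on (g ` S)" "integral (g ` S) f = integral S ?h"
      using cov by blast+
    show ?thesis using F(2)[OF _ f(1)] H(2)[OF _ True] f(2) nonneg by simp
  next
    case False
    then have "\<not> f absolutely_integrable_on (g ` S)" using cov by blast
    then have "(\<integral>\<^sup>+ y\<in>g ` S. ennreal (f y) \<partial>lborel) = \<infinity>" "(\<integral>\<^sup>+ x\<in>S. ennreal (?h x) \<partial>lborel) = \<infinity>"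
      using False F(1)[OF nonneg] H(1)[OF nnh] by (auto simp: less_top[symmetric])
    then show ?thesis by simp
  qed
qed

theorem nn_integral_change_of_variables:
  fixes f :: "real^'m \<Rightarrow> real" and g :: "real^'m \<Rightarrow> real^'m"
  assumes S: "S \<in> sets borel" and gS: "g ` S \<in> sets borel"
    and der: "\<And>x. x \<in> S \<Longrightarrow> (g has_derivative g' x) (at x within S)"
    and inj: "inj_on g S"
    and nonneg: "\<And>y. y \<in> g ` S \<Longrightarrow> 0 \<le> f y"
    and mf: "(\<lambda>y. indicator (g ` S) y * f y) \<in> borel_measurable borel"
    and mh: "(\<lambda>x. indicator S x * (\<bar>det (matrix (g' x))\<bar> * f (g x))) \<in> borel_measurable borel"
  shows "(\<integral>\<^sup>+ y\<in>g ` S. ennreal (f y) \<partial>lborel) =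
    (\<integral>\<^sup>+ x\<in>S. ennreal (\<bar>det (matrix (g' x))\<bar> * f (g x)) \<partial>lborel)"
proof -
  obtain b :: "'m \<Rightarrow> 'm ordcopy" where b: "bij b" using ex_bij_ordcopy by blast
  define c where "c = inv b"
  have c: "bij c" unfolding c_def using b by (rule bij_imp_bij_inv)
  have cb [simp]: "c (b i) = i" "b (c k) = k" for i k
    using b by (auto simp: c_def bij_is_inj bij_is_surj surj_f_inv_f)
  define \<phi> where "\<phi> = (\<lambda>v::real^'m. (\<chi> k. v $ c k) :: real^'m ordcopy)"
  define \<psi> where "\<psi> = (\<lambda>w::real^'m ordcopy. (\<chi> i. w $ b i) :: real^'m)"
  have [simp]: "\<psi> (\<phi> v) = v" "\<phi> (\<psi> w) = w" for v w by (auto simp: \<phi>_def \<psi>_def vec_eq_iff)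
  have blin: "bounded_linear \<phi>" "bounded_linear \<psi>"
    using linear_vec_reindex unfolding \<phi>_def \<psi>_def linear_conv_bounded_linear by blast+
  have meas [measurable]: "\<phi> \<in> borel_measurable borel" "\<psi> \<in> borel_measurable borel"
    using blin by (auto intro: borel_measurable_continuous_onI linear_continuous_on)
  have img: "\<phi> ` T = \<psi> -` T" for T
    by (auto simp: image_iff) (metis \<open>\<And>w. \<phi> (\<psi> w) = w\<close>)
  have ind: "indicator (\<phi> ` T) w = indicator T (\<psi> w)" for T w
    by (simp add: img indicator_def)
  have sets_img: "\<phi> ` T \<in> sets borel" if "T \<in> sets borel" for T
    unfolding img using measurable_sets[OF meas(2) that] by simp
  \<comment> \<open>Conjugating \<open>g\<close> with the relabelling moves the problem to the
    well-ordered index type; by \<open>det_reindex\<close> the Jacobian determinant is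
    unchanged.\<close>
  let ?G = "\<phi> \<circ> g \<circ> \<psi>" and ?G' = "\<lambda>w. \<phi> \<circ> g' (\<psi> w) \<circ> \<psi>"
  have Gimg: "?G ` (\<phi> ` S) = \<phi> ` (g ` S)" by (auto simp: image_iff)
  have detG: "det (matrix (?G' w)) = det (matrix (g' (\<psi> w)))" for w
  proof -
    have ax: "\<psi> (axis l 1) = axis (c l) 1" for l
      by (auto simp: \<psi>_def axis_def vec_eq_iff)
    have "matrix (?G' w) = (\<chi> k l. matrix (g' (\<psi> w)) $ c k $ c l)"
      unfolding matrix_def vec_eq_iff by (simp add: ax) (simp add: \<phi>_def)
    then show ?thesis by (simp add: det_reindex[OF c])
  qed
  have "(\<integral>\<^sup>+ w\<in>?G ` (\<phi> ` S). ennreal (f (\<psi> w)) \<partial>lborel) =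
     (\<integral>\<^sup>+ w\<in>\<phi> ` S. ennreal (\<bar>det (matrix (?G' w))\<bar> * f (\<psi> (?G w))) \<partial>lborel)"
  proof (rule nn_integral_change_of_variables_wellorder)
    show "\<phi> ` S \<in> sets borel" "?G ` (\<phi> ` S) \<in> sets borel"
      unfolding Gimg using sets_img S gS by auto
    show "(?G has_derivative ?G' w) (at w within \<phi> ` S)" if "w \<in> \<phi> ` S" for w
    proof -
      have "\<psi> ` \<phi> ` S = S" by (auto simp: image_iff)
      then have "(g has_derivative g' (\<psi> w)) (at (\<psi> w) within \<psi> ` \<phi> ` S)"
        using der[of "\<psi> w"] that by auto
      then have "(g \<circ> \<psi> has_derivative g' (\<psi> w) \<circ> \<psi>) (at w within \<phi> ` S)"
        by (intro diff_chain_within bounded_linear_imp_has_derivative blin)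
      then show ?thesis
        unfolding comp_assoc by (intro diff_chain_within[where g=\<phi>] bounded_linear_imp_has_derivative blin)
    qed
    show "inj_on ?G (\<phi> ` S)"
    proof (rule inj_onI)
      fix w w' assume w: "w \<in> \<phi> ` S" "w' \<in> \<phi> ` S" and eq: "?G w = ?G w'"
      have "\<psi> (?G w) = \<psi> (?G w')" using eq by (rule arg_cong)
      then have "g (\<psi> w) = g (\<psi> w')" by simp
      moreover have "\<psi> w \<in> S" "\<psi> w' \<in> S" using w by auto
      ultimately have "\<psi> w = \<psi> w'" by (rule inj_onD[OF inj])
      then have "\<phi> (\<psi> w) = \<phi> (\<psi> w')" by (rule arg_cong)
      then show "w = w'" by simp
    qed
    show "0 \<le> f (\<psi> y)" if "y \<in> ?G ` (\<phi> ` S)" for y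
      using that nonneg unfolding Gimg by auto
    show "(\<lambda>y. indicator (?G ` (\<phi> ` S)) y * f (\<psi> y)) \<in> borel_measurable borel"
      unfolding Gimg ind using measurable_compose[OF meas(2) mf] by simp
    show "(\<lambda>x. indicator (\<phi> ` S) x * (\<bar>det (matrix (?G' x))\<bar> * f (\<psi> (?G x)))) \<in> borel_measurable borel"
      unfolding detG ind using measurable_compose[OF meas(2) mh] by simp
  qed
  moreover have "(\<integral>\<^sup>+ w\<in>\<phi> ` T. ennreal (k (\<psi> w)) \<partial>lborel) = (\<integral>\<^sup>+ v\<in>T. ennreal (k v) \<partial>lborel)"
    if "(\<lambda>y. indicator T y * k y) \<in> borel_measurable borel" for T and k :: "real^'m \<Rightarrow> real"
  proof -
    have eq: "ennreal (k y) * indicator T y = ennreal (indicator T y * k y)" for y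
      by (auto simp: indicator_def)
    have "(\<lambda>w. ennreal (indicator T (\<psi> w) * k (\<psi> w))) \<in> borel_measurable borel"
      using measurable_compose[OF meas(2) that] by simp
    from nn_integral_vec_reindex[OF c this]
    have "(\<integral>\<^sup>+ w. ennreal (indicator T (\<psi> w) * k (\<psi> w)) \<partial>lborel) =
        (\<integral>\<^sup>+ v. ennreal (indicator T (\<psi> (\<phi> v)) * k (\<psi> (\<phi> v))) \<partial>lborel)"
      unfolding \<phi>_def .
    then show ?thesis unfolding ind eq by simp
  qed
  ultimately show ?thesis
    unfolding Gimg detG using mf mh by (simp add: ind)
qed

section \<open>Gram determinants and charts\<close>

definition gram :: "('m::finite \<Rightarrow> 'v::real_inner) \<Rightarrow> real^'m^'m" where
  "gram v = (\<chi> i j. v i \<bullet> v j)"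

lemma gram_mult_vec: "(gram v *v a) $ i = v i \<bullet> (\<Sum>j\<in>UNIV. a $ j *\<^sub>R v j)"
  by (simp add: gram_def matrix_vector_mult_def inner_sum_right mult.commute)

lemma inner_gram_mult_vec: "a \<bullet> (gram v *v a) = (norm (\<Sum>j\<in>UNIV. a $ j *\<^sub>R v j))\<^sup>2"
proof -
  have "a \<bullet> (gram v *v a) = (\<Sum>i\<in>UNIV. a $ i * (v i \<bullet> (\<Sum>j\<in>UNIV. a $ j *\<^sub>R v j)))"
    by (simp add: inner_vec_def gram_mult_vec)
  also have "\<dots> = (\<Sum>i\<in>UNIV. a $ i *\<^sub>R v i) \<bullet> (\<Sum>j\<in>UNIV. a $ j *\<^sub>R v j)"
    by (subst inner_sum_left) simp
  finally show ?thesis by (simp add: power2_norm_eq_inner)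
qed

lemma det_nonzero_iff_kernel:
  fixes G :: "real^'m^'m"
  shows "det G \<noteq> 0 \<longleftrightarrow> (\<forall>a. G *v a = 0 \<longrightarrow> a = 0)"
  by (simp add: invertible_det_nz[symmetric] invertible_left_inverse matrix_left_invertible_ker)

lemma det_gram_nonzero_imp:
  assumes "det (gram v) \<noteq> 0" "(\<Sum>j\<in>UNIV. a $ j *\<^sub>R v j) = 0"
  shows "a = 0"
proof -
  have "gram v *v a = 0" using assms(2) by (simp add: vec_eq_iff gram_mult_vec)
  then show ?thesis using assms(1) det_nonzero_iff_kernel by blast
qed

text \<open>Positivity follows by joining the Gram matrix to the identity through positive definite
  matrices.\<close>

lemma det_gram_pos:
  fixes v :: "'m::finite \<Rightarrow> 'v::real_inner"
  assumes indep: "\<And>a. (\<Sum>j\<in>UNIV. a $ j *\<^sub>R v j) = 0 \<Longrightarrow> a = 0"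
  shows "det (gram v) > 0"
proof -
  define M where "M s = (1 - s) *\<^sub>R mat 1 + s *\<^sub>R gram v" for s :: real
  have nz: "det (M s) \<noteq> 0" if s: "0 \<le> s" "s \<le> 1" for s
    unfolding det_nonzero_iff_kernel
  proof (intro allI impI, rule ccontr)
    fix a assume a: "M s *v a = 0" "a \<noteq> 0"
    have "M s *v a = (1 - s) *\<^sub>R a + s *\<^sub>R (gram v *v a)"
      by (simp add: M_def matrix_vector_mult_add_rdistrib scaleR_matrix_vector_assoc[symmetric])
    then have "0 = a \<bullet> ((1 - s) *\<^sub>R a + s *\<^sub>R (gram v *v a))" using a(1) by simp
    also have "\<dots> = (1 - s) * (norm a)\<^sup>2 + s * (norm (\<Sum>j\<in>UNIV. a $ j *\<^sub>R v j))\<^sup>2"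
      by (simp add: inner_add_right inner_gram_mult_vec power2_norm_eq_inner)
    finally have eq: "(1 - s) * (norm a)\<^sup>2 + s * (norm (\<Sum>j\<in>UNIV. a $ j *\<^sub>R v j))\<^sup>2 = 0" ..
    have "norm a > 0" "norm (\<Sum>j\<in>UNIV. a $ j *\<^sub>R v j) > 0" using a(2) indep[of a] by auto
    then have "(norm a)\<^sup>2 > 0" "(norm (\<Sum>j\<in>UNIV. a $ j *\<^sub>R v j))\<^sup>2 > 0" by simp_all
    \<comment> \<open>For \<open>s < 1\<close> the first summand is positive; for
      \<open>s = 1\<close> the second one remains, and it is positive by independence.\<close>
    then show False using eq s
      by (cases "s = 1") (auto simp: add_nonneg_eq_0_iff add_pos_nonneg)
  qed
  have cont: "continuous_on {0..1} (\<lambda>s. det (M s))"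
    unfolding det_def M_def by (auto intro!: continuous_intros)
  show ?thesis
  proof (rule ccontr)
    assume "\<not> ?thesis"
    then have "det (M 1) \<le> 0" "0 \<le> det (M 0)" by (simp_all add: M_def)
    then obtain s where "0 \<le> s" "s \<le> 1" "det (M s) = 0"
      using IVT2'[of "\<lambda>s. det (M s)" 1 0 0] cont by auto
    then show False using nz by blast
  qed
qed

section \<open>Jacobi's formula for the derivative of a determinant\<close>

text \<open>A permutation other than the identity moves at least two indices, so after one factor of
  its Leibniz product is differentiated an off-diagonal zero of the identity matrix remains. The
  identity permutation contributes the trace.\<close>

lemma has_derivative_det_mat_1:
  fixes M :: "real \<Rightarrow> real^'m^'m"
  assumes M: "\<And>i j. ((\<lambda>t. M t $ i $ j) has_real_derivative M' $ i $ j) (at t0)"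
    and M0: "M t0 = mat 1"
  shows "((\<lambda>t. det (M t)) has_real_derivative (\<Sum>i\<in>UNIV. M' $ i $ i)) (at t0)"
proof -
  let ?P = "{p. p permutes (UNIV :: 'm set)}"
  let ?d = "\<lambda>p. \<Sum>i\<in>UNIV. M' $ i $ p i * (\<Prod>j\<in>UNIV - {i}. M t0 $ j $ p j)"
  have "((\<lambda>t. \<Prod>i\<in>UNIV. M t $ i $ p i) has_real_derivative ?d p) (at t0)" for p :: "'m \<Rightarrow> 'm"
    by (rule has_field_derivative_prod) (use M in auto)
  then have "((\<lambda>t. det (M t)) has_real_derivative (\<Sum>p\<in>?P. of_int (sign p) * ?d p)) (at t0)"
    unfolding det_def by (intro DERIV_sum DERIV_cmult)
  moreover have "(\<Sum>p\<in>?P. of_int (sign p) * ?d p) = (\<Sum>i\<in>UNIV. M' $ i $ i)"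
  proof -
    have zero: "?d p = 0" if p: "p \<in> ?P - {id}" for p
    proof (rule sum.neutral, rule ballI)
      fix i :: 'm
      have "\<exists>j. j \<noteq> i \<and> p j \<noteq> j"
      proof (rule ccontr)
        assume "\<not> ?thesis"
        then have fixp: "\<And>j. j \<noteq> i \<Longrightarrow> p j = j" by blast
        have "inj p" using p permutes_inj by blast
        then have "p i = i" by (metis fixp injD)
        then have "p = id" using fixp by (metis eq_id_iff)
        then show False using p by simp
      qed
      then obtain j where "j \<noteq> i" "p j \<noteq> j" by blast
      then have "(\<Prod>j\<in>UNIV - {i}. M t0 $ j $ p j) = 0"
        by (intro prod_zero) (auto simp: M0 mat_def intro!: bexI[of _ j])
      then show "M' $ i $ p i * (\<Prod>j\<in>UNIV - {i}. M t0 $ j $ p j) = 0" by simp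
    qed
    have "(\<Sum>p\<in>?P. of_int (sign p) * ?d p) = (\<Sum>p\<in>{id}. of_int (sign p) * ?d p)"
      using zero by (intro sum.mono_neutral_right) (auto simp: finite_permutations permutes_id)
    also have "\<dots> = (\<Sum>i\<in>UNIV. M' $ i $ i)"
      by (auto simp: M0 mat_def intro!: sum.cong)
    finally show ?thesis .
  qed
  ultimately show ?thesis by simp
qed

lemma matrix_inv_mult:
  fixes G :: "real^'m^'m"
  assumes "det G \<noteq> 0"
  shows "G ** matrix_inv G = mat 1" "matrix_inv G ** G = mat 1"
  using someI_ex[of "\<lambda>B. G ** B = mat 1 \<and> B ** G = mat 1"] assms
  unfolding matrix_inv_def invertible_det_nz[symmetric] invertible_def by auto

text \<open>Factoring \<open>G t\<close> as \<open>G t0 ** (matrix_inv (G t0) ** G t)\<close>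
  reduces Jacobi's formula to a curve through the identity matrix.\<close>

lemma has_derivative_det:
  fixes G :: "real \<Rightarrow> real^'m^'m"
  assumes G: "\<And>i j. ((\<lambda>t. G t $ i $ j) has_real_derivative G' $ i $ j) (at t0)"
    and nz: "det (G t0) \<noteq> 0"
  shows "((\<lambda>t. det (G t)) has_real_derivative
     det (G t0) * (\<Sum>i\<in>UNIV. \<Sum>j\<in>UNIV. matrix_inv (G t0) $ i $ j * G' $ j $ i)) (at t0)"
proof -
  let ?I = "matrix_inv (G t0)"
  have "((\<lambda>t. det (?I ** G t)) has_real_derivative (\<Sum>i\<in>UNIV. (?I ** G') $ i $ i)) (at t0)"
  proof (rule has_derivative_det_mat_1)
    show "((\<lambda>t. (?I ** G t) $ i $ j) has_real_derivative (?I ** G') $ i $ j) (at t0)" for i j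
      unfolding matrix_matrix_mult_def by (auto intro!: DERIV_sum DERIV_cmult G)
  qed (rule matrix_inv_mult(2)[OF nz])
  from DERIV_cmult[OF this, of "det (G t0)"]
  have "((\<lambda>t. det (G t0 ** (?I ** G t))) has_real_derivative
      det (G t0) * (\<Sum>i\<in>UNIV. (?I ** G') $ i $ i)) (at t0)" by (simp add: det_mul)
  moreover have "G t0 ** (?I ** G t) = G t" for t
    by (simp add: matrix_mul_assoc matrix_inv_mult(1)[OF nz])
  ultimately show ?thesis by (simp add: matrix_matrix_mult_def)
qed

section \<open>Closure properties of smooth maps\<close>

lemma smooth_on_imp_C_k_on: "smooth_on S f \<Longrightarrow> C_k_on k S f"
  by (simp add: smooth_on_def)

lemma smooth_on_has_derivative:
  "smooth_on S f \<Longrightarrow> x \<in> S \<Longrightarrow> (f has_derivative frechet_derivative f (at x)) (at x)"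
  using smooth_on_imp_C_k_on C_k_on_has_derivative by blast

lemma smooth_on_frechet_derivative: "smooth_on S f \<Longrightarrow> smooth_on S (\<lambda>x. frechet_derivative f (at x) v)"
  unfolding smooth_on_def by (metis C_k_on.simps(2))

lemma smooth_on_imp_continuous_on: "smooth_on S f \<Longrightarrow> continuous_on S f"
  using smooth_on_imp_C_k_on[of S f 0] by simp

lemma smooth_on_subset: "smooth_on S f \<Longrightarrow> T \<subseteq> S \<Longrightarrow> smooth_on T f"
  unfolding smooth_on_def by (metis C_k_on_subset)

lemma smooth_on_compose:
  fixes f :: "'b::euclidean_space \<Rightarrow> 'c::real_normed_vector"
  assumes "open S" "open T" "g ` S \<subseteq> T" "smooth_on S g" "smooth_on T f"
  shows "smooth_on S (\<lambda>x. f (g x))"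
  using assms C_k_on_compose unfolding smooth_on_def by blast

lemma smooth_on_add:
  "open S \<Longrightarrow> smooth_on S f \<Longrightarrow> smooth_on S g \<Longrightarrow> smooth_on S (\<lambda>x. f x + g x)"
  unfolding smooth_on_def by (metis C_k_on_add)

lemma smooth_on_bilinear:
  "bounded_bilinear h \<Longrightarrow> open S \<Longrightarrow> smooth_on S f \<Longrightarrow> smooth_on S g \<Longrightarrow> smooth_on S (\<lambda>x. h (f x) (g x))"
  unfolding smooth_on_def by (metis C_k_on_bilinear)

lemma smooth_on_bounded_linear: "open S \<Longrightarrow> bounded_linear L \<Longrightarrow> smooth_on S L"
  unfolding smooth_on_def by (metis C_k_on_bounded_linear)

lemma smooth_on_const: "open S \<Longrightarrow> smooth_on S (\<lambda>x. c)"
  unfolding smooth_on_def by (metis C_k_on_const)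

lemma smooth_on_sum:
  "open S \<Longrightarrow> (\<And>i. i \<in> I \<Longrightarrow> smooth_on S (f i)) \<Longrightarrow> smooth_on S (\<lambda>x. \<Sum>i\<in>I. f i x)"
  unfolding smooth_on_def using C_k_on_sum[of S I _ f] by blast

lemma smooth_on_prod:
  fixes f :: "'i \<Rightarrow> 'a::real_normed_vector \<Rightarrow> real"
  shows "open S \<Longrightarrow> (\<And>i. i \<in> I \<Longrightarrow> smooth_on S (f i)) \<Longrightarrow> smooth_on S (\<lambda>x. \<Prod>i\<in>I. f i x)"
  unfolding smooth_on_def using C_k_on_prod[of S I _ f] by blast

lemma smooth_on_transform:
  "open S \<Longrightarrow> (\<And>x. x \<in> S \<Longrightarrow> f x = g x) \<Longrightarrow> smooth_on S f \<Longrightarrow> smooth_on S g"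
  unfolding smooth_on_def using C_k_on_transform[of S f g] by blast

lemma smooth_on_open_cover:
  assumes "\<And>x. x \<in> S \<Longrightarrow> \<exists>U. open U \<and> x \<in> U \<and> smooth_on U f"
  shows "smooth_on S f"
  unfolding smooth_on_def
proof
  fix k show "C_k_on k S f"
    by (rule C_k_on_open_cover) (meson assms smooth_on_def)
qed

lemma smooth_on_det:
  fixes M :: "'a::real_normed_vector \<Rightarrow> real^'m^'m"
  assumes "open S" "\<And>i j. smooth_on S (\<lambda>x. M x $ i $ j)"
  shows "smooth_on S (\<lambda>x. det (M x))"
  unfolding det_def
  by (intro smooth_on_sum assms smooth_on_bilinear[OF bounded_bilinear_mult] smooth_on_const smooth_on_prod)

section \<open>Charts, transition maps, tangent and normal spaces\<close>

locale atlas_manifold =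
  fixes A :: "('a::{t2_space,second_countable_topology}, 'm::finite) chart set"
  assumes atlas: "smooth_atlas A"
begin

lemma is_chart: "c \<in> A \<Longrightarrow> is_chart c"
  using atlas by (auto simp: smooth_atlas_def)

lemma open_chart_dom: "c \<in> A \<Longrightarrow> open (chart_dom c)"
  and open_chart_img: "c \<in> A \<Longrightarrow> open (chart_img c)"
  and homeomorphism_chart:
    "c \<in> A \<Longrightarrow> homeomorphism (chart_dom c) (chart_img c) (chart_map c) (chart_inv c)"
  using is_chart by (auto simp: is_chart_def)

lemma chart_inv_map: "c \<in> A \<Longrightarrow> q \<in> chart_dom c \<Longrightarrow> chart_inv c (chart_map c q) = q"
  using homeomorphism_chart by (auto simp: homeomorphism_def)

lemma chart_map_inv: "c \<in> A \<Longrightarrow> u \<in> chart_img c \<Longrightarrow> chart_map c (chart_inv c u) = u"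
  using homeomorphism_chart by (auto simp: homeomorphism_def)

lemma chart_map_in: "q \<in> chart_dom c \<Longrightarrow> chart_map c q \<in> chart_img c"
  by (auto simp: chart_img_def)

lemma chart_inv_in: "c \<in> A \<Longrightarrow> u \<in> chart_img c \<Longrightarrow> chart_inv c u \<in> chart_dom c"
  using homeomorphism_chart[of c] unfolding homeomorphism_def by blast

lemma continuous_on_chart_map: "c \<in> A \<Longrightarrow> continuous_on (chart_dom c) (chart_map c)"
  using homeomorphism_chart by (auto simp: homeomorphism_def)

lemma continuous_on_chart_inv: "c \<in> A \<Longrightarrow> continuous_on (chart_img c) (chart_inv c)"
  using homeomorphism_chart by (auto simp: homeomorphism_def)

lemma chart_map_image:
  assumes "c \<in> A" "E \<subseteq> chart_dom c"
  shows "chart_map c ` E = {u \<in> chart_img c. chart_inv c u \<in> E}"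
proof (intro set_eqI iffI)
  fix u assume "u \<in> chart_map c ` E"
  then obtain q where "q \<in> E" "u = chart_map c q" by blast
  then show "u \<in> {u \<in> chart_img c. chart_inv c u \<in> E}"
    using assms chart_inv_map[OF assms(1), of q] chart_map_in[of q c] by auto
next
  fix u assume "u \<in> {u \<in> chart_img c. chart_inv c u \<in> E}"
  then show "u \<in> chart_map c ` E"
    using chart_map_inv[OF assms(1), of u] by (intro image_eqI[of _ _ "chart_inv c u"]) auto
qed

lemma chart_inv_image:
  assumes "c \<in> A" "V \<subseteq> chart_img c"
  shows "chart_inv c ` V = {q \<in> chart_dom c. chart_map c q \<in> V}"
proof (intro set_eqI iffI)
  fix q assume "q \<in> chart_inv c ` V"
  then obtain u where "u \<in> V" "q = chart_inv c u" by blast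
  then show "q \<in> {q \<in> chart_dom c. chart_map c q \<in> V}"
    using assms chart_map_inv[OF assms(1), of u] chart_inv_in[OF assms(1), of u] by auto
next
  fix q assume "q \<in> {q \<in> chart_dom c. chart_map c q \<in> V}"
  then show "q \<in> chart_inv c ` V"
    using chart_inv_map[OF assms(1), of q] by (intro image_eqI[of _ _ "chart_map c q"]) auto
qed

lemma open_chart_map_image:
  assumes "c \<in> A" "open U" "U \<subseteq> chart_dom c"
  shows "open (chart_map c ` U)"
proof -
  have "open (chart_img c \<inter> chart_inv c -` U)"
    using continuous_open_preimage[OF continuous_on_chart_inv open_chart_img] assms by blast
  then show ?thesis using chart_map_image[OF assms(1,3)] by (simp add: Int_def vimage_def)
qed

lemma open_chart_inv_image:
  assumes "c \<in> A" "open V" "V \<subseteq> chart_img c"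
  shows "open (chart_inv c ` V)"
proof -
  have "open (chart_dom c \<inter> chart_map c -` V)"
    using continuous_open_preimage[OF continuous_on_chart_map open_chart_dom] assms by blast
  then show ?thesis using chart_inv_image[OF assms(1,3)] by (simp add: Int_def vimage_def)
qed

lemma ex_chart: "\<exists>c\<in>A. q \<in> chart_dom c"
  using atlas by (auto simp: smooth_atlas_def set_eq_iff)

lemma chart_at: "chart_at A q \<in> A" "q \<in> chart_dom (chart_at A q)"
  using someI_ex[of "\<lambda>c. c \<in> A \<and> q \<in> chart_dom c"] ex_chart[of q]
  unfolding chart_at_def Bex_def by blast+

lemma smooth_map_local_rep: "smooth_map A f \<Longrightarrow> c \<in> A \<Longrightarrow> smooth_on (chart_img c) (local_rep c f)"
  by (auto simp: smooth_map_def)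

lemma local_rep_chart_map: "c \<in> A \<Longrightarrow> q \<in> chart_dom c \<Longrightarrow> local_rep c f (chart_map c q) = f q"
  by (simp add: local_rep_def chart_inv_map)

lemma has_derivative_differential:
  assumes "smooth_map A f" "c \<in> A" "q \<in> chart_dom c"
  shows "(local_rep c f has_derivative differential c f q) (at (chart_map c q))"
  unfolding differential_def
  by (rule smooth_on_has_derivative[OF smooth_map_local_rep[OF assms(1,2)] chart_map_in[OF assms(3)]])

lemma linear_differential:
  "smooth_map A f \<Longrightarrow> c \<in> A \<Longrightarrow> q \<in> chart_dom c \<Longrightarrow> linear (differential c f q)"
  using has_derivative_differential has_derivative_linear by blast

definition transition :: "('a, 'm) chart \<Rightarrow> ('a, 'm) chart \<Rightarrow> 'a \<Rightarrow> real^'m \<Rightarrow> real^'m" where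
  "transition c d q = frechet_derivative (chart_map d \<circ> chart_inv c) (at (chart_map c q))"

lemma smooth_on_transition:
  "c \<in> A \<Longrightarrow> d \<in> A \<Longrightarrow> smooth_on (chart_map c ` (chart_dom c \<inter> chart_dom d)) (chart_map d \<circ> chart_inv c)"
  using atlas by (auto simp: smooth_atlas_def)

lemma open_overlap:
  "c \<in> A \<Longrightarrow> d \<in> A \<Longrightarrow> open (chart_map c ` (chart_dom c \<inter> chart_dom d))"
  by (intro open_chart_map_image) (auto intro: open_chart_dom)

lemma has_derivative_transition:
  assumes "c \<in> A" "d \<in> A" "q \<in> chart_dom c" "q \<in> chart_dom d"
  shows "(chart_map d \<circ> chart_inv c has_derivative transition c d q) (at (chart_map c q))"
  unfolding transition_def
  by (rule smooth_on_has_derivative[OF smooth_on_transition[OF assms(1,2)]]) (use assms in auto)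

lemma linear_transition:
  assumes "c \<in> A" "d \<in> A" "q \<in> chart_dom c" "q \<in> chart_dom d"
  shows "linear (transition c d q)"
  using has_derivative_transition[OF assms] has_derivative_linear by blast

text \<open>Formulated with a derivative \<open>D\<close> at one point rather than for smooth maps,
  so that it also applies to a coordinate map, which has no meaningful values outside its
  domain.\<close>

lemma has_derivative_change_chart:
  assumes cd: "c \<in> A" "d \<in> A" "q \<in> chart_dom c" "q \<in> chart_dom d"
    and D: "(local_rep d f has_derivative D) (at (chart_map d q))"
  shows "(local_rep c f has_derivative (\<lambda>a. D (transition c d q a))) (at (chart_map c q))"
proof -
  have "((\<lambda>u. local_rep d f ((chart_map d \<circ> chart_inv c) u)) has_derivative
      (\<lambda>a. D (transition c d q a))) (at (chart_map c q))"
    by (rule has_derivative_compose[OF has_derivative_transition[OF cd]])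
      (use D chart_inv_map[OF cd(1,3)] in simp)
  then show ?thesis
  proof (rule has_derivative_transform_within_open)
    show "open (chart_map c ` (chart_dom c \<inter> chart_dom d))" by (rule open_overlap[OF cd(1,2)])
    show "local_rep d f ((chart_map d \<circ> chart_inv c) u) = local_rep c f u"
      if "u \<in> chart_map c ` (chart_dom c \<inter> chart_dom d)" for u
      using that chart_inv_map[OF cd(1)] chart_inv_map[OF cd(2)] by (auto simp: local_rep_def)
  qed (use cd in auto)
qed

lemma differential_change_chart:
  assumes cd: "c \<in> A" "d \<in> A" "q \<in> chart_dom c" "q \<in> chart_dom d" and f: "smooth_map A f"
  shows "differential c f q a = differential d f q (transition c d q a)"
  using frechet_derivative_at[OF has_derivative_change_chart[OF cd has_derivative_differential[OF f cd(2,4)]]]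
  unfolding differential_def by metis

text \<open>The coordinate map of \<open>c\<close> is the identity in its own chart, while computing
  through \<open>d\<close> gives the composite of the two transitions; derivatives are
  unique.\<close>

lemma transition_inverse:
  assumes cd: "c \<in> A" "d \<in> A" "q \<in> chart_dom c" "q \<in> chart_dom d"
  shows "transition d c q (transition c d q a) = a"
proof -
  have "(local_rep d (chart_map c) has_derivative transition d c q) (at (chart_map d q))"
    using has_derivative_transition[OF cd(2,1,4,3)] by (simp add: local_rep_def)
  from has_derivative_change_chart[OF cd this]
  have 1: "(local_rep c (chart_map c) has_derivative (\<lambda>a. transition d c q (transition c d q a))) (at (chart_map c q))" .
  have "((\<lambda>u. u) has_derivative (\<lambda>a. a)) (at (chart_map c q))" by simp
  then have 2: "(local_rep c (chart_map c) has_derivative (\<lambda>a. a)) (at (chart_map c q))"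
    by (rule has_derivative_transform_within_open[OF _ open_chart_img[OF cd(1)] chart_map_in[OF cd(3)]])
      (simp add: local_rep_def chart_map_inv[OF cd(1)])
  show ?thesis using has_derivative_unique[OF 1 2] by metis
qed

lemma tangent_space_eq:
  assumes c: "c \<in> A" "q \<in> chart_dom c" and x: "smooth_map A x"
  shows "tangent_space A x q = range (differential c x q)"
proof -
  have "range (differential d x q) \<subseteq> range (differential c x q)" if "d \<in> A" "q \<in> chart_dom d" for d
    using differential_change_chart[OF that(1) c(1) that(2) c(2) x] by auto
  then show ?thesis unfolding tangent_space_def using c by blast
qed

lemma differential_expand:
  assumes c: "c \<in> A" "q \<in> chart_dom c" and x: "smooth_map A x"
  shows "differential c x q a = (\<Sum>i\<in>UNIV. a $ i *\<^sub>R differential c x q (axis i 1))"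
proof -
  have "a = (\<Sum>i\<in>UNIV. a $ i *\<^sub>R axis i 1)"
    using basis_expansion[of a] by (simp add: scalar_mult_eq_scaleR)
  then have "differential c x q a = differential c x q (\<Sum>i\<in>UNIV. a $ i *\<^sub>R axis i 1)" by (rule arg_cong)
  also have "\<dots> = (\<Sum>i\<in>UNIV. a $ i *\<^sub>R differential c x q (axis i 1))"
    using linear_differential[OF x c] by (simp add: linear_sum linear_cmul)
  finally show ?thesis .
qed

lemma normal_space_eq:
  assumes c: "c \<in> A" "q \<in> chart_dom c" and x: "smooth_map A x"
  shows "w \<in> normal_space A x q \<longleftrightarrow> (\<forall>i. w \<bullet> differential c x q (axis i 1) = 0)"
proof -
  have "w \<in> normal_space A x q \<longleftrightarrow> (\<forall>a. w \<bullet> differential c x q a = 0)"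
    unfolding normal_space_def tangent_space_eq[OF assms] by (auto simp: orthogonal_def)
  also have "\<dots> \<longleftrightarrow> (\<forall>i. w \<bullet> differential c x q (axis i 1) = 0)"
  proof (intro iffI allI)
    fix a assume 0: "\<forall>i. w \<bullet> differential c x q (axis i 1) = 0"
    show "w \<bullet> differential c x q a = 0"
      unfolding differential_expand[OF assms, of a] using 0 by (simp add: inner_sum_right)
  qed auto
  finally show ?thesis .
qed

text \<open>Justifies the definite description in \<open>normal_part\<close>: orthogonal
  decomposition along the tangent space supplies a candidate, and the difference of two candidates
  is both tangent and normal, hence orthogonal to itself.\<close>

lemma normal_part_props:
  assumes x: "smooth_map A x"
  shows "normal_part A x q v \<in> normal_space A x q" "v - normal_part A x q v \<in> tangent_space A x q"
proof -
  let ?T = "tangent_space A x q"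
  have T: "subspace ?T"
    unfolding tangent_space_eq[OF chart_at x]
    by (rule linear_subspace_image[OF linear_differential[OF x chart_at] subspace_UNIV])
  obtain y z where yz: "y \<in> span ?T" "\<And>w. w \<in> span ?T \<Longrightarrow> orthogonal z w" "v = y + z"
    using orthogonal_subspace_decomp_exists[of ?T v] by blast
  then have 1: "z \<in> normal_space A x q \<and> v - z \<in> ?T"
    using T by (auto simp: normal_space_def span_eq_iff[THEN iffD2])
  have "\<exists>!w. w \<in> normal_space A x q \<and> v - w \<in> ?T"
  proof (rule ex1I[of _ z])
    show "z \<in> normal_space A x q \<and> v - z \<in> ?T" by (rule 1)
  next
    fix w assume w: "w \<in> normal_space A x q \<and> v - w \<in> ?T"
    have "(v - z) - (v - w) \<in> ?T" using subspace_diff[OF T] 1 w by blast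
    then have "w - z \<in> ?T" by simp
    then have "w \<bullet> (w - z) = 0" "z \<bullet> (w - z) = 0"
      using w 1 by (auto simp: normal_space_def orthogonal_def)
    then have "(w - z) \<bullet> (w - z) = 0" by (simp add: inner_diff_left)
    then show "w = z" by simp
  qed
  from theI'[OF this] show "normal_part A x q v \<in> normal_space A x q" "v - normal_part A x q v \<in> ?T"
    unfolding normal_part_def by auto
qed

lemma inner_normal_part:
  assumes "smooth_map A x" "w \<in> normal_space A x q"
  shows "w \<bullet> normal_part A x q v = w \<bullet> v"
  using normal_part_props(2)[OF assms(1), of v q] assms(2)
  by (auto simp: normal_space_def orthogonal_def inner_diff_right)

lemma subspace_normal_space: "subspace (normal_space A x q)"
  by (auto simp: subspace_def normal_space_def orthogonal_def inner_add_left)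

lemma metric_coeffs_eq_gram: "metric_coeffs c y u = gram (\<lambda>i. partial i (local_rep c y) u)"
  by (simp add: metric_coeffs_def gram_def)

lemma partial_eq_differential: "partial i (local_rep c y) (chart_map c q) = differential c y q (axis i 1)"
  by (simp add: partial_def differential_def)

lemma det_metric_pos:
  assumes y: "immersion A y" and c: "c \<in> A" "u \<in> chart_img c"
  shows "det (metric_coeffs c y u) > 0"
  unfolding metric_coeffs_eq_gram
proof (rule det_gram_pos)
  fix a :: "real^'m"
  let ?q = "chart_inv c u"
  have q: "?q \<in> chart_dom c" "chart_map c ?q = u" using c chart_inv_in chart_map_inv by auto
  have sm: "smooth_map A y" using y by (simp add: immersion_def)
  assume "(\<Sum>j\<in>UNIV. a $ j *\<^sub>R partial j (local_rep c y) u) = 0"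
  then have "differential c y ?q a = 0"
    unfolding differential_expand[OF c(1) q(1) sm, of a] by (simp add: partial_eq_differential[symmetric] q(2))
  moreover have "inj (differential c y ?q)" using y c q by (auto simp: immersion_def)
  ultimately show "a = 0"
    using linear_differential[OF sm c(1) q(1)] by (simp add: linear_injective_0)
qed

text \<open>The two metric matrices are congruent through the Jacobian matrix of the transition,
  which therefore contributes its determinant twice.\<close>

lemma det_metric_change_chart:
  assumes cd: "c \<in> A" "d \<in> A" "q \<in> chart_dom c" "q \<in> chart_dom d"
    and y: "smooth_map A (y :: 'a \<Rightarrow> real^'b)"
  shows "det (metric_coeffs c y (chart_map c q)) =
    (det (matrix (transition c d q)))\<^sup>2 * det (metric_coeffs d y (chart_map d q))"
proof -
  let ?T = "matrix (transition c d q)"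
  have "metric_coeffs c y (chart_map c q) = transpose ?T ** metric_coeffs d y (chart_map d q) ** ?T"
  proof -
    have 1: "differential c y q (axis i 1) = (\<Sum>k\<in>UNIV. ?T $ k $ i *\<^sub>R differential d y q (axis k 1))" for i
      unfolding differential_change_chart[OF cd y, of "axis i 1"]
        differential_expand[OF cd(2,4) y, of "transition c d q (axis i 1)"]
      by (simp add: matrix_def)
    have 2: "(\<Sum>k\<in>UNIV. ?T $ k $ i *\<^sub>R D k) \<bullet> (\<Sum>l\<in>UNIV. ?T $ l $ j *\<^sub>R D l) =
        (\<Sum>l\<in>UNIV. (\<Sum>k\<in>UNIV. ?T $ k $ i * (D k \<bullet> D l)) * ?T $ l $ j)" for i j and D :: "'m \<Rightarrow> real^'b"
      by (simp add: inner_sum_right inner_sum_left sum_distrib_right ac_simps)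
    have "differential c y q (axis i 1) \<bullet> differential c y q (axis j 1) =
        (\<Sum>l\<in>UNIV. (\<Sum>k\<in>UNIV. ?T $ k $ i * (differential d y q (axis k 1) \<bullet> differential d y q (axis l 1))) * ?T $ l $ j)"
      for i j unfolding 1[of i] 1[of j] by (rule 2)
    then show ?thesis
      unfolding metric_coeffs_eq_gram partial_eq_differential gram_def
      by (simp add: vec_eq_iff matrix_matrix_mult_def transpose_def)
  qed
  then show ?thesis by (simp add: det_mul power2_eq_square)
qed

lemma det_transition_nonzero:
  assumes cd: "c \<in> A" "d \<in> A" "q \<in> chart_dom c" "q \<in> chart_dom d"
  shows "det (matrix (transition c d q)) \<noteq> 0"
proof -
  have "inj (transition c d q)" using transition_inverse[OF cd] by (rule inj_on_inverseI)
  then show ?thesis using det_nz_iff_inj[OF linear_transition[OF cd]] by simp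
qed

definition vol_density :: "('a, 'm) chart \<Rightarrow> ('a \<Rightarrow> real ^ 'n) \<Rightarrow> real ^ 'm \<Rightarrow> real" where
  "vol_density c y u = sqrt (det (metric_coeffs c y u))"

lemma vol_density_pos: "immersion A y \<Longrightarrow> c \<in> A \<Longrightarrow> u \<in> chart_img c \<Longrightarrow> vol_density c y u > 0"
  by (simp add: vol_density_def det_metric_pos)

lemma vol_density_change_chart:
  assumes "c \<in> A" "d \<in> A" "q \<in> chart_dom c" "q \<in> chart_dom d" "smooth_map A y"
  shows "vol_density c y (chart_map c q) =
    \<bar>det (matrix (transition c d q))\<bar> * vol_density d y (chart_map d q)"
  by (simp add: vol_density_def det_metric_change_chart[OF assms] real_sqrt_mult)

lemma continuous_on_det:
  fixes M :: "'b::topological_space \<Rightarrow> real^'m^'m"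
  assumes "\<And>i j. continuous_on S (\<lambda>x. M x $ i $ j)"
  shows "continuous_on S (\<lambda>x. det (M x))"
  unfolding det_def by (intro continuous_intros assms)

lemma continuous_on_vol_density:
  assumes "smooth_map A y" "c \<in> A"
  shows "continuous_on (chart_img c) (vol_density c y)"
proof -
  have "continuous_on (chart_img c) (partial i (local_rep c y))" for i
    using smooth_on_imp_continuous_on[OF smooth_on_frechet_derivative[OF smooth_map_local_rep[OF assms]]]
    by (simp add: partial_def[abs_def])
  then show ?thesis
    unfolding vol_density_def metric_coeffs_def
    by (intro continuous_on_real_sqrt continuous_on_det) (simp add: continuous_on_inner)
qed

lemma immersion_imp_smooth_map: "immersion A y \<Longrightarrow> smooth_map A y"
  by (simp add: immersion_def)

text \<open>The Jacobian determinant of a change of chart is a common nonzero factor of numerator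
  and denominator, so the arbitrary choice made by \<open>chart_at\<close> may be replaced by any
  chart at \<open>q\<close>.\<close>

lemma volume_ratio_eq:
  assumes xy: "immersion A x" "smooth_map A y" and c: "c \<in> A" "q \<in> chart_dom c"
  shows "volume_ratio A x y q = vol_density c y (chart_map c q) / vol_density c x (chart_map c q)"
proof -
  let ?d = "chart_at A q"
  note ch = c(1) chart_at(1)[of q] c(2) chart_at(2)[of q]
  have "volume_ratio A x y q = vol_density ?d y (chart_map ?d q) / vol_density ?d x (chart_map ?d q)"
    by (simp add: volume_ratio_def vol_density_def Let_def)
  then show ?thesis
    using det_transition_nonzero[OF ch]
    by (simp add: vol_density_change_chart[OF ch] xy immersion_imp_smooth_map)
qed

end

section \<open>The volume measure\<close>

context atlas_manifold
begin

text \<open>The volume over one chart, pushed forward to a Borel measure on the whole manifold that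
  is concentrated on the chart domain. In this form the measures of different charts can be compared
  and summed.\<close>

definition chart_measure :: "('a, 'm) chart \<Rightarrow> ('a \<Rightarrow> real^'n) \<Rightarrow> 'a measure" where
  "chart_measure c y =
     distr (density (restrict_space lborel (chart_img c)) (\<lambda>u. ennreal (vol_density c y u))) borel (chart_inv c)"

lemma sets_chart_measure [simp, measurable_cong]: "sets (chart_measure c y) = sets borel"
  by (simp add: chart_measure_def)

lemma measurable_chart_inv:
  "c \<in> A \<Longrightarrow> chart_inv c \<in> measurable (restrict_space lborel (chart_img c)) borel"
  using borel_measurable_continuous_on_restrict[OF continuous_on_chart_inv]
  by (subst measurable_cong_sets[OF sets_restrict_space_cong[OF sets_lborel] refl])

lemma measurable_vol_density:
  "immersion A y \<Longrightarrow> c \<in> A \<Longrightarrow> vol_density c y \<in> borel_measurable (restrict_space lborel (chart_img c))"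
  using borel_measurable_continuous_on_restrict[OF continuous_on_vol_density[OF immersion_imp_smooth_map]]
  by (subst measurable_cong_sets[OF sets_restrict_space_cong[OF sets_lborel] refl])

lemma borel_chart_img: "c \<in> A \<Longrightarrow> chart_img c \<in> sets borel"
  by (simp add: borel_open open_chart_img)

lemma borel_chart_dom: "c \<in> A \<Longrightarrow> chart_dom c \<in> sets borel"
  by (simp add: borel_open open_chart_dom)

lemma borel_chart_map_image:
  assumes c: "c \<in> A" and E: "E \<in> sets borel" "E \<subseteq> chart_dom c"
  shows "chart_map c ` E \<in> sets borel"
proof -
  have "chart_inv c -` E \<inter> space (restrict_space lborel (chart_img c)) \<in> sets (restrict_space lborel (chart_img c))"
    by (rule measurable_sets[OF measurable_chart_inv[OF c] E(1)])
  then have "chart_inv c -` E \<inter> chart_img c \<in> sets (restrict_space lborel (chart_img c))"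
    by (simp add: space_restrict_space)
  then have "chart_inv c -` E \<inter> chart_img c \<in> sets borel"
    using borel_chart_img[OF c] by (simp add: sets_restrict_space_iff)
  moreover have "chart_map c ` E = chart_inv c -` E \<inter> chart_img c"
    using chart_map_image[OF c E(2)] by auto
  ultimately show ?thesis by simp
qed

lemma nn_integral_chart_measure:
  assumes y: "immersion A y" and c: "c \<in> A" and f: "f \<in> borel_measurable borel"
  shows "(\<integral>\<^sup>+ q. f q \<partial>chart_measure c y) =
    (\<integral>\<^sup>+ u\<in>chart_img c. (ennreal (vol_density c y u) * f (chart_inv c u)) \<partial>lborel)"
proof -
  let ?R = "restrict_space lborel (chart_img c)"
  have inv: "chart_inv c \<in> measurable ?R borel" by (rule measurable_chart_inv[OF c])
  have "(\<integral>\<^sup>+ q. f q \<partial>chart_measure c y) =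
      (\<integral>\<^sup>+ u. f (chart_inv c u) \<partial>density ?R (\<lambda>u. ennreal (vol_density c y u)))"
    unfolding chart_measure_def by (rule nn_integral_distr) (use inv f in simp_all)
  also have "\<dots> = (\<integral>\<^sup>+ u. ennreal (vol_density c y u) * f (chart_inv c u) \<partial>?R)"
    using measurable_vol_density[OF y c] measurable_compose[OF inv f]
    by (intro nn_integral_density) simp_all
  also have "\<dots> = (\<integral>\<^sup>+ u\<in>chart_img c. (ennreal (vol_density c y u) * f (chart_inv c u)) \<partial>lborel)"
    by (rule nn_integral_restrict_space) (simp add: borel_chart_img[OF c])
  finally show ?thesis .
qed

lemma emeasure_chart_measure:
  assumes y: "immersion A y" and c: "c \<in> A" and E: "E \<in> sets borel"
  shows "emeasure (chart_measure c y) E =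
    (\<integral>\<^sup>+ u\<in>chart_map c ` (E \<inter> chart_dom c). ennreal (vol_density c y u) \<partial>lborel)"
proof -
  have "emeasure (chart_measure c y) E = (\<integral>\<^sup>+ q. indicator E q \<partial>chart_measure c y)"
    using E by simp
  also have "\<dots> = (\<integral>\<^sup>+ u\<in>chart_img c. (ennreal (vol_density c y u) * indicator E (chart_inv c u)) \<partial>lborel)"
    by (rule nn_integral_chart_measure[OF y c]) (use E in simp)
  also have "\<dots> = (\<integral>\<^sup>+ u\<in>chart_map c ` (E \<inter> chart_dom c). ennreal (vol_density c y u) \<partial>lborel)"
  proof (rule nn_integral_cong)
    fix u
    have "u \<in> chart_map c ` (E \<inter> chart_dom c) \<longleftrightarrow> u \<in> chart_img c \<and> chart_inv c u \<in> E"
      using chart_map_image[OF c, of "E \<inter> chart_dom c"] chart_inv_in[OF c] by auto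
    then show "ennreal (vol_density c y u) * indicator E (chart_inv c u) * indicator (chart_img c) u =
        ennreal (vol_density c y u) * indicator (chart_map c ` (E \<inter> chart_dom c)) u"
      by (auto simp: indicator_def)
  qed
  finally show ?thesis .
qed

text \<open>The transformation law of the density cancels exactly the Jacobian in the change of
  variables formula; this is why the charts define a common measure.\<close>

lemma nn_integral_vol_density_change_chart:
  assumes y: "immersion A y" and cd: "c \<in> A" "d \<in> A"
    and E: "E \<in> sets borel" "E \<subseteq> chart_dom c \<inter> chart_dom d"
  shows "(\<integral>\<^sup>+ u\<in>chart_map d ` E. ennreal (vol_density d y u) \<partial>lborel) =
    (\<integral>\<^sup>+ u\<in>chart_map c ` E. ennreal (vol_density c y u) \<partial>lborel)"
proof -
  let ?g = "chart_map d \<circ> chart_inv c" and ?S = "chart_map c ` E"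
  let ?g' = "\<lambda>u. transition c d (chart_inv c u)"
  have Ec: "E \<subseteq> chart_dom c" and Ed: "E \<subseteq> chart_dom d" using E(2) by auto
  have Sd: "chart_inv c u \<in> E" "chart_inv c u \<in> chart_dom c" "chart_inv c u \<in> chart_dom d"
    "chart_map c (chart_inv c u) = u" "u \<in> chart_img c"
    if u: "u \<in> ?S" for u
  proof -
    obtain q where q: "q \<in> E" "u = chart_map c q" using u by blast
    then have "chart_inv c u = q" using Ec chart_inv_map[OF cd(1)] by blast
    then show "chart_inv c u \<in> E" "chart_inv c u \<in> chart_dom c" "chart_inv c u \<in> chart_dom d"
      "chart_map c (chart_inv c u) = u" "u \<in> chart_img c"
      using q Ec Ed by (auto simp: chart_img_def)
  qed
  have gS: "?g ` ?S = chart_map d ` E"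
    unfolding image_image o_def using Ec chart_inv_map[OF cd(1)] by (intro image_cong) auto
  have mS: "?S \<in> sets borel" "chart_map d ` E \<in> sets borel"
    using borel_chart_map_image cd E(1) Ec Ed by auto
  have dens: "\<bar>det (matrix (?g' u))\<bar> * vol_density d y (?g u) = vol_density c y u" if "u \<in> ?S" for u
    using vol_density_change_chart[OF cd Sd(2,3)[OF that] immersion_imp_smooth_map[OF y]] Sd(4)[OF that]
    by simp
  have meas: "(\<lambda>u. indicator (chart_map e ` E) u * vol_density e y u) \<in> borel_measurable borel"
    if e: "e \<in> A" "E \<subseteq> chart_dom e" for e
  proof -
    have "continuous_on (chart_map e ` E) (vol_density e y)"
      by (rule continuous_on_subset[OF continuous_on_vol_density[OF immersion_imp_smooth_map[OF y] e(1)]])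
        (use e(2) in \<open>auto simp: chart_img_def\<close>)
    from borel_measurable_continuous_on_indicator[OF borel_chart_map_image[OF e(1) E(1) e(2)] this]
    show ?thesis by simp
  qed
  have "(\<integral>\<^sup>+ v\<in>?g ` ?S. ennreal (vol_density d y v) \<partial>lborel) =
      (\<integral>\<^sup>+ u\<in>?S. ennreal (\<bar>det (matrix (?g' u))\<bar> * vol_density d y (?g u)) \<partial>lborel)"
  proof (rule nn_integral_change_of_variables)
    show "(?g has_derivative ?g' u) (at u within ?S)" if "u \<in> ?S" for u
      using has_derivative_transition[OF cd Sd(2,3)[OF that]] Sd(4)[OF that]
      by (simp add: has_derivative_at_withinI)
    show "inj_on ?g ?S"
    proof (rule inj_onI)
      fix u v assume uv: "u \<in> ?S" "v \<in> ?S" "?g u = ?g v"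
      then have "chart_inv c u = chart_inv c v"
        using Sd(3)[OF uv(1)] Sd(3)[OF uv(2)] by (metis chart_inv_map[OF cd(2)] o_apply)
      then show "u = v" using Sd(4)[OF uv(1)] Sd(4)[OF uv(2)] by metis
    qed
    show "0 \<le> vol_density d y v" if "v \<in> ?g ` ?S" for v
      using that vol_density_pos[OF y cd(2), of v] Ed unfolding gS by (force simp: chart_img_def)
    show "(\<lambda>v. indicator (?g ` ?S) v * vol_density d y v) \<in> borel_measurable borel"
      unfolding gS by (rule meas[OF cd(2) Ed])
    \<comment> \<open>Measurability of the integrand containing the Jacobian is read off from the
      density in the chart \<open>c\<close>, with which it agrees on \<open>?S\<close>.\<close>
    have "(\<lambda>u. indicator ?S u * (\<bar>det (matrix (?g' u))\<bar> * vol_density d y (?g u))) =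
        (\<lambda>u. indicator ?S u * vol_density c y u)"
    proof
      fix u show "indicator ?S u * (\<bar>det (matrix (?g' u))\<bar> * vol_density d y (?g u)) =
          indicator ?S u * vol_density c y u"
        by (cases "u \<in> ?S") (simp_all add: dens del: o_apply)
    qed
    then show "(\<lambda>u. indicator ?S u * (\<bar>det (matrix (?g' u))\<bar> * vol_density d y (?g u))) \<in> borel_measurable borel"
      using meas[OF cd(1) Ec] by simp
  qed (use mS gS in auto)
  also have "\<dots> = (\<integral>\<^sup>+ u\<in>?S. ennreal (vol_density c y u) \<partial>lborel)"
  proof (rule nn_integral_cong)
    fix u show "ennreal (\<bar>det (matrix (?g' u))\<bar> * vol_density d y (?g u)) * indicator ?S u =
        ennreal (vol_density c y u) * indicator ?S u"
      by (cases "u \<in> ?S") (simp_all add: dens del: o_apply)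
  qed
  finally show ?thesis unfolding gS .
qed

lemma chart_measure_change_chart:
  assumes y: "immersion A y" and cd: "c \<in> A" "d \<in> A"
    and E: "E \<in> sets borel" "E \<subseteq> chart_dom c \<inter> chart_dom d"
  shows "emeasure (chart_measure d y) E = emeasure (chart_measure c y) E"
proof -
  have "E \<inter> chart_dom c = E" "E \<inter> chart_dom d = E" using E(2) by auto
  then show ?thesis
    using nn_integral_vol_density_change_chart[OF assms]
    by (simp add: emeasure_chart_measure[OF y _ E(1)] cd)
qed

lemma countable_charts:
  obtains cs :: "nat \<Rightarrow> ('a, 'm) chart" where "range cs \<subseteq> A" "(\<Union>n. chart_dom (cs n)) = UNIV"
proof -
  obtain D where D: "D \<subseteq> chart_dom ` A" "countable D" "\<Union>D = \<Union>(chart_dom ` A)"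
    by (rule Lindelof[of "chart_dom ` A"]) (use open_chart_dom in auto)
  have UN: "\<Union>(chart_dom ` A) = UNIV" using atlas by (simp add: smooth_atlas_def)
  \<comment> \<open>\<open>from_nat_into\<close> enumerates any nonempty countable set, repeating
    members of a finite one, so finitely many charts also give a sequence.\<close>
  then have ne: "D \<noteq> {}" using D(3) by auto
  have "\<forall>n. \<exists>c\<in>A. chart_dom c = from_nat_into D n"
    using from_nat_into[OF ne] D(1) by (metis image_iff subsetD)
  then obtain cs where cs: "\<And>n. cs n \<in> A" "\<And>n. chart_dom (cs n) = from_nat_into D n" by metis
  have "(\<Union>n. chart_dom (cs n)) = \<Union>D"
    unfolding cs(2) using range_from_nat_into[OF ne D(2)] by metis
  then show ?thesis using that[of cs] cs(1) D(3) UN by auto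
qed

text \<open>Takes the role of a partition of unity: any Borel set splits into countably many
  disjoint parts, each inside a single chart.\<close>

lemma disjoint_chart_pieces:
  obtains cs :: "nat \<Rightarrow> ('a, 'm) chart" and P where
    "range cs \<subseteq> A" "disjoint_family P" "(\<Union>n. P n) = UNIV"
    "\<And>n. P n \<in> sets borel" "\<And>n. P n \<subseteq> chart_dom (cs n)"
proof -
  obtain cs :: "nat \<Rightarrow> ('a, 'm) chart" where cs: "range cs \<subseteq> A" "(\<Union>n. chart_dom (cs n)) = UNIV"
    by (rule countable_charts)
  let ?P = "disjointed (\<lambda>n. chart_dom (cs n))"
  have "range ?P \<subseteq> sets borel"
    by (rule sets.range_disjointed_sets) (use cs(1) borel_chart_dom in blast)
  then have "?P n \<in> sets borel" for n by auto
  moreover have "(\<Union>n. ?P n) = UNIV" using cs(2) by (simp add: UN_disjointed_eq)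
  ultimately show ?thesis
    by (intro that[of cs ?P] cs(1) disjoint_family_disjointed disjointed_subset)
qed

section \<open>Existence and uniqueness of the volume measure\<close>

definition is_volume :: "('a \<Rightarrow> real^'n) \<Rightarrow> 'a measure \<Rightarrow> bool" where
  "is_volume y \<mu> \<longleftrightarrow> sets \<mu> = sets borel \<and>
     (\<forall>c\<in>A. \<forall>E\<in>sets borel. E \<subseteq> chart_dom c \<longrightarrow> emeasure \<mu> E = emeasure (chart_measure c y) E)"

lemma volume_measure_eq: "immersion A y \<Longrightarrow> volume_measure A y = (THE \<mu>. is_volume y \<mu>)"
proof -
  assume y: "immersion A y"
  have "(\<integral>\<^sup>+ u\<in>chart_map c ` E. ennreal (sqrt (det (metric_coeffs c y u))) \<partial>lborel) =
      emeasure (chart_measure c y) E" if "c \<in> A" "E \<in> sets borel" "E \<subseteq> chart_dom c" for c E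
    using emeasure_chart_measure[OF y that(1,2)] that(3) by (simp add: Int_absorb2 vol_density_def)
  then have eq: "(\<lambda>\<mu>. sets \<mu> = sets borel \<and> (\<forall>c\<in>A. \<forall>E\<in>sets borel. E \<subseteq> chart_dom c \<longrightarrow>
        emeasure \<mu> E = (\<integral>\<^sup>+ u\<in>chart_map c ` E. ennreal (sqrt (det (metric_coeffs c y u))) \<partial>lborel)))
      = is_volume y"
    unfolding is_volume_def by (intro ext) (simp cong: conj_cong ball_cong imp_cong)
  show ?thesis unfolding volume_measure_def eq ..
qed

text \<open>The defining property concerns sets inside one chart; a general Borel set is cut along
  the disjoint pieces and reassembled by countable additivity.\<close>

lemma is_volume_unique:
  assumes "is_volume y \<mu>" "is_volume y \<nu>"
  shows "\<mu> = \<nu>"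
proof (rule measure_eqI)
  show "sets \<mu> = sets \<nu>" using assms by (simp add: is_volume_def)
  fix E assume "E \<in> sets \<mu>"
  then have E: "E \<in> sets borel" using assms by (simp add: is_volume_def)
  obtain cs :: "nat \<Rightarrow> ('a, 'm) chart" and P where P:
    "range cs \<subseteq> A" "disjoint_family P" "(\<Union>n. P n) = UNIV"
    "\<And>n. P n \<in> sets borel" "\<And>n. P n \<subseteq> chart_dom (cs n)"
    using disjoint_chart_pieces by metis
  have eq: "emeasure \<tau> E = (\<Sum>n. emeasure (chart_measure (cs n) y) (E \<inter> P n))" if \<tau>: "is_volume y \<tau>" for \<tau>
  proof -
    have "emeasure \<tau> (\<Union>n. E \<inter> P n) = (\<Sum>n. emeasure \<tau> (E \<inter> P n))"
      using \<tau> E P(2,4)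
      by (intro suminf_emeasure[symmetric]) (auto simp: is_volume_def disjoint_family_on_def)
    moreover have "emeasure \<tau> (E \<inter> P n) = emeasure (chart_measure (cs n) y) (E \<inter> P n)" for n
    proof -
      have "cs n \<in> A" "E \<inter> P n \<in> sets borel" "E \<inter> P n \<subseteq> chart_dom (cs n)" using P(1,4) P(5)[of n] E by auto
      then show ?thesis using \<tau> unfolding is_volume_def by blast
    qed
    moreover have "(\<Union>n. E \<inter> P n) = E" using P(3) by auto
    ultimately show ?thesis by simp
  qed
  show "emeasure \<mu> E = emeasure \<nu> E" using eq[OF assms(1)] eq[OF assms(2)] by simp
qed

text \<open>The measure is the sum over the disjoint pieces, each measured in its own chart. That
  every other chart sees the same values follows from agreement on overlaps.\<close>

lemma is_volume_exists:
  assumes y: "immersion A y"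
  shows "\<exists>\<mu>. is_volume y \<mu>"
proof -
  obtain cs :: "nat \<Rightarrow> ('a, 'm) chart" and P where P:
    "range cs \<subseteq> A" "disjoint_family P" "(\<Union>n. P n) = UNIV"
    "\<And>n. P n \<in> sets borel" "\<And>n. P n \<subseteq> chart_dom (cs n)"
    using disjoint_chart_pieces by metis
  let ?N = "\<lambda>n. chart_measure (cs n) y"
  define m where "m E = (\<Sum>n. emeasure (?N n) (E \<inter> P n))" for E
  define \<mu> where "\<mu> = measure_of (UNIV :: 'a set) (sets borel) m"
  have sets: "sets \<mu> = sets borel"
    unfolding \<mu>_def using sets.sigma_sets_eq[of borel] by (simp add: sets_measure_of_conv)
  have em: "emeasure \<mu> E = m E" if "E \<in> sets borel" for E
    unfolding \<mu>_def
  proof (rule emeasure_measure_of_sigma[OF _ _ _ that])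
    show "sigma_algebra (UNIV :: 'a set) (sets borel)"
      using sets.sigma_algebra_axioms[of borel] by simp
    show "positive (sets borel) m" by (simp add: positive_def m_def)
    show "countably_additive (sets borel) m"
    proof (rule countably_additiveI)
      fix F :: "nat \<Rightarrow> 'a set" assume F: "range F \<subseteq> sets borel" "disjoint_family F"
      \<comment> \<open>Writing one of the two series as an integral over counting measure lets
        monotone convergence interchange them.\<close>
      have "(\<Sum>i. m (F i)) = (\<Sum>i. \<integral>\<^sup>+ n. emeasure (?N n) (F i \<inter> P n) \<partial>count_space UNIV)"
        by (simp add: m_def nn_integral_count_space_nat)
      also have "\<dots> = (\<integral>\<^sup>+ n. (\<Sum>i. emeasure (?N n) (F i \<inter> P n)) \<partial>count_space UNIV)"
        by (rule nn_integral_suminf[symmetric]) simp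
      also have "\<dots> = (\<integral>\<^sup>+ n. emeasure (?N n) ((\<Union>i. F i) \<inter> P n) \<partial>count_space UNIV)"
      proof (rule nn_integral_cong)
        fix n
        have "(\<Sum>i. emeasure (?N n) (F i \<inter> P n)) = emeasure (?N n) (\<Union>i. F i \<inter> P n)"
          using F P(4) by (intro suminf_emeasure) (auto simp: disjoint_family_on_def)
        then show "(\<Sum>i. emeasure (?N n) (F i \<inter> P n)) = emeasure (?N n) ((\<Union>i. F i) \<inter> P n)"
          by (simp add: Int_UN_distrib2)
      qed
      also have "\<dots> = m (\<Union>i. F i)"
        by (simp add: m_def nn_integral_count_space_nat)
      finally show "(\<Sum>i. m (F i)) = m (\<Union>i. F i)" .
    qed
  qed
  have "emeasure \<mu> E = emeasure (chart_measure d y) E" if d: "d \<in> A" and E: "E \<in> sets borel" "E \<subseteq> chart_dom d" for d E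
  proof -
    have "emeasure \<mu> E = (\<Sum>n. emeasure (?N n) (E \<inter> P n))" using em[OF E(1)] by (simp add: m_def)
    \<comment> \<open>On each piece the chart \<open>cs n\<close> may be exchanged for
      \<open>d\<close>, after which additivity of a single measure puts \<open>E\<close> together
      again.\<close>
    also have "\<dots> = (\<Sum>n. emeasure (chart_measure d y) (E \<inter> P n))"
    proof (intro arg_cong[of _ _ suminf] ext)
      fix n show "emeasure (?N n) (E \<inter> P n) = emeasure (chart_measure d y) (E \<inter> P n)"
        by (rule chart_measure_change_chart[OF y d]) (use P(1,4) P(5)[of n] E in auto)
    qed
    also have "\<dots> = emeasure (chart_measure d y) (\<Union>n. E \<inter> P n)"
      using E P(2,4) by (intro suminf_emeasure) (auto simp: disjoint_family_on_def)
    also have "(\<Union>n. E \<inter> P n) = E" using P(3) by auto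
    finally show ?thesis .
  qed
  then show ?thesis using sets unfolding is_volume_def by blast
qed

lemma is_volume_volume_measure: "immersion A y \<Longrightarrow> is_volume y (volume_measure A y)"
  unfolding volume_measure_eq using is_volume_exists is_volume_unique by (metis theI)

lemma volume_measure_eqI: "immersion A y \<Longrightarrow> is_volume y \<mu> \<Longrightarrow> volume_measure A y = \<mu>"
  using is_volume_volume_measure is_volume_unique by blast

lemma sets_volume_measure: "immersion A y \<Longrightarrow> sets (volume_measure A y) = sets borel"
  using is_volume_volume_measure[of y] by (simp add: is_volume_def)

lemma emeasure_volume_measure:
  "immersion A y \<Longrightarrow> c \<in> A \<Longrightarrow> E \<in> sets borel \<Longrightarrow> E \<subseteq> chart_dom c \<Longrightarrow>
    emeasure (volume_measure A y) E = emeasure (chart_measure c y) E"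
  using is_volume_volume_measure[of y] by (simp add: is_volume_def)

text \<open>The volume measure cut down to a chart domain by an indicator density is
  \<open>chart_measure\<close>; equality on sets passes to integrals.\<close>

lemma nn_integral_volume_measure:
  assumes y: "immersion A y" and c: "c \<in> A" and f: "f \<in> borel_measurable borel"
  shows "(\<integral>\<^sup>+ q\<in>chart_dom c. f q \<partial>volume_measure A y) = (\<integral>\<^sup>+ q. f q \<partial>chart_measure c y)"
proof -
  let ?\<mu> = "volume_measure A y"
  have [measurable_cong]: "sets ?\<mu> = sets borel" by (rule sets_volume_measure[OF y])
  note borel_chart_dom[OF c, measurable]
  have "density ?\<mu> (indicator (chart_dom c)) = chart_measure c y"
  proof (rule measure_eqI)
    fix E assume "E \<in> sets (density ?\<mu> (indicator (chart_dom c)))"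
    then have E: "E \<in> sets borel" by (simp add: sets_volume_measure[OF y])
    have "emeasure (density ?\<mu> (indicator (chart_dom c))) E = emeasure ?\<mu> (chart_dom c \<inter> E)"
      using E borel_chart_dom[OF c]
      by (subst emeasure_density) (simp_all add: indicator_inter_arith[symmetric] sets_volume_measure[OF y])
    also have "\<dots> = emeasure (chart_measure c y) (chart_dom c \<inter> E)"
      using E borel_chart_dom[OF c] by (intro emeasure_volume_measure y c) auto
    also have "\<dots> = emeasure (chart_measure c y) E"
    proof -
      have "chart_dom c \<inter> E \<inter> chart_dom c = E \<inter> chart_dom c" by auto
      then show ?thesis
        using E borel_chart_dom[OF c] by (simp add: emeasure_chart_measure[OF y c])
    qed
    finally show "emeasure (density ?\<mu> (indicator (chart_dom c))) E = emeasure (chart_measure c y) E" .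
  qed (simp add: sets_volume_measure[OF y])
  then have "(\<integral>\<^sup>+ q. f q \<partial>chart_measure c y) = (\<integral>\<^sup>+ q. f q \<partial>density ?\<mu> (indicator (chart_dom c)))" by simp
  also have "\<dots> = (\<integral>\<^sup>+ q. indicator (chart_dom c) q * f q \<partial>?\<mu>)"
    by (rule nn_integral_density) (use f borel_chart_dom[OF c] in measurable)
  finally show ?thesis by (simp add: mult.commute)
qed

lemma continuous_on_charts:
  assumes "\<And>c. c \<in> A \<Longrightarrow> continuous_on (chart_dom c) f"
  shows "continuous_on UNIV f"
proof -
  have "continuous_on (\<Union>c\<in>A. chart_dom c) f"
    by (rule continuous_on_open_UN) (use open_chart_dom assms in auto)
  then show ?thesis using atlas by (simp add: smooth_atlas_def)
qed

section \<open>Comparing the volume measures of two immersions; volumes of compact and of open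
  sets\<close>

lemma continuous_on_volume_ratio:
  assumes x: "immersion A x" and y: "immersion A y"
  shows "continuous_on UNIV (volume_ratio A x y)"
proof (rule continuous_on_charts)
  fix c assume c: "c \<in> A"
  have "continuous_on (chart_dom c) (\<lambda>q. vol_density c z (chart_map c q))" if "immersion A z" for z :: "'a \<Rightarrow> real^'b"
    by (rule continuous_on_compose2[OF continuous_on_vol_density continuous_on_chart_map])
      (use that c in \<open>auto simp: immersion_imp_smooth_map chart_img_def\<close>)
  then have "continuous_on (chart_dom c)
      (\<lambda>q. vol_density c y (chart_map c q) / vol_density c x (chart_map c q))"
    using x y vol_density_pos[OF x c chart_map_in] by (intro continuous_on_divide) (auto simp: less_imp_neq[symmetric])
  then show "continuous_on (chart_dom c) (volume_ratio A x y)"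
    using volume_ratio_eq[OF x immersion_imp_smooth_map[OF y] c]
    by (simp cong: continuous_on_cong)
qed

lemma volume_ratio_pos: "immersion A x \<Longrightarrow> immersion A y \<Longrightarrow> volume_ratio A x y q > 0"
  by (simp add: volume_ratio_eq[OF _ immersion_imp_smooth_map chart_at] vol_density_pos chart_at chart_map_in)

text \<open>By uniqueness it suffices to test Borel subsets of charts, where the ratio cancels the
  density of \<open>x\<close> and leaves that of \<open>y\<close>. This brings all immersions of a
  variation to one reference measure.\<close>

theorem volume_measure_density:
  assumes x: "immersion A x" and y: "immersion A y"
  shows "volume_measure A y = density (volume_measure A x) (\<lambda>q. ennreal (volume_ratio A x y q))"
proof (rule volume_measure_eqI[OF y], unfold is_volume_def, intro conjI ballI impI)
  let ?\<mu> = "volume_measure A x" and ?J = "volume_ratio A x y"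
  have [measurable_cong]: "sets ?\<mu> = sets borel" by (rule sets_volume_measure[OF x])
  show "sets (density ?\<mu> (\<lambda>q. ennreal (?J q))) = sets borel" by (simp add: sets_volume_measure[OF x])
  have J [measurable]: "?J \<in> borel_measurable borel"
    using continuous_on_volume_ratio[OF x y] by (rule borel_measurable_continuous_onI)
  fix c and E :: "'a set" assume c: "c \<in> A" and E [measurable]: "E \<in> sets borel" and Ec: "E \<subseteq> chart_dom c"
  have "emeasure (density ?\<mu> (\<lambda>q. ennreal (?J q))) E = (\<integral>\<^sup>+ q. ennreal (?J q) * indicator E q \<partial>?\<mu>)"
    by (rule emeasure_density) (use E in measurable)
  also have "\<dots> = (\<integral>\<^sup>+ q\<in>chart_dom c. (ennreal (?J q) * indicator E q) \<partial>?\<mu>)"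
    using Ec by (intro nn_integral_cong) (auto simp: indicator_def)
  also have "\<dots> = (\<integral>\<^sup>+ q. ennreal (?J q) * indicator E q \<partial>chart_measure c x)"
    by (rule nn_integral_volume_measure[OF x c]) measurable
  also have "\<dots> = (\<integral>\<^sup>+ u\<in>chart_img c. (ennreal (vol_density c x u) *
      (ennreal (?J (chart_inv c u)) * indicator E (chart_inv c u))) \<partial>lborel)"
    by (rule nn_integral_chart_measure[OF x c]) measurable
  also have "\<dots> = (\<integral>\<^sup>+ u\<in>chart_img c. (ennreal (vol_density c y u) * indicator E (chart_inv c u)) \<partial>lborel)"
  proof (rule nn_integral_cong)
    fix u
    have "ennreal (vol_density c x u) * ennreal (?J (chart_inv c u)) = ennreal (vol_density c y u)"
      if u: "u \<in> chart_img c"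
    proof -
      have "?J (chart_inv c u) = vol_density c y u / vol_density c x u"
        using volume_ratio_eq[OF x immersion_imp_smooth_map[OF y] c chart_inv_in[OF c u]]
        by (simp add: chart_map_inv[OF c u])
      then show ?thesis
        using vol_density_pos[OF x c u] vol_density_pos[OF y c u]
        by (simp add: ennreal_mult'[symmetric])
    qed
    then show "ennreal (vol_density c x u) * (ennreal (?J (chart_inv c u)) * indicator E (chart_inv c u)) * indicator (chart_img c) u
        = ennreal (vol_density c y u) * indicator E (chart_inv c u) * indicator (chart_img c) u"
      by (cases "u \<in> chart_img c") (simp_all add: mult.assoc[symmetric])
  qed
  also have "\<dots> = emeasure (chart_measure c y) E"
    using nn_integral_chart_measure[OF y c, of "indicator E"] by simp
  finally show "emeasure (density ?\<mu> (\<lambda>q. ennreal (?J q))) E = emeasure (chart_measure c y) E" .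
qed

text \<open>A closed coordinate ball inside the chart image bounds the continuous density, so every
  point has a neighbourhood of finite volume; finitely many of these cover \<open>K\<close>.\<close>

lemma emeasure_volume_measure_compact:
  assumes y: "immersion A y" and K: "compact K"
  shows "emeasure (volume_measure A y) K < \<infinity>"
proof -
  let ?\<mu> = "volume_measure A y"
  have s: "sets ?\<mu> = sets borel" by (rule sets_volume_measure[OF y])
  have loc: "\<exists>U. open U \<and> q \<in> U \<and> emeasure ?\<mu> U < \<infinity>" for q
  proof -
    obtain c where c: "c \<in> A" "q \<in> chart_dom c" using ex_chart by blast
    obtain r where r: "r > 0" "cball (chart_map c q) r \<subseteq> chart_img c"
      using open_contains_cball[of "chart_img c"] open_chart_img[OF c(1)] chart_map_in[OF c(2)] by blast
    let ?B = "ball (chart_map c q) r"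
    let ?U = "chart_inv c ` ?B"
    have B: "?B \<subseteq> chart_img c" using r(2) by auto
    have U: "open ?U" by (rule open_chart_inv_image[OF c(1) _ B]) simp
    have q: "q \<in> ?U" using r(1) chart_inv_image[OF c(1) B] c(2) by auto
    have Uc: "?U \<subseteq> chart_dom c" using chart_inv_image[OF c(1) B] by auto
    have img: "chart_map c ` ?U = ?B"
      using B chart_map_inv[OF c(1)] by (force simp: image_image)
    have "compact (vol_density c y ` cball (chart_map c q) r)"
      by (rule compact_continuous_image[OF continuous_on_subset[OF continuous_on_vol_density r(2)]])
        (use y c in \<open>auto simp: immersion_imp_smooth_map\<close>)
    then obtain M where M: "\<And>u. u \<in> cball (chart_map c q) r \<Longrightarrow> vol_density c y u \<le> M"
      by (meson bounded_imp_bdd_above bdd_above.unfold compact_imp_bounded imageI)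
    have "emeasure ?\<mu> ?U = (\<integral>\<^sup>+ u\<in>?B. ennreal (vol_density c y u) \<partial>lborel)"
      using emeasure_volume_measure[OF y c(1) _ Uc] emeasure_chart_measure[OF y c(1), of ?U] U Uc
      by (simp add: Int_absorb2 img)
    also have "\<dots> \<le> (\<integral>\<^sup>+ u. ennreal M * indicator ?B u \<partial>lborel)"
      by (rule nn_integral_mono) (auto simp: indicator_def intro!: ennreal_leI M)
    also have "\<dots> = ennreal M * emeasure lborel ?B" by (rule nn_integral_cmult_indicator) simp
    also have "\<dots> < \<infinity>"
      using emeasure_lborel_ball_finite[of "chart_map c q" r] by (simp add: ennreal_mult_less_top)
    finally show ?thesis using U q by blast
  qed
  obtain U where U: "\<And>q. open (U q)" "\<And>q. q \<in> U q" "\<And>q. emeasure ?\<mu> (U q) < \<infinity>" using loc by metis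
  obtain F where F: "F \<subseteq> K" "finite F" "K \<subseteq> (\<Union>q\<in>F. U q)"
    using compactE_image[OF K, of K U] U by (metis UN_I subsetI)
  have "emeasure ?\<mu> K \<le> emeasure ?\<mu> (\<Union>q\<in>F. U q)"
    by (rule emeasure_mono[OF F(3)]) (use s U(1) in \<open>auto intro!: borel_open\<close>)
  also have "\<dots> \<le> (\<Sum>q\<in>F. emeasure ?\<mu> (U q))"
    by (rule emeasure_subadditive_finite[OF F(2)]) (use s U(1) in auto)
  also have "\<dots> < \<infinity>" using F(2) U(3) by simp
  finally show ?thesis .
qed

text \<open>A positive density with zero integral would force a nonempty open coordinate set to be
  negligible. It turns an almost everywhere statement about continuous functions into one at a given
  point.\<close>

lemma emeasure_volume_measure_open:
  assumes y: "immersion A y" and U: "open U" "q \<in> U"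
  shows "emeasure (volume_measure A y) U \<noteq> 0"
proof
  let ?\<mu> = "volume_measure A y"
  have s: "sets ?\<mu> = sets borel" by (rule sets_volume_measure[OF y])
  assume 0: "emeasure ?\<mu> U = 0"
  obtain c where c: "c \<in> A" "q \<in> chart_dom c" using ex_chart by blast
  let ?V = "U \<inter> chart_dom c"
  have V: "open ?V" "?V \<subseteq> chart_dom c" using U(1) open_chart_dom[OF c(1)] by auto
  let ?W = "chart_map c ` ?V"
  have W: "open ?W" "chart_map c q \<in> ?W" "?W \<subseteq> chart_img c"
    using open_chart_map_image[OF c(1) V] c U(2) by (auto simp: chart_img_def)
  have "emeasure ?\<mu> ?V \<le> emeasure ?\<mu> U" by (rule emeasure_mono) (use s U(1) in auto)
  then have "emeasure ?\<mu> ?V = 0" using 0 by simp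
  then have "(\<integral>\<^sup>+ u\<in>?W. ennreal (vol_density c y u) \<partial>lborel) = 0"
    using emeasure_volume_measure[OF y c(1) _ V(2)] emeasure_chart_measure[OF y c(1), of ?V] V(1)
    by (simp add: Int_assoc)
  moreover have "(\<lambda>u. ennreal (vol_density c y u) * indicator ?W u) \<in> borel_measurable lborel"
  proof -
    have "(\<lambda>u. indicator ?W u *\<^sub>R vol_density c y u) \<in> borel_measurable borel"
      using W(1) by (intro borel_measurable_continuous_on_indicator
          continuous_on_subset[OF continuous_on_vol_density W(3)] immersion_imp_smooth_map y c) auto
    then have "(\<lambda>u. ennreal (indicator ?W u *\<^sub>R vol_density c y u)) \<in> borel_measurable borel" by simp
    moreover have "ennreal (indicator ?W u *\<^sub>R vol_density c y u) = ennreal (vol_density c y u) * indicator ?W u" for u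
      by (cases "u \<in> ?W") simp_all
    ultimately show ?thesis by simp
  qed
  ultimately have "AE u in lborel. ennreal (vol_density c y u) * indicator ?W u = 0"
    by (simp add: nn_integral_0_iff_AE)
  then have "AE u in lborel. u \<notin> ?W"
  proof (rule AE_mp, intro AE_I2 impI notI)
    fix u assume "ennreal (vol_density c y u) * indicator ?W u = 0" "u \<in> ?W"
    then show False using vol_density_pos[OF y c(1), of u] W(3) by auto
  qed
  then have "?W \<in> null_sets lborel" using W(1) by (subst AE_iff_null_sets) auto
  then have "negligible ?W" by (simp add: negligible_iff_null_sets null_sets_completionI)
  then show False using open_not_negligible[OF W(1)] W(2) by blast
qed

end

section \<open>Weighted volumes along a variation\<close>

context atlas_manifold
begin

lemma differential_cong:
  assumes c: "c \<in> A" "q \<in> chart_dom c" and f: "smooth_map A f"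
    and U: "open U" "q \<in> U" "\<And>q'. q' \<in> U \<Longrightarrow> f q' = g q'"
  shows "differential c f q = differential c g q"
  unfolding differential_def
proof (rule frechet_derivative_transform_within_open)
  show "local_rep c f differentiable at (chart_map c q)"
    using has_derivative_differential[OF f c] by (rule differentiableI)
  show "open (chart_map c ` (U \<inter> chart_dom c))"
    using U(1) open_chart_dom[OF c(1)] by (intro open_chart_map_image c) auto
  show "local_rep c f u = local_rep c g u" if u: "u \<in> chart_map c ` (U \<inter> chart_dom c)" for u
  proof -
    obtain q' where "q' \<in> U" "q' \<in> chart_dom c" "u = chart_map c q'" using u by blast
    then show ?thesis using U(3)[of q'] by (simp add: local_rep_chart_map[OF c(1)])
  qed
qed (use c U in auto)

lemma smooth_map_imp_continuous_on: "smooth_map A f \<Longrightarrow> continuous_on UNIV f"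
proof (rule continuous_on_charts)
  fix c assume f: "smooth_map A f" and c: "c \<in> A"
  have "continuous_on (chart_dom c) (\<lambda>q. local_rep c f (chart_map c q))"
    by (rule continuous_on_compose2[OF smooth_on_imp_continuous_on[OF smooth_map_local_rep[OF f c]]
          continuous_on_chart_map[OF c]]) (auto simp: chart_img_def)
  then show "continuous_on (chart_dom c) f"
    by (rule continuous_on_eq) (rule local_rep_chart_map[OF c])
qed

end

lemma matrix_inv_symmetric:
  fixes G :: "real^'m^'m"
  assumes "det G \<noteq> 0" "transpose G = G"
  shows "matrix_inv G $ i $ j = matrix_inv G $ j $ i"
proof -
  let ?I = "matrix_inv G"
  have "transpose ?I ** G = mat 1"
    using arg_cong[OF matrix_inv_mult(1)[OF assms(1)], of transpose] assms(2)
    by (simp add: matrix_transpose_mul)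
  then have "transpose ?I ** (G ** ?I) = ?I" by (simp add: matrix_mul_assoc)
  then have "transpose ?I = ?I" by (simp add: matrix_inv_mult(1)[OF assms(1)])
  moreover have "transpose ?I $ i $ j = ?I $ j $ i" by (simp add: transpose_def)
  ultimately show ?thesis by simp
qed

section \<open>The weighted volume density along a variation\<close>

text \<open>The function \<beta> lets one argument serve both functionals: it is 0 for
  \<open>f_weight \<xi>\<close> and half of \<open>(norm (\<xi> q))\<^sup>2\<close> for
  \<open>f_bar_weight \<xi>\<close>.\<close>

locale weighted_variation = atlas_manifold A
  for A :: "('a::{t2_space,second_countable_topology}, 'm::finite) chart set" +
  fixes x \<xi> :: "'a \<Rightarrow> real^'n" and \<beta> :: "'a \<Rightarrow> real"
    and \<Phi> :: "('a \<Rightarrow> real^'n) \<Rightarrow> 'a \<Rightarrow> real"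
    and \<epsilon> :: real and F :: "'a \<Rightarrow> real \<Rightarrow> real^'n"
  assumes x: "immersion A x" and \<xi>: "smooth_map A \<xi>" and \<beta>: "continuous_on UNIV \<beta>"
    and \<Phi>: "\<And>y q. \<Phi> y q = f_weight \<xi> y q - \<beta> q"
    and var: "variation A x \<epsilon> F" and cpt: "compact_variation \<epsilon> F"
    and normal: "normal_variation A x F"
begin

abbreviation I :: "real set" where "I \<equiv> {-\<epsilon><..<\<epsilon>}"

text \<open>Coordinates and time form a single argument, so that mixed derivatives are second
  derivatives of one smooth map on an open set.\<close>

definition Fc :: "('a, 'm) chart \<Rightarrow> (real^'m) \<times> real \<Rightarrow> real^'n" where
  "Fc c z = F (chart_inv c (fst z)) (snd z)"

definition Fu :: "('a, 'm) chart \<Rightarrow> 'm \<Rightarrow> (real^'m) \<times> real \<Rightarrow> real^'n" where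
  "Fu c i z = frechet_derivative (Fc c) (at z) (axis i 1, 0)"

definition Ft :: "('a, 'm) chart \<Rightarrow> (real^'m) \<times> real \<Rightarrow> real^'n" where
  "Ft c z = frechet_derivative (Fc c) (at z) (0, 1)"

definition D :: "('a, 'm) chart \<Rightarrow> (real^'m) \<times> real \<Rightarrow> real" where
  "D c z = det (gram (\<lambda>i. Fu c i z))"

definition Dt :: "('a, 'm) chart \<Rightarrow> (real^'m) \<times> real \<Rightarrow> real" where
  "Dt c z = frechet_derivative (D c) (at z) (0, 1)"

text \<open>The density of the weighted volume of \<open>x_t\<close> with respect to the volume
  measure of \<open>x\<close>.\<close>

definition \<psi> :: "'a \<Rightarrow> real \<Rightarrow> real" where
  "\<psi> q t = exp (- \<Phi> (\<lambda>q. F q t) q) * volume_ratio A x (\<lambda>q. F q t) q"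

lemma \<epsilon>_pos: "\<epsilon> > 0" and F0: "F q 0 = x q" and imm: "t \<in> I \<Longrightarrow> immersion A (\<lambda>q. F q t)"
  using var by (auto simp: variation_def)

lemma smooth_F: "t \<in> I \<Longrightarrow> smooth_map A (\<lambda>q. F q t)"
  using imm immersion_imp_smooth_map by blast

lemma F_0: "(\<lambda>q. F q 0) = x" using F0 by auto

lemma open_chart_img_times: "c \<in> A \<Longrightarrow> open (chart_img c \<times> I)"
  by (simp add: open_Times open_chart_img)

lemma smooth_Fc: "c \<in> A \<Longrightarrow> smooth_on (chart_img c \<times> I) (Fc c)"
  using var by (simp add: variation_def Fc_def[abs_def] case_prod_beta')

lemma has_derivative_Fc:
  "c \<in> A \<Longrightarrow> z \<in> chart_img c \<times> I \<Longrightarrow> (Fc c has_derivative frechet_derivative (Fc c) (at z)) (at z)"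
  by (rule smooth_on_has_derivative[OF smooth_Fc])

lemma smooth_Fu: "c \<in> A \<Longrightarrow> smooth_on (chart_img c \<times> I) (Fu c i)"
  unfolding Fu_def[abs_def] by (intro smooth_on_frechet_derivative smooth_Fc)

lemma smooth_Ft: "c \<in> A \<Longrightarrow> smooth_on (chart_img c \<times> I) (Ft c)"
  unfolding Ft_def[abs_def] by (intro smooth_on_frechet_derivative smooth_Fc)

lemma smooth_D: "c \<in> A \<Longrightarrow> smooth_on (chart_img c \<times> I) (D c)"
  unfolding D_def[abs_def]
  by (intro smooth_on_det open_chart_img_times)
    (auto simp: gram_def intro!: smooth_on_bilinear[OF bounded_bilinear_inner] open_chart_img_times smooth_Fu)

lemma smooth_Dt: "c \<in> A \<Longrightarrow> smooth_on (chart_img c \<times> I) (Dt c)"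
  unfolding Dt_def[abs_def] by (intro smooth_on_frechet_derivative smooth_D)

lemma slice_u: "((\<lambda>u. (u, t)) has_derivative (\<lambda>a. (a, 0))) (at u)"
  by (auto intro!: derivative_eq_intros)

lemma slice_t: "((\<lambda>t. (u, t)) has_derivative (\<lambda>h. (0, h))) (at t)"
  by (auto intro!: derivative_eq_intros)

lemma has_vector_derivative_slice_t:
  assumes "(g has_derivative g') (at (u, t))"
  shows "((\<lambda>t. g (u, t)) has_vector_derivative g' (0, 1)) (at t)"
proof -
  have "((\<lambda>t. g (u, t)) has_derivative (\<lambda>h. g' (0, h))) (at t)"
    by (rule has_derivative_compose[OF slice_t assms])
  moreover have "(\<lambda>h. g' (0, h)) = (\<lambda>h. h *\<^sub>R g' (0, 1))"
  proof
    show "g' (0, h) = h *\<^sub>R g' (0, 1)" for h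
      using linear_cmul[OF has_derivative_linear[OF assms], of h "(0, 1)"] by simp
  qed
  ultimately show ?thesis unfolding has_vector_derivative_def by metis
qed

lemma partial_slice_u:
  assumes "(g has_derivative g') (at (u, t))"
  shows "partial i (\<lambda>u. g (u, t)) u = g' (axis i 1, 0)"
  unfolding partial_def
  using frechet_derivative_at[OF has_derivative_compose[OF slice_u assms]] by metis

lemma local_rep_F: "local_rep c (\<lambda>q. F q t) = (\<lambda>u. Fc c (u, t))"
  by (auto simp: local_rep_def Fc_def)

lemma partial_F:
  assumes "c \<in> A" "u \<in> chart_img c" "t \<in> I"
  shows "partial i (local_rep c (\<lambda>q. F q t)) u = Fu c i (u, t)"
  unfolding local_rep_F Fu_def by (rule partial_slice_u[OF has_derivative_Fc]) (use assms in auto)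

lemma det_metric_F:
  assumes "c \<in> A" "u \<in> chart_img c" "t \<in> I"
  shows "det (metric_coeffs c (\<lambda>q. F q t) u) = D c (u, t)"
  unfolding metric_coeffs_eq_gram D_def partial_F[OF assms] ..

lemma D_pos: "c \<in> A \<Longrightarrow> u \<in> chart_img c \<Longrightarrow> t \<in> I \<Longrightarrow> D c (u, t) > 0"
  using det_metric_pos[OF imm] det_metric_F by metis

lemma has_vector_derivative_F:
  assumes c: "c \<in> A" "q \<in> chart_dom c" and t: "t \<in> I"
  shows "(F q has_vector_derivative Ft c (chart_map c q, t)) (at t)"
proof -
  have "((\<lambda>t. Fc c (chart_map c q, t)) has_vector_derivative Ft c (chart_map c q, t)) (at t)"
    unfolding Ft_def
    by (rule has_vector_derivative_slice_t[OF has_derivative_Fc]) (use c t in \<open>auto simp: chart_img_def\<close>)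
  then show ?thesis using chart_inv_map[OF c] by (simp add: Fc_def)
qed

lemma velocity_eq:
  assumes "c \<in> A" "q \<in> chart_dom c" "t \<in> I"
  shows "velocity F t q = Ft c (chart_map c q, t)"
  unfolding velocity_def by (rule vector_derivative_at[OF has_vector_derivative_F[OF assms]])

definition \<psi>\<^sub>c :: "('a, 'm) chart \<Rightarrow> 'a \<times> real \<Rightarrow> real" where
  "\<psi>\<^sub>c c p = exp (\<beta> (fst p)) * exp (- (1/2 * (norm (Fc c (chart_map c (fst p), snd p) - \<xi> (fst p)))\<^sup>2)) *
    (sqrt (D c (chart_map c (fst p), snd p)) / sqrt (D c (chart_map c (fst p), 0)))"

lemma \<psi>_eq:
  assumes c: "c \<in> A" "q \<in> chart_dom c" and t: "t \<in> I"
  shows "\<psi> q t = \<psi>\<^sub>c c (q, t)"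
proof -
  have 0: "0 \<in> I" using \<epsilon>_pos by simp
  have u: "chart_map c q \<in> chart_img c" using c by (simp add: chart_img_def)
  have "volume_ratio A x (\<lambda>q. F q t) q = sqrt (D c (chart_map c q, t)) / sqrt (D c (chart_map c q, 0))"
    using volume_ratio_eq[OF x smooth_F[OF t] c] det_metric_F[OF c(1) u t] det_metric_F[OF c(1) u 0]
    by (simp add: vol_density_def F_0)
  moreover have "Fc c (chart_map c q, t) = F q t" using chart_inv_map[OF c] by (simp add: Fc_def)
  ultimately show ?thesis
    unfolding \<psi>_def \<psi>\<^sub>c_def \<Phi> f_weight_def by (simp add: exp_add[symmetric])
qed

text \<open>The second factor is the logarithmic derivative in time: one term from the square root
  of \<open>D\<close>, the other from the Gaussian weight.\<close>

definition \<psi>'\<^sub>c :: "('a, 'm) chart \<Rightarrow> 'a \<times> real \<Rightarrow> real" where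
  "\<psi>'\<^sub>c c p = \<psi>\<^sub>c c p *
    (Dt c (chart_map c (fst p), snd p) / (2 * D c (chart_map c (fst p), snd p))
      - (Fc c (chart_map c (fst p), snd p) - \<xi> (fst p)) \<bullet> Ft c (chart_map c (fst p), snd p))"

lemma has_derivative_\<psi>:
  assumes c: "c \<in> A" "q \<in> chart_dom c" and t: "t \<in> I"
  shows "(\<psi> q has_real_derivative \<psi>'\<^sub>c c (q, t)) (at t)"
proof -
  let ?u = "chart_map c q"
  have u: "?u \<in> chart_img c" using c by (simp add: chart_img_def)
  have z: "(?u, t) \<in> chart_img c \<times> I" using u t by simp
  have 0: "0 \<in> I" using \<epsilon>_pos by simp
  have D: "((\<lambda>t. D c (?u, t)) has_real_derivative Dt c (?u, t)) (at t)"
    unfolding Dt_def has_real_derivative_iff_has_vector_derivative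
    by (rule has_vector_derivative_slice_t[OF smooth_on_has_derivative[OF smooth_D[OF c(1)] z]])
  have Dp: "D c (?u, t) > 0" "D c (?u, 0) > 0" using D_pos c(1) u t 0 by auto
  have "((\<lambda>t. Fc c (?u, t) - \<xi> q) has_vector_derivative Ft c (?u, t)) (at t)"
    unfolding Ft_def
    by (rule has_vector_derivative_diff_const[THEN iffD2, OF has_vector_derivative_slice_t[OF has_derivative_Fc[OF c(1) z]]])
  then have V: "((\<lambda>t. Fc c (?u, t) - \<xi> q) has_derivative (\<lambda>h. h *\<^sub>R Ft c (?u, t))) (at t)"
    by (simp add: has_vector_derivative_def)
  have N: "((\<lambda>t. (Fc c (?u, t) - \<xi> q) \<bullet> (Fc c (?u, t) - \<xi> q)) has_real_derivative
      2 * ((Fc c (?u, t) - \<xi> q) \<bullet> Ft c (?u, t))) (at t)"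
    unfolding has_field_derivative_def
    by (rule has_derivative_eq_rhs[OF has_derivative_inner[OF V V]]) (auto simp: inner_commute)
  let ?N = "\<lambda>t. (Fc c (?u, t) - \<xi> q) \<bullet> (Fc c (?u, t) - \<xi> q)" and ?d0 = "sqrt (D c (?u, 0))"
  have E: "((\<lambda>t. exp (- (1/2 * ?N t))) has_real_derivative
      exp (- (1/2 * ?N t)) * (- ((Fc c (?u, t) - \<xi> q) \<bullet> Ft c (?u, t)))) (at t)"
    using DERIV_chain2[OF DERIV_exp DERIV_minus[OF DERIV_cmult[OF N, of "1/2"]]] by simp
  have S: "((\<lambda>t. sqrt (D c (?u, t)) / ?d0) has_real_derivative
      sqrt (D c (?u, t)) / ?d0 * (Dt c (?u, t) / (2 * D c (?u, t)))) (at t)"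
  proof -
    have eq: "inverse (sqrt (D c (?u, t))) / 2 * Dt c (?u, t) = sqrt (D c (?u, t)) * (Dt c (?u, t) / (2 * D c (?u, t)))"
      using Dp(1) real_sqrt_mult_self[of "D c (?u, t)"] by (simp add: divide_simps)
    have "inverse (sqrt (D c (?u, t))) / 2 * Dt c (?u, t) / ?d0 =
        sqrt (D c (?u, t)) / ?d0 * (Dt c (?u, t) / (2 * D c (?u, t)))"
      unfolding eq by (rule times_divide_eq_left[symmetric])
    then show ?thesis
      by (rule DERIV_cong[OF DERIV_cdivide[OF DERIV_chain2[OF DERIV_real_sqrt[OF Dp(1)] D], of ?d0]])
  qed
  have alg: "a * (e * - v) * s + s * k * (a * e) = a * e * s * (k - v)" for a e v s k :: real
    by (simp add: algebra_simps)
  have "((\<lambda>t. \<psi>\<^sub>c c (q, t)) has_real_derivative \<psi>'\<^sub>c c (q, t)) (at t)"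
    unfolding \<psi>'\<^sub>c_def \<psi>\<^sub>c_def power2_norm_eq_inner fst_conv snd_conv
    by (rule DERIV_cong[OF DERIV_mult[OF DERIV_cmult[OF E] S] alg])
  then show ?thesis
    by (rule has_field_derivative_transform_within_open[where S=I])
      (use t \<psi>_eq[OF c] in auto)
qed

end

section \<open>The first variation formula\<close>

context weighted_variation
begin

lemma zero_in_I: "0 \<in> I" using \<epsilon>_pos by simp

lemma deriv_\<psi>: "c \<in> A \<Longrightarrow> q \<in> chart_dom c \<Longrightarrow> t \<in> I \<Longrightarrow> deriv (\<psi> q) t = \<psi>'\<^sub>c c (q, t)"
  by (rule DERIV_imp_deriv[OF has_derivative_\<psi>])

text \<open>Joint continuity in point and time gives a uniform bound for the derivative on compact
  sets; restricted to time 0 it gives continuity of the first variation density.\<close>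

lemma continuous_on_\<psi>:
  "continuous_on (UNIV \<times> I) (\<lambda>p. \<psi> (fst p) (snd p))" (is ?thesis1)
  "continuous_on (UNIV \<times> I) (\<lambda>p. deriv (\<psi> (fst p)) (snd p))" (is ?thesis2)
proof -
  have on_charts: "continuous_on (UNIV \<times> I) g" if "\<And>c. c \<in> A \<Longrightarrow> continuous_on (chart_dom c \<times> I) g"
    for g :: "'a \<times> real \<Rightarrow> real"
  proof -
    have "continuous_on (\<Union>c\<in>A. chart_dom c \<times> I) g"
      by (rule continuous_on_open_UN) (use open_chart_dom that in \<open>auto simp: open_Times\<close>)
    moreover have "(\<Union>c\<in>A. chart_dom c \<times> I) = UNIV \<times> I"
      using ex_chart by auto
    ultimately show ?thesis by simp
  qed
  have coord: "continuous_on (chart_dom c \<times> I) (\<lambda>p. g (chart_map c (fst p), snd p))"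
    "continuous_on (chart_dom c \<times> I) (\<lambda>p. g (chart_map c (fst p), 0))"
    if c: "c \<in> A" and g: "smooth_on (chart_img c \<times> I) g" for c and g :: "_ \<Rightarrow> 'v::real_normed_vector"
  proof -
    have 1: "continuous_on (chart_dom c \<times> I) (\<lambda>p. chart_map c (fst p))"
      by (rule continuous_on_compose2[OF continuous_on_chart_map[OF c]]) (auto intro!: continuous_intros)
    show "continuous_on (chart_dom c \<times> I) (\<lambda>p. g (chart_map c (fst p), snd p))"
      "continuous_on (chart_dom c \<times> I) (\<lambda>p. g (chart_map c (fst p), 0))"
      by (rule continuous_on_compose2[OF smooth_on_imp_continuous_on[OF g]],
          use zero_in_I in \<open>auto intro!: continuous_intros 1 simp: chart_img_def\<close>)+
  qed
  have field: "continuous_on (chart_dom c \<times> I) (\<lambda>p. g (fst p))" if "continuous_on UNIV g"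
    for c and g :: "'a \<Rightarrow> 'v::real_normed_vector"
    by (rule continuous_on_compose2[OF that]) (auto intro!: continuous_intros)
  have D_nz: "D c (chart_map c (fst p), snd p) > 0" "D c (chart_map c (fst p), 0) > 0"
    if "c \<in> A" "p \<in> chart_dom c \<times> I" for c p
    using that D_pos[of c "chart_map c (fst p)"] zero_in_I by (auto simp: chart_img_def)
  have cont_\<psi>\<^sub>c: "continuous_on (chart_dom c \<times> I) (\<psi>\<^sub>c c)" if c: "c \<in> A" for c
    unfolding \<psi>\<^sub>c_def[abs_def] power2_norm_eq_inner
    by (intro continuous_intros coord c smooth_Fc smooth_D field \<beta> smooth_map_imp_continuous_on[OF \<xi>])
      (use D_nz(2)[OF c] in force)
  have cont_\<psi>'\<^sub>c: "continuous_on (chart_dom c \<times> I) (\<psi>'\<^sub>c c)" if c: "c \<in> A" for c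
    unfolding \<psi>'\<^sub>c_def[abs_def]
    by (intro continuous_intros coord c smooth_Fc smooth_D smooth_Dt smooth_Ft field
        smooth_map_imp_continuous_on[OF \<xi>] cont_\<psi>\<^sub>c)
      (use D_nz(1)[OF c] in force)
  show ?thesis1
    by (rule on_charts, rule continuous_on_eq[OF cont_\<psi>\<^sub>c]) (auto simp: \<psi>_eq)
  show ?thesis2
    by (rule on_charts, rule continuous_on_eq[OF cont_\<psi>'\<^sub>c]) (auto simp: deriv_\<psi>)
qed

lemma has_derivative_\<psi>_deriv: "t \<in> I \<Longrightarrow> (\<psi> q has_real_derivative deriv (\<psi> q) t) (at t)"
  using has_derivative_\<psi>[OF chart_at] deriv_\<psi>[OF chart_at] by simp

lemma F_eq_outside:
  assumes q: "q \<notin> B" and B: "\<And>t. t \<in> I \<Longrightarrow> velocity F t q \<noteq> 0 \<Longrightarrow> q \<in> B" and t: "t \<in> I"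
  shows "F q t = x q"
proof -
  have "(F q has_vector_derivative 0) (at s within I)" if s: "s \<in> I" for s
  proof -
    have "velocity F s q = 0" using B[OF s] q by blast
    then show ?thesis
      using has_vector_derivative_F[OF chart_at[of q] s] velocity_eq[OF chart_at[of q] s]
      by (simp add: has_vector_derivative_at_within)
  qed
  from has_vector_derivative_zero_constant[OF convex_real_interval(8) this]
  obtain a where "\<And>s. s \<in> I \<Longrightarrow> F q s = a" by blast
  then show ?thesis using t zero_in_I F0 by metis
qed

lemma compact_support:
  obtains K where "compact K" "\<And>q t. q \<notin> K \<Longrightarrow> t \<in> I \<Longrightarrow> F q t = x q \<and> \<psi> q t = \<psi> q 0"
    "\<And>q. q \<notin> K \<Longrightarrow> velocity F 0 q = 0"
proof -
  obtain B where B: "open B" "compact (closure B)" "\<And>t. t \<in> I \<Longrightarrow> closure {q. velocity F t q \<noteq> 0} \<subseteq> B"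
    using cpt unfolding compact_variation_def by blast
  let ?K = "closure B"
  have F: "F q t = x q" if "q \<notin> ?K" "t \<in> I" for q t
  proof (rule F_eq_outside[OF that(1) _ that(2)])
    fix s assume s: "s \<in> I" "velocity F s q \<noteq> 0"
    then have "q \<in> closure {q. velocity F s q \<noteq> 0}" using closure_subset by fastforce
    then show "q \<in> ?K" using B(3)[OF s(1)] closure_subset by blast
  qed
  have psi: "\<psi> q t = \<psi> q 0" if q: "q \<notin> ?K" and t: "t \<in> I" for q t
  proof -
    let ?c = "chart_at A q"
    \<comment> \<open>The volume ratio contains derivatives in \<open>q\<close>, so agreement at one
      point would be too little. The complement of the closed set \<open>?K\<close> is a
      neighbourhood of \<open>q\<close> on which \<open>F\<close> at time \<open>t\<close> coincides
      with \<open>x\<close>.\<close>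
    have "differential ?c (\<lambda>q. F q t) q = differential ?c x q"
      by (rule differential_cong[OF chart_at smooth_F[OF t], of "- ?K"]) (use q F t in auto)
    then have "vol_density ?c (\<lambda>q. F q t) (chart_map ?c q) = vol_density ?c x (chart_map ?c q)"
      by (simp add: vol_density_def metric_coeffs_eq_gram partial_eq_differential)
    then have "volume_ratio A x (\<lambda>q. F q t) q = volume_ratio A x (\<lambda>q. F q 0) q"
      using volume_ratio_eq[OF x smooth_F[OF t] chart_at] volume_ratio_eq[OF x smooth_F[OF zero_in_I] chart_at]
      by (simp add: F_0)
    moreover have "\<Phi> (\<lambda>q. F q t) q = \<Phi> (\<lambda>q. F q 0) q"
      using F[OF q t] by (simp add: \<Phi> f_weight_def F0)
    ultimately show ?thesis by (simp add: \<psi>_def)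
  qed
  have "velocity F 0 q = 0" if "q \<notin> ?K" for q
  proof (rule ccontr)
    assume "velocity F 0 q \<noteq> 0"
    then have "q \<in> closure {q. velocity F 0 q \<noteq> 0}" using closure_subset by fastforce
    then show False using B(3)[OF zero_in_I] closure_subset that by blast
  qed
  then show ?thesis using that[of ?K] B(2) F psi by blast
qed

definition first_var :: "'a \<Rightarrow> real" where
  "first_var q = - exp (- \<Phi> x q) * (velocity F 0 q \<bullet> (mean_curvature A x q + normal_part A x q (x q) - \<xi> q))"

text \<open>The divergence term: a normal velocity \<open>W\<close> satisfies \<open>\<langle>\<partial>\<^sub>i W, \<partial>\<^sub>j x\<rangle> = - \<langle>W, \<partial>\<^sub>i \<partial>\<^sub>j x\<rangle>\<close>.\<close>

lemma Dt_0:
  fixes q :: 'a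
  defines "c \<equiv> chart_at A q"
  defines "u \<equiv> chart_map c q"
  shows "Dt c (u, 0) / (2 * D c (u, 0)) = - (velocity F 0 q \<bullet> mean_curvature A x q)"
proof -
  \<comment> \<open>The computation is carried out in \<open>chart_at A q\<close> because
    \<open>mean_curvature\<close> is evaluated in that chart.\<close>
  have c: "c \<in> A" "q \<in> chart_dom c" using chart_at by (auto simp: c_def)
  have u: "u \<in> chart_img c" using c by (auto simp: u_def chart_img_def)
  have z: "(u, 0) \<in> chart_img c \<times> I" using u zero_in_I by simp
  have smx: "smooth_map A x" using x by (rule immersion_imp_smooth_map)
  let ?W = "\<lambda>v. Ft c (v, 0)"
  let ?P = "\<lambda>i. Fu c i (u, 0)"
  define dW where "dW i = frechet_derivative (Ft c) (at (u, 0)) (axis i 1, 0)" for i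
  define G where "G = gram (\<lambda>i. ?P i)"
  have detG: "det G = D c (u, 0)" by (simp add: G_def D_def)
  have detG_nz: "det G \<noteq> 0" using D_pos[OF c(1) u zero_in_I] detG by simp
  have G_eq: "G = metric_coeffs c x u"
    unfolding G_def metric_coeffs_eq_gram using partial_F[OF c(1) u zero_in_I] by (simp add: F_0)
  let ?Gi = "matrix_inv G"
  have Gi_sym: "?Gi $ i $ j = ?Gi $ j $ i" for i j
    by (rule matrix_inv_symmetric[OF detG_nz]) (simp add: G_def gram_def transpose_def vec_eq_iff inner_commute)
  \<comment> \<open>Exchanging the two derivatives of \<open>Fc c\<close> identifies the time
    derivative of the i-th coordinate vector with \<open>dW i\<close>, the i-th coordinate
    derivative of the velocity.\<close>
  have dP: "((\<lambda>t. Fu c i (u, t)) has_vector_derivative dW i) (at 0)" for i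
  proof -
    have "C_k_on 2 (chart_img c \<times> I) (Fc c)"
      by (rule smooth_on_imp_C_k_on[OF smooth_Fc[OF c(1)]])
    from second_derivative_symmetric[OF open_chart_img_times[OF c(1)] z this, of "(axis i 1, 0)" "(0, 1)"]
    have "frechet_derivative (Fu c i) (at (u, 0)) (0, 1) = dW i"
      by (simp add: Fu_def[abs_def] Ft_def[abs_def] dW_def)
    then show ?thesis
      using has_vector_derivative_slice_t[OF smooth_on_has_derivative[OF smooth_Fu[OF c(1)] z], of i] by simp
  qed
  have "((\<lambda>t. Fu c i (u, t) \<bullet> Fu c j (u, t)) has_real_derivative (?P i \<bullet> dW j + dW i \<bullet> ?P j)) (at 0)" for i j
  proof -
    have "((\<lambda>t. Fu c i (u, t) \<bullet> Fu c j (u, t)) has_derivative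
        (\<lambda>h. ?P i \<bullet> (h *\<^sub>R dW j) + (h *\<^sub>R dW i) \<bullet> ?P j)) (at 0)"
      using has_derivative_inner[OF dP[unfolded has_vector_derivative_def] dP[unfolded has_vector_derivative_def]] .
    then show ?thesis
      unfolding has_field_derivative_def
      by (rule has_derivative_eq_rhs) (auto simp: algebra_simps)
  qed
  then have "((\<lambda>t. det (gram (\<lambda>i. Fu c i (u, t)))) has_real_derivative
      det (gram (\<lambda>i. Fu c i (u, 0))) * (\<Sum>i\<in>UNIV. \<Sum>j\<in>UNIV. matrix_inv (gram (\<lambda>i. Fu c i (u, 0))) $ i $ j
        * (\<chi> j i. ?P j \<bullet> dW i + dW j \<bullet> ?P i) $ j $ i)) (at 0)"
    using detG_nz by (intro has_derivative_det) (simp_all add: gram_def G_def)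
  then have 1: "((\<lambda>t. D c (u, t)) has_real_derivative
      D c (u, 0) * (\<Sum>i\<in>UNIV. \<Sum>j\<in>UNIV. ?Gi $ i $ j * (?P j \<bullet> dW i + dW j \<bullet> ?P i))) (at 0)"
    by (simp add: D_def G_def)
  have 2: "((\<lambda>t. D c (u, t)) has_real_derivative Dt c (u, 0)) (at 0)"
    unfolding Dt_def has_real_derivative_iff_has_vector_derivative
    by (rule has_vector_derivative_slice_t[OF smooth_on_has_derivative[OF smooth_D[OF c(1)] z]])
  have "Dt c (u, 0) = D c (u, 0) * (\<Sum>i\<in>UNIV. \<Sum>j\<in>UNIV. ?Gi $ i $ j * (?P j \<bullet> dW i + dW j \<bullet> ?P i))"
    by (rule DERIV_unique[OF 2 1])
  \<comment> \<open>Since the inverse metric is symmetric, both terms of the product rule contribute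
    equally; the resulting 2 cancels the one that stems from the square root in the volume
    density.\<close>
  also have "(\<Sum>i\<in>UNIV. \<Sum>j\<in>UNIV. ?Gi $ i $ j * (?P j \<bullet> dW i + dW j \<bullet> ?P i)) =
      2 * (\<Sum>i\<in>UNIV. \<Sum>j\<in>UNIV. ?Gi $ i $ j * (dW i \<bullet> ?P j))"
  proof -
    have "(\<Sum>i\<in>UNIV. \<Sum>j\<in>UNIV. ?Gi $ i $ j * (dW j \<bullet> ?P i)) = (\<Sum>i\<in>UNIV. \<Sum>j\<in>UNIV. ?Gi $ i $ j * (dW i \<bullet> ?P j))"
      by (subst sum.swap) (intro sum.cong refl arg_cong2[where f="(*)"] Gi_sym)
    then show ?thesis by (simp add: distrib_left sum.distrib inner_commute)
  qed
  finally have "Dt c (u, 0) / (2 * D c (u, 0)) = (\<Sum>i\<in>UNIV. \<Sum>j\<in>UNIV. ?Gi $ i $ j * (dW i \<bullet> ?P j))"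
    using D_pos[OF c(1) u zero_in_I] by simp
  also have "\<dots> = (\<Sum>i\<in>UNIV. \<Sum>j\<in>UNIV. ?Gi $ i $ j * - (velocity F 0 q \<bullet> second_fundamental_form A c x q i j))"
  proof (intro sum.cong refl, rule arg_cong[of _ _ "(*) _"])
    fix i j
    let ?xj = "partial j (local_rep c x)"
    have smooth_xj: "smooth_on (chart_img c) ?xj"
      unfolding partial_def[abs_def] by (intro smooth_on_frechet_derivative smooth_map_local_rep smx c)
    have dx: "(?xj has_derivative frechet_derivative ?xj (at u)) (at u)"
      by (rule smooth_on_has_derivative[OF smooth_xj u])
    have dWd: "(?W has_derivative (\<lambda>a. frechet_derivative (Ft c) (at (u, 0)) (a, 0))) (at u)"
      by (rule has_derivative_compose[OF slice_u smooth_on_has_derivative[OF smooth_Ft[OF c(1)] z]])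
    \<comment> \<open>Normality at every point of the chart, not just at \<open>q\<close>, is what
      permits this relation to be differentiated.\<close>
    have orth: "?W v \<bullet> ?xj v = 0" if v: "v \<in> chart_img c" for v
    proof -
      let ?q = "chart_inv c v"
      have q: "?q \<in> chart_dom c" "chart_map c ?q = v" using v c(1) chart_inv_in chart_map_inv by auto
      have "velocity F 0 ?q \<in> normal_space A x ?q" using normal by (simp add: normal_variation_def)
      then have "velocity F 0 ?q \<bullet> differential c x ?q (axis j 1) = 0"
        using normal_space_eq[OF c(1) q(1) smx] by blast
      then show ?thesis
        using velocity_eq[OF c(1) q(1) zero_in_I] partial_eq_differential[of j c x ?q] q(2) by simp
    qed
    have "((\<lambda>v. ?W v \<bullet> ?xj v) has_derivative
        (\<lambda>a. ?W u \<bullet> frechet_derivative ?xj (at u) a + frechet_derivative (Ft c) (at (u, 0)) (a, 0) \<bullet> ?xj u)) (at u)"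
      by (rule has_derivative_inner[OF dWd dx])
    moreover have "((\<lambda>v. ?W v \<bullet> ?xj v) has_derivative (\<lambda>a. 0)) (at u)"
      by (rule has_derivative_transform_within_open[OF has_derivative_const open_chart_img[OF c(1)] u])
        (simp add: orth)
    ultimately have "(\<lambda>a. ?W u \<bullet> frechet_derivative ?xj (at u) a + frechet_derivative (Ft c) (at (u, 0)) (a, 0) \<bullet> ?xj u)
        = (\<lambda>a. 0)" by (rule has_derivative_unique)
    from fun_cong[OF this, of "axis i 1"]
    have "dW i \<bullet> ?xj u = - (?W u \<bullet> partial i ?xj u)" by (simp add: dW_def partial_def)
    moreover have "?xj u = ?P j" using partial_F[OF c(1) u zero_in_I] by (simp add: F_0)
    moreover have "?W u = velocity F 0 q" using velocity_eq[OF c zero_in_I] by (simp add: u_def)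
    \<comment> \<open>Pairing with the normal velocity does not see the tangential part of the
      second derivative.\<close>
    moreover have "velocity F 0 q \<bullet> second_fundamental_form A c x q i j = velocity F 0 q \<bullet> partial i ?xj u"
      unfolding second_fundamental_form_def u_def[symmetric]
      by (rule inner_normal_part[OF smx]) (use normal in \<open>simp add: normal_variation_def\<close>)
    ultimately show "dW i \<bullet> ?P j = - (velocity F 0 q \<bullet> second_fundamental_form A c x q i j)" by simp
  qed
  also have "\<dots> = - (velocity F 0 q \<bullet> mean_curvature A x q)"
    unfolding mean_curvature_def Let_def c_def[symmetric] u_def[symmetric] G_eq[symmetric]
    by (simp add: inner_sum_right sum_negf)
  finally show ?thesis .
qed

lemma deriv_\<psi>_0: "deriv (\<psi> q) 0 = first_var q"
proof -
  let ?c = "chart_at A q" and ?W = "velocity F 0 q"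
  let ?u = "chart_map ?c q"
  have smx: "smooth_map A x" using x by (rule immersion_imp_smooth_map)
  have W: "?W \<in> normal_space A x q" using normal by (simp add: normal_variation_def)
  have "\<psi>\<^sub>c ?c (q, 0) = \<psi> q 0" using \<psi>_eq[OF chart_at zero_in_I] by simp
  also have "\<dots> = exp (- \<Phi> x q)"
    using volume_ratio_eq[OF x smx chart_at, of q] vol_density_pos[OF x chart_at(1) chart_map_in[OF chart_at(2)], of q]
    by (simp add: \<psi>_def F_0)
  finally have \<psi>0: "\<psi>\<^sub>c ?c (q, 0) = exp (- \<Phi> x q)" .
  have "deriv (\<psi> q) 0 = exp (- \<Phi> x q) * (- (?W \<bullet> mean_curvature A x q) - (x q - \<xi> q) \<bullet> ?W)"
    unfolding deriv_\<psi>[OF chart_at zero_in_I] \<psi>'\<^sub>c_def fst_conv snd_conv \<psi>0 Dt_0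
      velocity_eq[OF chart_at zero_in_I, symmetric]
    by (simp add: Fc_def chart_inv_map[OF chart_at] F0)
  \<comment> \<open>Against the normal velocity, \<open>x q\<close> may be replaced by its normal
    part.\<close>
  also have "\<dots> = first_var q"
    unfolding first_var_def using inner_normal_part[OF smx W, of "x q"]
    by (simp add: inner_diff_right inner_add_right inner_commute algebra_simps)
  finally show ?thesis .
qed

lemma continuous_on_first_var: "continuous_on UNIV first_var"
proof -
  have "continuous_on UNIV (\<lambda>q::'a. (q, 0::real))" by (intro continuous_intros)
  moreover have "(\<lambda>q::'a. (q, 0::real)) ` UNIV \<subseteq> UNIV \<times> I" using zero_in_I by auto
  ultimately show ?thesis
    using continuous_on_compose2[OF continuous_on_\<psi>(2), of UNIV "\<lambda>q. (q, 0)"] by (simp add: deriv_\<psi>_0)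
qed

section \<open>Differentiation under the integral sign\<close>

abbreviation \<mu> :: "'a measure" where "\<mu> \<equiv> volume_measure A x"

lemma integrable_first_var: "integrable \<mu> first_var"
proof -
  obtain K where K: "compact K" "\<And>q. q \<notin> K \<Longrightarrow> velocity F 0 q = 0" using compact_support by metis
  have "compact (first_var ` K)" by (rule compact_continuous_image[OF continuous_on_subset[OF continuous_on_first_var] K(1)]) simp
  then obtain C where C: "\<And>q. q \<in> K \<Longrightarrow> norm (first_var q) \<le> C"
    by (meson bounded_iff compact_imp_bounded imageI)
  show ?thesis
  proof (rule integrableI_bounded_set[where A=K and B=C])
    show "K \<in> sets \<mu>" using K(1) sets_volume_measure[OF x] by (simp add: borel_compact)
    show "first_var \<in> borel_measurable \<mu>"
      using borel_measurable_continuous_onI[OF continuous_on_first_var] measurable_cong_sets[OF sets_volume_measure[OF x] refl] by blast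
    show "emeasure \<mu> K < \<infinity>" by (rule emeasure_volume_measure_compact[OF x K(1)])
  qed (use C K(2) in \<open>auto simp: first_var_def\<close>)
qed

lemma measurable_\<psi>: "t \<in> I \<Longrightarrow> (\<lambda>q. \<psi> q t) \<in> borel_measurable \<mu>"
proof -
  assume t: "t \<in> I"
  have "continuous_on UNIV (\<lambda>q::'a. (q, t))" by (intro continuous_intros)
  moreover have "(\<lambda>q::'a. (q, t)) ` UNIV \<subseteq> UNIV \<times> I" using t by auto
  ultimately have "continuous_on UNIV (\<lambda>q. \<psi> q t)"
    using continuous_on_compose2[OF continuous_on_\<psi>(1), of UNIV "\<lambda>q. (q, t)"] by simp
  then have "(\<lambda>q. \<psi> q t) \<in> borel_measurable borel" by (rule borel_measurable_continuous_onI)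
  then show ?thesis using measurable_cong_sets[OF sets_volume_measure[OF x] refl] by blast
qed

lemma weighted_volume_\<psi>:
  assumes t: "t \<in> I"
  shows "weighted_volume_finite A \<Phi> (\<lambda>q. F q t) \<longleftrightarrow> integrable \<mu> (\<lambda>q. \<psi> q t)"
    and "weighted_volume A \<Phi> (\<lambda>q. F q t) = (\<integral>q. \<psi> q t \<partial>\<mu>)"
proof -
  let ?J = "volume_ratio A x (\<lambda>q. F q t)" and ?f = "\<lambda>q. exp (- \<Phi> (\<lambda>q. F q t) q)"
  have ms: "borel_measurable \<mu> = borel_measurable borel"
    by (rule measurable_cong_sets[OF sets_volume_measure[OF x] refl])
  have J: "?J \<in> borel_measurable \<mu>"
    unfolding ms by (rule borel_measurable_continuous_onI[OF continuous_on_volume_ratio[OF x imm[OF t]]])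
  have pos: "?J q > 0" for q by (rule volume_ratio_pos[OF x imm[OF t]])
  \<comment> \<open>Measurability of the weight is recovered from that of \<open>\<psi>\<close> by
    dividing by the positive volume ratio.\<close>
  have "(\<lambda>q. \<psi> q t / ?J q) \<in> borel_measurable \<mu>"
    using measurable_\<psi>[OF t] J by (rule borel_measurable_divide)
  moreover have "\<psi> q t / ?J q = ?f q" for q using pos[of q] by (simp add: \<psi>_def)
  ultimately have f: "?f \<in> borel_measurable \<mu>" by simp
  have dens: "volume_measure A (\<lambda>q. F q t) = density \<mu> (\<lambda>q. ennreal (?J q))"
    by (rule volume_measure_density[OF x imm[OF t]])
  have J0: "AE q in \<mu>. 0 \<le> ?J q" using pos by (intro AE_I2 less_imp_le)
  show "weighted_volume_finite A \<Phi> (\<lambda>q. F q t) \<longleftrightarrow> integrable \<mu> (\<lambda>q. \<psi> q t)"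
    unfolding weighted_volume_finite_def dens integrable_density[OF f J J0] by (simp add: \<psi>_def mult.commute)
  show "weighted_volume A \<Phi> (\<lambda>q. F q t) = (\<integral>q. \<psi> q t \<partial>\<mu>)"
    unfolding weighted_volume_def dens integral_density[OF f J J0] by (simp add: \<psi>_def mult.commute)
qed

text \<open>Dominated convergence along sequences: on \<open>K\<close> the mean value inequality
  bounds the difference quotient by a constant, and off \<open>K\<close> the quotient is zero, so a
  multiple of the indicator of \<open>K\<close> dominates.\<close>

lemma weighted_volume_has_derivative:
  assumes fin: "\<And>t. t \<in> I \<Longrightarrow> weighted_volume_finite A \<Phi> (\<lambda>q. F q t)"
  shows "((\<lambda>t. weighted_volume A \<Phi> (\<lambda>q. F q t)) has_real_derivative (\<integral>q. first_var q \<partial>\<mu>)) (at 0)"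
  unfolding has_field_derivative_iff tendsto_at_iff_sequentially
proof (intro allI impI)
  obtain K where K: "compact K" "\<And>q t. q \<notin> K \<Longrightarrow> t \<in> I \<Longrightarrow> F q t = x q \<and> \<psi> q t = \<psi> q 0"
    using compact_support by metis
  \<comment> \<open>Half of \<epsilon> leaves a compact interval inside \<open>I\<close>, so the
    continuous time derivative is bounded on the product with \<open>K\<close>.\<close>
  define \<delta> where "\<delta> = \<epsilon> / 2"
  have \<delta>: "\<delta> > 0" "{-\<delta>..\<delta>} \<subseteq> I" using \<epsilon>_pos by (auto simp: \<delta>_def)
  let ?d = "\<lambda>p. deriv (\<psi> (fst p)) (snd p)"
  have "K \<times> {-\<delta>..\<delta>} \<subseteq> UNIV \<times> I" using \<delta>(2) by blast
  from compact_continuous_image[OF continuous_on_subset[OF continuous_on_\<psi>(2) this] compact_Times[OF K(1) compact_Icc]]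
  have "compact (?d ` (K \<times> {-\<delta>..\<delta>}))" .
  from compact_imp_bounded[OF this] obtain C where "\<forall>y\<in>?d ` (K \<times> {-\<delta>..\<delta>}). norm y \<le> C"
    unfolding bounded_iff ..
  then have C: "norm (?d p) \<le> C" if "p \<in> K \<times> {-\<delta>..\<delta>}" for p using that by (rule bspec[OF _ imageI])
  have bound: "norm ((\<psi> q t - \<psi> q 0) / t) \<le> C * indicator K q" if t: "t \<in> {-\<delta>..\<delta>}" "t \<noteq> 0" for q t
  proof (cases "q \<in> K")
    case True
    have "norm (\<psi> q t - \<psi> q 0) \<le> C * norm (t - 0)"
    proof (rule field_differentiable_bound[of "{-\<delta>..\<delta>}" "\<psi> q" "deriv (\<psi> q)"])
      show "(\<psi> q has_real_derivative deriv (\<psi> q) s) (at s within {-\<delta>..\<delta>})" if "s \<in> {-\<delta>..\<delta>}" for s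
        by (rule has_field_derivative_at_within[OF has_derivative_\<psi>_deriv]) (use that \<delta>(2) in blast)
      show "norm (deriv (\<psi> q) s) \<le> C" if "s \<in> {-\<delta>..\<delta>}" for s
        using C[of "(q, s)"] True that by simp
    qed (use t \<delta> in auto)
    then show ?thesis using True t by (simp add: divide_simps)
  next
    case False
    then show ?thesis using K(2)[of q t] t \<delta> by auto
  qed
  fix X :: "nat \<Rightarrow> real" assume X: "\<forall>i. X i \<in> UNIV - {0}" "X \<longlonglongrightarrow> 0"
  \<comment> \<open>The bound holds only from some index \<open>N\<close> on; the limit is taken for
    the shifted sequence, and \<open>LIMSEQ_offset\<close> undoes the shift.\<close>
  then obtain N where N: "\<And>n. n \<ge> N \<Longrightarrow> \<bar>X n\<bar> < \<delta>"
    using \<delta>(1) LIMSEQ_D[of X 0 \<delta>] by auto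
  let ?V = "\<lambda>t. weighted_volume A \<Phi> (\<lambda>q. F q t)"
  have XN: "X (n + N) \<in> {-\<delta>..\<delta>}" "X (n + N) \<noteq> 0" "X (n + N) \<in> I" for n
    using N[of "n + N"] X(1) \<epsilon>_pos by (auto simp: abs_less_iff \<delta>_def)
  have int: "integrable \<mu> (\<lambda>q. \<psi> q t)" if "t \<in> I" for t
    using fin[OF that] weighted_volume_\<psi>(1)[OF that] by blast
  have "(\<lambda>n. \<integral>q. (\<psi> q (X (n + N)) - \<psi> q 0) / X (n + N) \<partial>\<mu>) \<longlonglongrightarrow> (\<integral>q. first_var q \<partial>\<mu>)"
  proof (rule integral_dominated_convergence[where w="\<lambda>q. C * indicator K q"])
    show "first_var \<in> borel_measurable \<mu>" using integrable_first_var by (rule borel_measurable_integrable)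
    show "(\<lambda>q. (\<psi> q (X (n + N)) - \<psi> q 0) / X (n + N)) \<in> borel_measurable \<mu>" for n
      using measurable_\<psi>[OF XN(3)] measurable_\<psi>[OF zero_in_I] by simp
    have "K \<in> sets \<mu>" using K(1) sets_volume_measure[OF x] by (simp add: borel_compact)
    then show "integrable \<mu> (\<lambda>q. C * indicator K q)"
      using emeasure_volume_measure_compact[OF x K(1)] by (intro integrable_mult_right) simp
    show "AE q in \<mu>. (\<lambda>n. (\<psi> q (X (n + N)) - \<psi> q 0) / X (n + N)) \<longlonglongrightarrow> first_var q"
    proof (rule AE_I2)
      fix q
      have "((\<lambda>t. (\<psi> q t - \<psi> q 0) / (t - 0)) \<longlongrightarrow> first_var q) (at 0)"
        using has_derivative_\<psi>_deriv[OF zero_in_I, of q] by (simp add: has_field_derivative_iff deriv_\<psi>_0)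
      then have "((\<lambda>t. (\<psi> q t - \<psi> q 0) / (t - 0)) \<circ> X) \<longlonglongrightarrow> first_var q"
        using X unfolding tendsto_at_iff_sequentially by blast
      then show "(\<lambda>n. (\<psi> q (X (n + N)) - \<psi> q 0) / X (n + N)) \<longlonglongrightarrow> first_var q"
        using LIMSEQ_ignore_initial_segment[of _ "first_var q" N] by (simp add: o_def)
    qed
    show "AE q in \<mu>. norm ((\<psi> q (X (n + N)) - \<psi> q 0) / X (n + N)) \<le> C * indicator K q" for n
      using bound[OF XN(1,2)] by (intro AE_I2) blast
  qed
  moreover have "(\<integral>q. (\<psi> q (X (n + N)) - \<psi> q 0) / X (n + N) \<partial>\<mu>) =
      (?V (X (n + N)) - ?V 0) / (X (n + N) - 0)" for n
    unfolding weighted_volume_\<psi>(2)[OF XN(3)] weighted_volume_\<psi>(2)[OF zero_in_I]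
    using int[OF XN(3)] int[OF zero_in_I] by simp
  ultimately have "(\<lambda>n. (?V (X (n + N)) - ?V 0) / (X (n + N) - 0)) \<longlonglongrightarrow> (\<integral>q. first_var q \<partial>\<mu>)" by (simp only:)
  then show "((\<lambda>t. (?V t - ?V 0) / (t - 0)) \<circ> X) \<longlonglongrightarrow> (\<integral>q. first_var q \<partial>\<mu>)"
    unfolding o_def by (rule LIMSEQ_offset)
qed

text \<open>Both branches of the convention, a genuine derivative or an integral of derivatives,
  give the same number, and in either branch it is unique.\<close>

theorem has_first_variation_iff: "has_first_variation A \<Phi> x \<epsilon> F v \<longleftrightarrow> v = (\<integral>q. first_var q \<partial>\<mu>)"
proof (cases "\<forall>t\<in>I. weighted_volume_finite A \<Phi> (\<lambda>q. F q t)")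
  case True
  then have "((\<lambda>t. weighted_volume A \<Phi> (\<lambda>q. F q t)) has_real_derivative (\<integral>q. first_var q \<partial>\<mu>)) (at 0)"
    by (intro weighted_volume_has_derivative) blast
  then show ?thesis
    unfolding has_first_variation_def if_P[OF True] using DERIV_unique by blast
next
  case False
  have "deriv (\<lambda>t. exp (- \<Phi> (\<lambda>q. F q t) q) * volume_ratio A x (\<lambda>q. F q t) q) 0 = first_var q" for q
    using deriv_\<psi>_0[of q] unfolding \<psi>_def[abs_def] .
  then have "has_first_variation A \<Phi> x \<epsilon> F v \<longleftrightarrow> has_bochner_integral \<mu> first_var v"
    unfolding has_first_variation_def if_not_P[OF False] by simp
  then show ?thesis using integrable_first_var by (auto simp: has_bochner_integral_iff)
qed

end

section \<open>Normal variations with small support\<close>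

context atlas_manifold
begin

text \<open>The compact image of \<open>K\<close> in the manifold is closed because the space is
  Hausdorff. Hence a point outside the chart domain has a whole neighbourhood on which the extension
  vanishes.\<close>

lemma smooth_map_extend_zero:
  fixes Z :: "real^'m \<Rightarrow> 'b::real_normed_vector"
  assumes c: "c \<in> A" and Z: "smooth_on (chart_img c) Z"
    and K: "compact K" "K \<subseteq> chart_img c" "\<And>u. u \<in> chart_img c \<Longrightarrow> u \<notin> K \<Longrightarrow> Z u = 0"
  shows "smooth_map A (\<lambda>q. if q \<in> chart_dom c then Z (chart_map c q) else 0)" (is "smooth_map A ?f")
  unfolding smooth_map_def
proof (intro ballI)
  fix d assume d: "d \<in> A"
  let ?K = "chart_inv c ` K"
  have "compact ?K"
    by (rule compact_continuous_image[OF continuous_on_subset[OF continuous_on_chart_inv[OF c] K(2)] K(1)])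
  then have "closed ?K" by (rule compact_imp_closed)
  then have U2: "open (chart_dom d \<inter> - ?K)" using open_chart_dom[OF d] by auto
  have zero: "?f q = 0" if "q \<notin> ?K" for q
    using that K(3)[of "chart_map c q"] chart_inv_map[OF c, of q] chart_map_in[of q c] by force
  show "smooth_on (chart_img d) (local_rep d ?f)"
  proof (rule smooth_on_open_cover)
    fix u assume u: "u \<in> chart_img d"
    let ?q = "chart_inv d u"
    have q: "?q \<in> chart_dom d" "chart_map d ?q = u" using u d chart_inv_in chart_map_inv by auto
    show "\<exists>U. open U \<and> u \<in> U \<and> smooth_on U (local_rep d ?f)"
    proof (cases "?q \<in> chart_dom c")
      case True
      let ?U = "chart_map d ` (chart_dom d \<inter> chart_dom c)"
      have U: "open ?U" "u \<in> ?U" using open_overlap[OF d c] True q by (auto intro: rev_image_eqI[of ?q])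
      have "smooth_on ?U (\<lambda>v. Z ((chart_map c \<circ> chart_inv d) v))"
        by (rule smooth_on_compose[OF U(1) open_chart_img[OF c] _ smooth_on_transition[OF d c] Z])
          (auto simp: chart_inv_map[OF d] chart_map_in)
      then have "smooth_on ?U (local_rep d ?f)"
        by (rule smooth_on_transform[OF U(1), rotated]) (auto simp: local_rep_def chart_inv_map[OF d])
      then show ?thesis using U by blast
    next
      case False
      let ?U = "chart_map d ` (chart_dom d \<inter> - ?K)"
      have "?q \<notin> ?K" using False K(2) chart_inv_in[OF c] by auto
      then have U: "open ?U" "u \<in> ?U"
        using open_chart_map_image[OF d U2] q by (auto intro: rev_image_eqI[of ?q])
      have lr: "0 = local_rep d ?f v" if v: "v \<in> ?U" for v
      proof -
        obtain q where q: "q \<in> chart_dom d" "q \<notin> ?K" "v = chart_map d q" using v by blast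
        show ?thesis unfolding q(3) local_rep_chart_map[OF d q(1)] by (rule zero[OF q(2), symmetric])
      qed
      have "smooth_on ?U (local_rep d ?f)"
        by (rule smooth_on_transform[OF U(1) lr smooth_on_const[OF U(1), of 0]])
      then show ?thesis using U by blast
    qed
  qed
qed

lemma inj_differential_change_chart:
  assumes "c \<in> A" "d \<in> A" "q \<in> chart_dom c" "q \<in> chart_dom d" "smooth_map A f"
    and "inj (differential d f q)"
  shows "inj (differential c f q)"
proof -
  have "differential c f q = differential d f q \<circ> transition c d q"
    using differential_change_chart[OF assms(1-5)] by auto
  moreover have "inj (transition c d q)" using transition_inverse[OF assms(1-4)] by (rule inj_on_inverseI)
  ultimately show ?thesis using assms(6) by (simp add: inj_compose)
qed

lemma smooth_map_add_scaleR:
  assumes "smooth_map A f" "smooth_map A h"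
  shows "smooth_map A (\<lambda>q. f q + t *\<^sub>R h q)"
  unfolding smooth_map_def
proof (intro ballI)
  fix c assume c: "c \<in> A"
  have "smooth_on (chart_img c) (\<lambda>u. local_rep c f u + t *\<^sub>R local_rep c h u)"
    by (intro smooth_on_add smooth_on_bilinear[OF bounded_bilinear_scaleR] smooth_on_const
        open_chart_img smooth_map_local_rep assms c)
  then show "smooth_on (chart_img c) (local_rep c (\<lambda>q. f q + t *\<^sub>R h q))"
    by (simp add: local_rep_def o_def)
qed

lemma differential_add_scaleR:
  assumes "smooth_map A f" "smooth_map A h" "c \<in> A" "q \<in> chart_dom c"
  shows "differential c (\<lambda>q. f q + t *\<^sub>R h q) q a = differential c f q a + t *\<^sub>R differential c h q a"
proof -
  have "((\<lambda>u. local_rep c f u + t *\<^sub>R local_rep c h u) has_derivative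
      (\<lambda>a. differential c f q a + t *\<^sub>R differential c h q a)) (at (chart_map c q))"
    by (intro has_derivative_add has_derivative_scaleR_right has_derivative_differential assms)
  from frechet_derivative_at[OF this] show ?thesis
    unfolding differential_def by (simp add: local_rep_def o_def fun_eq_iff)
qed

text \<open>The Gram determinant is positive on \<open>K\<close> at time 0, and compactness keeps it
  nonzero there for all small times at once. Off the image of \<open>K\<close> the map is locally
  unchanged.\<close>

lemma immersion_perturb:
  fixes x Z :: "'a \<Rightarrow> real^'n"
  assumes x: "immersion A x" and Z: "smooth_map A Z" and c: "c \<in> A"
    and K: "compact K" "K \<subseteq> chart_img c" "\<And>q. q \<notin> chart_inv c ` K \<Longrightarrow> Z q = 0"
  shows "\<exists>\<epsilon>>0. \<forall>t\<in>{-\<epsilon><..<\<epsilon>}. immersion A (\<lambda>q. x q + t *\<^sub>R Z q)"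
proof -
  have smx: "smooth_map A x" using x by (rule immersion_imp_smooth_map)
  define P where "P i z = partial i (local_rep c x) (fst z) + snd z *\<^sub>R partial i (local_rep c Z) (fst z)" for i and z :: "(real^'m) \<times> real"
  define D where "D z = det (gram (\<lambda>i. P i z))" for z
  have cont_partial: "continuous_on (chart_img c) (partial i (local_rep c y))" if "smooth_map A y" for i and y :: "'a \<Rightarrow> real^'n"
    unfolding partial_def[abs_def]
    by (intro smooth_on_imp_continuous_on smooth_on_frechet_derivative smooth_map_local_rep that c)
  have "continuous_on (K \<times> UNIV) (P i)" for i
    unfolding P_def
    by (intro continuous_intros continuous_on_compose2[OF cont_partial[OF smx]] continuous_on_compose2[OF cont_partial[OF Z]])
      (use K(2) in auto)
  then have contD: "continuous_on (K \<times> UNIV) D"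
    unfolding D_def gram_def by (intro continuous_on_det) (simp add: continuous_on_inner)
  have D0: "D (u, 0) > 0" if "u \<in> K" for u
    using det_metric_pos[OF x c, of u] K(2) that by (auto simp: D_def P_def metric_coeffs_eq_gram)
  have "\<exists>\<epsilon>>0. \<forall>u\<in>K. \<forall>t\<in>{-\<epsilon><..<\<epsilon>}. D (u, t) \<noteq> 0"
  proof (cases "K = {}")
    case True
    then show ?thesis by (intro exI[of _ 1]) auto
  next
    case False
    \<comment> \<open>Any compact time interval around 0 would serve, and this choice explains
      \<open>min e 1\<close> below. The tolerance for uniform continuity is the minimum
      \<open>D (u0, 0)\<close> over \<open>K\<close> at time 0.\<close>
    have "compact (K \<times> {-1..1::real})" using K(1) by (intro compact_Times) auto
    then have uc: "uniformly_continuous_on (K \<times> {-1..1}) D"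
      by (rule compact_uniformly_continuous[OF continuous_on_subset[OF contD], rotated]) auto
    have "continuous_on K (\<lambda>u. D (u, 0))"
      by (rule continuous_on_compose2[OF contD]) (auto intro!: continuous_intros)
    from continuous_attains_inf[OF K(1) False this]
    obtain u0 where u0: "u0 \<in> K" "\<And>u. u \<in> K \<Longrightarrow> D (u0, 0) \<le> D (u, 0)" by blast
    obtain e where e: "e > 0" "\<And>z w. z \<in> K \<times> {-1..1} \<Longrightarrow> w \<in> K \<times> {-1..1} \<Longrightarrow> dist w z < e \<Longrightarrow> dist (D w) (D z) < D (u0, 0)"
      using uc D0[OF u0(1)] unfolding uniformly_continuous_on_def by metis
    show ?thesis
    proof (intro exI[of _ "min e 1"] conjI ballI)
      fix u t assume u: "u \<in> K" and t: "t \<in> {- min e 1<..<min e 1}"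
      have "dist (u, t) (u, 0) < e" using t by (auto simp: dist_Pair_Pair dist_real_def)
      then have "dist (D (u, t)) (D (u, 0)) < D (u0, 0)" using e(2)[of "(u, 0)" "(u, t)"] u t by auto
      then show "D (u, t) \<noteq> 0" using u0(2)[OF u] by (auto simp: dist_real_def)
    qed (use e in auto)
  qed
  then obtain \<epsilon> where \<epsilon>: "\<epsilon> > 0" "\<And>u t. u \<in> K \<Longrightarrow> t \<in> {-\<epsilon><..<\<epsilon>} \<Longrightarrow> D (u, t) \<noteq> 0" by blast
  have "immersion A (\<lambda>q. x q + t *\<^sub>R Z q)" if t: "t \<in> {-\<epsilon><..<\<epsilon>}" for t
  proof -
    let ?y = "\<lambda>q. x q + t *\<^sub>R Z q"
    have smy: "smooth_map A ?y" by (rule smooth_map_add_scaleR[OF smx Z])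
    have "inj (differential d ?y q)" if d: "d \<in> A" "q \<in> chart_dom d" for d q
    proof (cases "q \<in> chart_inv c ` K")
      case True
      then obtain u where u: "u \<in> K" "q = chart_inv c u" by blast
      have "u \<in> chart_img c" using u(1) K(2) by blast
      then have qc: "q \<in> chart_dom c" "chart_map c q = u"
        using u(2) chart_inv_in[OF c] chart_map_inv[OF c] by simp_all
      have "P i (u, t) = differential c ?y q (axis i 1)" for i
        unfolding P_def differential_add_scaleR[OF smx Z c qc(1)] by (simp add: partial_eq_differential[symmetric] qc(2))
      then have "det (gram (\<lambda>i. differential c ?y q (axis i 1))) \<noteq> 0"
        using \<epsilon>(2)[OF u(1) t] by (simp add: D_def)
      then have "a = 0" if "differential c ?y q a = 0" for a
        using det_gram_nonzero_imp[of "\<lambda>i. differential c ?y q (axis i 1)" a] that differential_expand[OF c qc(1) smy, of a]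
        by simp
      then have "inj (differential c ?y q)"
        using linear_differential[OF smy c qc(1)] by (simp add: linear_injective_0)
      then show ?thesis by (rule inj_differential_change_chart[OF d(1) c d(2) qc(1) smy])
    next
      case False
      have "closed (chart_inv c ` K)"
        by (intro compact_imp_closed compact_continuous_image K continuous_on_subset[OF continuous_on_chart_inv[OF c]])
      then have "differential d ?y q = differential d x q"
        using False K(3) by (intro differential_cong[OF d smy, of "- chart_inv c ` K"]) auto
      then show ?thesis using x d by (simp add: immersion_def)
    qed
    then show ?thesis using smy by (simp add: immersion_def)
  qed
  then show ?thesis using \<epsilon>(1) by blast
qed

text \<open>By Cramer's rule, the field \<open>N = (det G) v - \<Sum>\<^sub>k (det G\<^sub>k) \<partial>\<^sub>k x\<close> is \<open>det G\<close> times the normal part of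
  the constant vector \<open>v\<close>; written this way it is visibly smooth.\<close>

definition normal_rep :: "('a, 'm) chart \<Rightarrow> ('a \<Rightarrow> real^'n) \<Rightarrow> real^'n \<Rightarrow> real^'m \<Rightarrow> real^'n" where
  "normal_rep c x v u = det (metric_coeffs c x u) *\<^sub>R v -
     (\<Sum>k\<in>UNIV. det (\<chi> i j. if j = k then v \<bullet> partial i (local_rep c x) u else metric_coeffs c x u $ i $ j)
        *\<^sub>R partial k (local_rep c x) u)"

lemma smooth_on_normal_rep:
  assumes "smooth_map A x" "c \<in> A"
  shows "smooth_on (chart_img c) (normal_rep c x v)"
proof -
  have o: "open (chart_img c)" by (rule open_chart_img[OF assms(2)])
  have p: "smooth_on (chart_img c) (partial i (local_rep c x))" for i
    unfolding partial_def[abs_def] by (intro smooth_on_frechet_derivative smooth_map_local_rep assms)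
  have G: "smooth_on (chart_img c) (\<lambda>u. metric_coeffs c x u $ i $ j)" for i j
    unfolding metric_coeffs_def by (simp add: smooth_on_bilinear[OF bounded_bilinear_inner o p p])
  have vp: "smooth_on (chart_img c) (\<lambda>u. v \<bullet> partial i (local_rep c x) u)" for i
    by (rule smooth_on_bilinear[OF bounded_bilinear_inner o smooth_on_const[OF o] p])
  have "smooth_on (chart_img c) (\<lambda>u. det (\<chi> i j. if j = k then v \<bullet> partial i (local_rep c x) u else metric_coeffs c x u $ i $ j))" for k
  proof (rule smooth_on_det[OF o])
    show "smooth_on (chart_img c) (\<lambda>u. (\<chi> i j. if j = k then v \<bullet> partial i (local_rep c x) u else metric_coeffs c x u $ i $ j) $ i $ j)" for i j
      by (cases "j = k") (simp_all add: G vp)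
  qed
  then have s: "smooth_on (chart_img c) (\<lambda>u. \<Sum>k\<in>UNIV. det (\<chi> i j. if j = k then v \<bullet> partial i (local_rep c x) u else metric_coeffs c x u $ i $ j)
        *\<^sub>R partial k (local_rep c x) u)"
    by (intro smooth_on_sum o smooth_on_bilinear[OF bounded_bilinear_scaleR] p)
  have d: "smooth_on (chart_img c) (\<lambda>u. det (metric_coeffs c x u) *\<^sub>R v)"
    by (intro smooth_on_bilinear[OF bounded_bilinear_scaleR] o smooth_on_det G smooth_on_const)
  have "smooth_on (chart_img c) (\<lambda>u. det (metric_coeffs c x u) *\<^sub>R v + (-1) *\<^sub>R
     (\<Sum>k\<in>UNIV. det (\<chi> i j. if j = k then v \<bullet> partial i (local_rep c x) u else metric_coeffs c x u $ i $ j)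
        *\<^sub>R partial k (local_rep c x) u))"
    by (intro smooth_on_add o d smooth_on_bilinear[OF bounded_bilinear_scaleR] smooth_on_const s)
  then show ?thesis by (simp add: normal_rep_def[abs_def])
qed

lemma normal_rep_normal:
  assumes x: "immersion A x" and c: "c \<in> A" "q \<in> chart_dom c"
  shows "normal_rep c x v (chart_map c q) \<in> normal_space A x q"
proof -
  let ?u = "chart_map c q"
  let ?G = "metric_coeffs c x ?u" and ?p = "\<lambda>i. partial i (local_rep c x) ?u"
  let ?b = "\<chi> i. v \<bullet> ?p i"
  let ?d = "\<lambda>k. det (\<chi> i j. if j = k then v \<bullet> ?p i else ?G $ i $ j)"
  have G: "?G $ i $ k = ?p k \<bullet> ?p i" for i k by (simp add: metric_coeffs_def inner_commute)
  have nz: "det ?G \<noteq> 0" using det_metric_pos[OF x c(1) chart_map_in[OF c(2)]] by simp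
  \<comment> \<open>These quotients are the coordinates of the tangential part of \<open>v\<close>;
    the denominators are cleared next to reach the form of \<open>normal_rep\<close>.\<close>
  then have "?G *v (\<chi> k. ?d k / det ?G) = ?b" by (simp add: cramer cong: if_cong)
  then have "(\<Sum>k\<in>UNIV. ?G $ i $ k * (?d k / det ?G)) = v \<bullet> ?p i" for i
    by (simp add: vec_eq_iff matrix_vector_mult_def)
  then have "det ?G * (\<Sum>k\<in>UNIV. ?G $ i $ k * (?d k / det ?G)) = det ?G * (v \<bullet> ?p i)" for i
    by (rule arg_cong)
  then have "(\<Sum>k\<in>UNIV. ?d k * ?G $ i $ k) = det ?G * (v \<bullet> ?p i)" for i
    using nz by (simp add: sum_distrib_left mult.commute)
  then have sum: "(\<Sum>k\<in>UNIV. ?d k * (?p k \<bullet> ?p i)) = det ?G * (v \<bullet> ?p i)" for i unfolding G .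
  have "normal_rep c x v ?u \<bullet> ?p i = 0" for i
    unfolding normal_rep_def inner_diff_left inner_sum_left inner_scaleR_left sum by simp
  then show ?thesis
    using normal_space_eq[OF c immersion_imp_smooth_map[OF x]] by (simp add: partial_eq_differential)
qed

lemma inner_normal_rep:
  assumes x: "smooth_map A x" and c: "c \<in> A" "q \<in> chart_dom c" and w: "w \<in> normal_space A x q"
  shows "normal_rep c x v (chart_map c q) \<bullet> w = det (metric_coeffs c x (chart_map c q)) * (v \<bullet> w)"
proof -
  have "partial k (local_rep c x) (chart_map c q) \<bullet> w = 0" for k
    using w normal_space_eq[OF c x] by (simp add: partial_eq_differential inner_commute)
  then show ?thesis by (simp add: normal_rep_def inner_diff_left inner_sum_left)
qed

text \<open>The variation moves points along straight lines, so its velocity is the same field at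
  all times. As \<open>normal_rep\<close> carries the factor \<open>det G\<close>, the function
  \<open>\<phi>\<close> is a bump times the metric determinant.\<close>

lemma bump_variation:
  fixes x :: "'a \<Rightarrow> real^'n"
  assumes x: "immersion A x" and U: "open U" "q0 \<in> U"
  shows "\<exists>\<epsilon> F \<phi>. variation A x \<epsilon> F \<and> compact_variation \<epsilon> F \<and> normal_variation A x F \<and>
    (\<forall>q. 0 \<le> \<phi> q) \<and> \<phi> q0 > 0 \<and> (\<forall>q. q \<notin> U \<longrightarrow> \<phi> q = 0) \<and>
    (\<forall>q. \<forall>w\<in>normal_space A x q. velocity F 0 q \<bullet> w = \<phi> q * (v \<bullet> w))"
proof -
  have smx: "smooth_map A x" using x by (rule immersion_imp_smooth_map)
  obtain c where c: "c \<in> A" "q0 \<in> chart_dom c" using ex_chart by blast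
  let ?u0 = "chart_map c q0"
  let ?V = "chart_map c ` (U \<inter> chart_dom c)"
  have V: "open ?V" "?u0 \<in> ?V" "?V \<subseteq> chart_img c"
    using open_chart_map_image[OF c(1), of "U \<inter> chart_dom c"] U open_chart_dom[OF c(1)] c(2)
    by (auto simp: chart_img_def)
  obtain r where r: "r > 0" "cball ?u0 r \<subseteq> ?V" using V(1,2) open_contains_cball by blast
  \<comment> \<open>Two radii are needed: the velocity vanishes outside the ball of radius
    \<open>s\<close>, and its closed support must lie in an open relatively compact set, the image
    of the ball of radius \<open>r\<close>.\<close>
  define s where "s = r / 2"
  have s: "s > 0" "s < r" using r by (auto simp: s_def)
  \<comment> \<open>The argument of \<open>flat_fun 0\<close> is smooth in \<open>u\<close> and
    positive exactly on the open ball of radius \<open>s\<close>.\<close>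
  define b where "b u = flat_fun 0 (s\<^sup>2 - (u - ?u0) \<bullet> (u - ?u0))" for u
  have b0: "0 \<le> b u" for u by (simp add: b_def flat_fun_def)
  have b_out: "b u = 0" if "u \<notin> ball ?u0 s" for u
  proof -
    have "s \<le> norm (u - ?u0)" using that by (simp add: dist_norm norm_minus_commute)
    then have "s\<^sup>2 \<le> (u - ?u0) \<bullet> (u - ?u0)"
      using s(1) by (metis power2_norm_eq_inner power_mono less_imp_le)
    then show ?thesis by (simp add: b_def flat_fun_def)
  qed
  have b_pos: "b ?u0 > 0" using s by (simp add: b_def flat_fun_def)
  have smb: "smooth_on UNIV b"
  proof -
    have lin: "smooth_on UNIV (\<lambda>u. u - ?u0)"
      using smooth_on_add[OF open_UNIV smooth_on_bounded_linear[OF open_UNIV bounded_linear_ident] smooth_on_const[OF open_UNIV, of "- ?u0"]]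
      by simp
    have "smooth_on UNIV (\<lambda>u. s\<^sup>2 + (-1) * ((u - ?u0) \<bullet> (u - ?u0)))"
      by (intro smooth_on_add smooth_on_bilinear[OF bounded_bilinear_mult] smooth_on_const
          smooth_on_bilinear[OF bounded_bilinear_inner] lin open_UNIV)
    moreover have "smooth_on UNIV (flat_fun 0)" by (simp add: smooth_on_def C_k_on_flat_fun)
    ultimately have "smooth_on UNIV (\<lambda>u. flat_fun 0 (s\<^sup>2 + (-1) * ((u - ?u0) \<bullet> (u - ?u0))))"
      by (rule smooth_on_compose[OF open_UNIV open_UNIV subset_UNIV])
    then show ?thesis by (simp add: b_def[abs_def])
  qed
  let ?K = "cball ?u0 s"
  have "?K \<subseteq> cball ?u0 r" using s by auto
  then have K: "compact ?K" "?K \<subseteq> chart_img c" using r(2) V(3) by auto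
  let ?Zc = "\<lambda>u. b u *\<^sub>R normal_rep c x v u"
  define Z where "Z q = (if q \<in> chart_dom c then ?Zc (chart_map c q) else 0)" for q
  have smZ: "smooth_map A Z"
    unfolding Z_def[abs_def]
  proof (rule smooth_map_extend_zero[OF c(1) _ K])
    show "smooth_on (chart_img c) ?Zc"
      by (intro smooth_on_bilinear[OF bounded_bilinear_scaleR] open_chart_img c
          smooth_on_subset[OF smb] smooth_on_normal_rep smx) simp
    show "?Zc u = 0" if "u \<notin> ?K" for u using b_out[of u] that by auto
  qed
  have Z_ball: "chart_map c q \<in> ball ?u0 s \<and> q \<in> chart_dom c" if "Z q \<noteq> 0" for q
    using that b_out[of "chart_map c q"] by (auto simp: Z_def split: if_splits)
  have Z0: "Z q = 0" if "q \<notin> chart_inv c ` ?K" for q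
    using that Z_ball[of q] chart_inv_image[OF c(1) K(2)] by auto
  obtain \<epsilon> where \<epsilon>: "\<epsilon> > 0" "\<And>t. t \<in> {-\<epsilon><..<\<epsilon>} \<Longrightarrow> immersion A (\<lambda>q. x q + t *\<^sub>R Z q)"
    using immersion_perturb[OF x smZ c(1) K Z0] by blast
  define F where "F q t = x q + t *\<^sub>R Z q" for q t
  define \<phi> where "\<phi> q = (if q \<in> chart_dom c then b (chart_map c q) * det (metric_coeffs c x (chart_map c q)) else 0)" for q
  have vel: "velocity F t q = Z q" for t q
  proof -
    have "(F q has_vector_derivative Z q) (at t)"
      unfolding F_def[abs_def] by (auto intro!: derivative_eq_intros)
    then show ?thesis unfolding velocity_def by (rule vector_derivative_at)
  qed
  have "variation A x \<epsilon> F"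
    unfolding variation_def
  proof (intro conjI ballI allI)
    fix d assume d: "d \<in> A"
    have o: "open (chart_img d \<times> {-\<epsilon><..<\<epsilon>})" by (simp add: open_Times open_chart_img[OF d])
    have lift: "smooth_on (chart_img d \<times> {-\<epsilon><..<\<epsilon>}) (\<lambda>z. local_rep d y (fst z))" if "smooth_map A y" for y :: "'a \<Rightarrow> real^'n"
      by (rule smooth_on_compose[OF o open_chart_img[OF d] _ smooth_on_bounded_linear[OF o bounded_linear_fst] smooth_map_local_rep[OF that d]]) auto
    have "smooth_on (chart_img d \<times> {-\<epsilon><..<\<epsilon>}) (\<lambda>z. local_rep d x (fst z) + snd z *\<^sub>R local_rep d Z (fst z))"
      by (intro smooth_on_add smooth_on_bilinear[OF bounded_bilinear_scaleR] o lift smx smZ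
          smooth_on_bounded_linear bounded_linear_snd)
    then show "smooth_on (chart_img d \<times> {-\<epsilon><..<\<epsilon>}) (\<lambda>(u, t). F (chart_inv d u) t)"
      by (simp add: F_def local_rep_def case_prod_beta')
  qed (use \<epsilon> in \<open>auto simp: F_def\<close>)
  moreover have "compact_variation \<epsilon> F"
    unfolding compact_variation_def
  proof (intro exI conjI ballI)
    let ?B = "chart_inv c ` ball ?u0 r"
    have Bi2: "cball ?u0 r \<subseteq> chart_img c" using r(2) V(3) by blast
    then have Bi: "ball ?u0 r \<subseteq> chart_img c" "cball ?u0 r \<subseteq> chart_img c" using ball_subset_cball by blast+
    show "open ?B" by (rule open_chart_inv_image[OF c(1) _ Bi(1)]) simp
    have cl: "compact (chart_inv c ` cball ?u0 t)" if "t \<le> r" for t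
    proof -
      have "cball ?u0 t \<subseteq> cball ?u0 r" using that by auto
      then have "cball ?u0 t \<subseteq> chart_img c" using Bi(2) by blast
      then show ?thesis
        by (intro compact_continuous_image continuous_on_subset[OF continuous_on_chart_inv[OF c(1)]]) auto
    qed
    have "closure ?B \<subseteq> chart_inv c ` cball ?u0 r"
      by (rule closure_minimal[OF _ compact_imp_closed[OF cl]]) auto
    then show "compact (closure ?B)"
      using compact_Int_closed[OF cl[of r] closed_closure[of ?B]] by (simp add: Int_absorb1)
    fix t
    have "closure {q. velocity F t q \<noteq> 0} \<subseteq> chart_inv c ` ?K"
      by (rule closure_minimal[OF _ compact_imp_closed[OF cl]]) (use Z0 s in \<open>auto simp: vel\<close>)
    also have "\<dots> \<subseteq> ?B" using s by (intro image_mono) auto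
    finally show "closure {q. velocity F t q \<noteq> 0} \<subseteq> ?B" .
  qed
  moreover have "normal_variation A x F"
    unfolding normal_variation_def vel
  proof
    fix q show "Z q \<in> normal_space A x q"
      using normal_rep_normal[OF x c(1), of q v] subspace_scale[OF subspace_normal_space] subspace_0[OF subspace_normal_space]
      by (auto simp: Z_def)
  qed
  moreover have "\<forall>q. 0 \<le> \<phi> q"
    using mult_nonneg_nonneg[OF b0 less_imp_le[OF det_metric_pos[OF x c(1) chart_map_in]]] by (simp add: \<phi>_def)
  moreover have "\<phi> q0 > 0"
    using b_pos det_metric_pos[OF x c(1) chart_map_in[OF c(2)]] c(2) by (simp add: \<phi>_def)
  moreover have "\<forall>q. q \<notin> U \<longrightarrow> \<phi> q = 0"
  proof (intro allI impI)
    fix q assume q: "q \<notin> U"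
    show "\<phi> q = 0"
    proof (cases "q \<in> chart_dom c")
      case True
      have "chart_map c q \<notin> ball ?u0 s"
      proof
        assume "chart_map c q \<in> ball ?u0 s"
        then have "chart_map c q \<in> ?V" using r(2) s by auto
        then obtain q' where q': "q' \<in> U" "q' \<in> chart_dom c" "chart_map c q = chart_map c q'" by blast
        have "q = q'"
          using arg_cong[OF q'(3), of "chart_inv c"]
          unfolding chart_inv_map[OF c(1) True] chart_inv_map[OF c(1) q'(2)] .
        then show False using q q'(1) by blast
      qed
      then show ?thesis using b_out by (simp add: \<phi>_def)
    qed (simp add: \<phi>_def)
  qed
  moreover have "\<forall>q. \<forall>w\<in>normal_space A x q. velocity F 0 q \<bullet> w = \<phi> q * (v \<bullet> w)"
    using inner_normal_rep[OF smx c(1)] by (simp add: vel Z_def \<phi>_def)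
  ultimately show ?thesis by blast
qed

section \<open>Critical points and the equation for \<xi>\<close>

lemma mean_curvature_normal:
  assumes "smooth_map A x"
  shows "mean_curvature A x q \<in> normal_space A x q"
  unfolding mean_curvature_def Let_def second_fundamental_form_def
  by (intro subspace_sum[OF subspace_normal_space] subspace_scale[OF subspace_normal_space] normal_part_props assms)

text \<open>Normal variations detect only the normal part of a vector field along \<open>x\<close>.
  Since \<xi> is a normal field, the difference of the two sides of the equation is itself normal
  and is detected entirely.\<close>

lemma critical_point_iff:
  fixes x \<xi> :: "'a \<Rightarrow> real^'n"
  assumes x: "immersion A x" and \<xi>: "normal_field A x \<xi>" and \<beta>: "continuous_on UNIV \<beta>"
    and \<Phi>: "\<And>y q. \<Phi> y q = f_weight \<xi> y q - \<beta> q"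
  shows "critical_point A \<Phi> x \<longleftrightarrow> (\<forall>q. mean_curvature A x q + normal_part A x q (x q) = \<xi> q)"
proof
  let ?h = "\<lambda>q. mean_curvature A x q + normal_part A x q (x q) - \<xi> q"
  have smx: "smooth_map A x" using x by (rule immersion_imp_smooth_map)
  have sm\<xi>: "smooth_map A \<xi>" using \<xi> by (simp add: normal_field_def)
  have wv: "weighted_variation A x \<xi> \<beta> \<Phi> \<epsilon> F"
    if "variation A x \<epsilon> F" "compact_variation \<epsilon> F" "normal_variation A x F" for \<epsilon> F
    using that x sm\<xi> \<beta> \<Phi> atlas_manifold_axioms
    by (auto simp: weighted_variation_def weighted_variation_axioms_def)
  {
    assume 0: "\<forall>q. mean_curvature A x q + normal_part A x q (x q) = \<xi> q"
    show "critical_point A \<Phi> x"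
      unfolding critical_point_def
    proof (intro allI impI, elim conjE)
      fix \<epsilon> F assume "variation A x \<epsilon> F" "compact_variation \<epsilon> F" "normal_variation A x F"
      then interpret weighted_variation A x \<xi> \<beta> \<Phi> \<epsilon> F by (rule wv)
      have "first_var = (\<lambda>q. 0)" using 0 by (auto simp: first_var_def)
      then show "has_first_variation A \<Phi> x \<epsilon> F 0" by (simp add: has_first_variation_iff)
    qed
  next
    assume crit: "critical_point A \<Phi> x"
    show "\<forall>q. mean_curvature A x q + normal_part A x q (x q) = \<xi> q"
    proof (rule ccontr)
      assume "\<not> ?thesis"
      then obtain q0 where q0: "?h q0 \<noteq> 0" by auto
      define v where "v = ?h q0"
      have h_normal: "?h q \<in> normal_space A x q" for q
        using mean_curvature_normal[OF smx] normal_part_props(1)[OF smx] \<xi>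
        by (intro subspace_diff subspace_add subspace_normal_space) (auto simp: normal_field_def)
      have vv: "v \<bullet> ?h q0 > 0" using q0 by (simp add: v_def)
      obtain \<epsilon>1 F1 \<phi>1 where 1: "variation A x \<epsilon>1 F1" "compact_variation \<epsilon>1 F1" "normal_variation A x F1"
        "\<And>q. 0 \<le> \<phi>1 q" "\<phi>1 q0 > 0" "\<And>q w. w \<in> normal_space A x q \<Longrightarrow> velocity F1 0 q \<bullet> w = \<phi>1 q * (v \<bullet> w)"
        using bump_variation[OF x open_UNIV UNIV_I, of q0 v] by metis
      interpret V1: weighted_variation A x \<xi> \<beta> \<Phi> \<epsilon>1 F1 by (rule wv[OF 1(1-3)])
      have g1: "V1.first_var q = - exp (- \<Phi> x q) * (\<phi>1 q * (v \<bullet> ?h q))" for q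
        unfolding V1.first_var_def 1(6)[OF h_normal] ..
      \<comment> \<open>As \<open>\<phi>1\<close> is nonnegative, a negative first variation density
        at a point forces \<open>v \<bullet> ?h q > 0\<close> there.\<close>
      let ?U = "{q. V1.first_var q < 0}"
      have U: "open ?U" using open_Collect_less[OF V1.continuous_on_first_var continuous_on_const] .
      have q0U: "q0 \<in> ?U" using 1(5) vv by (simp add: g1)
      have U_pos: "v \<bullet> ?h q > 0" if "q \<in> ?U" for q
      proof -
        have "exp (- \<Phi> x q) * (\<phi>1 q * (v \<bullet> ?h q)) > 0" using that by (simp add: g1)
        then have "\<phi>1 q * (v \<bullet> ?h q) > 0" by (rule zero_less_mult_pos[OF _ exp_gt_zero])
        then show ?thesis using 1(4)[of q] by (simp add: zero_less_mult_iff)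
      qed
      obtain \<epsilon>2 F2 \<phi>2 where 2: "variation A x \<epsilon>2 F2" "compact_variation \<epsilon>2 F2" "normal_variation A x F2"
        "\<And>q. 0 \<le> \<phi>2 q" "\<phi>2 q0 > 0" "\<And>q. q \<notin> ?U \<Longrightarrow> \<phi>2 q = 0"
        "\<And>q w. w \<in> normal_space A x q \<Longrightarrow> velocity F2 0 q \<bullet> w = \<phi>2 q * (v \<bullet> w)"
        using bump_variation[OF x U q0U, of v] by metis
      interpret V2: weighted_variation A x \<xi> \<beta> \<Phi> \<epsilon>2 F2 by (rule wv[OF 2(1-3)])
      have g2: "V2.first_var q = - exp (- \<Phi> x q) * (\<phi>2 q * (v \<bullet> ?h q))" for q
        unfolding V2.first_var_def 2(7)[OF h_normal] ..
      have nonpos: "V2.first_var q \<le> 0" for q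
      proof (cases "q \<in> ?U")
        case True
        then show ?thesis unfolding g2 using U_pos[OF True] 2(4)[of q]
          by (simp add: mult_nonneg_nonneg)
      qed (simp add: g2 2(6))
      have neg: "V2.first_var q0 < 0" unfolding g2 using vv 2(5) by simp
      have "has_first_variation A \<Phi> x \<epsilon>2 F2 0" using crit 2(1-3) unfolding critical_point_def by blast
      then have "(\<integral>q. V2.first_var q \<partial>volume_measure A x) = 0" using V2.has_first_variation_iff by simp
      then have "(\<integral>q. - V2.first_var q \<partial>volume_measure A x) = 0" by simp
      \<comment> \<open>A nonnegative function with zero integral vanishes almost everywhere, so the
        open set on which this continuous one is positive has volume zero, although it contains
        \<open>q0\<close>.\<close>
      then have "AE q in volume_measure A x. - V2.first_var q = 0"
        using V2.integrable_first_var nonpos by (subst (asm) integral_nonneg_eq_0_iff_AE) auto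
      then have ae: "AE q in volume_measure A x. q \<notin> {q. V2.first_var q < 0}" by (rule AE_mp) auto
      have V: "open {q. V2.first_var q < 0}" using open_Collect_less[OF V2.continuous_on_first_var continuous_on_const] .
      then have "{q. V2.first_var q < 0} \<in> sets (volume_measure A x)"
        using sets_volume_measure[OF x] by simp
      then have "emeasure (volume_measure A x) {q. V2.first_var q < 0} = 0"
        using ae by (simp add: AE_iff_null_sets null_setsD1)
      then show False using emeasure_volume_measure_open[OF x V, of q0] neg by simp
    qed
  }
qed

end

theorem corollary4p2:
  fixes A :: "('a::{t2_space,second_countable_topology}, 'm::finite) chart set"
    and x :: "'a \<Rightarrow> real ^ 'n::finite"
    and p :: nat
  assumes "smooth_atlas A"
    and "CARD('n) = CARD('m) + p"
    and "immersion A x"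
  shows "xi_submanifold A x \<longleftrightarrow>
    (\<exists>\<xi>. parallel_normal_field A x \<xi> \<and>
         critical_point A (f_weight \<xi>) x \<and>
         critical_point A (f_bar_weight \<xi>) x)"
proof -
  interpret atlas_manifold A using assms(1) by unfold_locales
  \<comment> \<open>For a given parallel field both sides of the theorem reduce to the same
    equation, so the two existence statements have the same witnesses.\<close>
  have "critical_point A (f_weight \<xi>) x \<and> critical_point A (f_bar_weight \<xi>) x \<longleftrightarrow>
      (\<forall>q. mean_curvature A x q + normal_part A x q (x q) = \<xi> q)"
    if "parallel_normal_field A x \<xi>" for \<xi>
  proof -
    have \<xi>: "normal_field A x \<xi>" using that by (simp add: parallel_normal_field_def)
    then have "continuous_on UNIV \<xi>" by (auto simp: normal_field_def intro: smooth_map_imp_continuous_on)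
    then have "continuous_on UNIV (\<lambda>q. 1/2 * (norm (\<xi> q))\<^sup>2)" by (intro continuous_intros)
    from critical_point_iff[OF assms(3) \<xi> this, of "f_bar_weight \<xi>"]
      critical_point_iff[OF assms(3) \<xi> continuous_on_const[of _ 0], of "f_weight \<xi>"]
    show ?thesis by (simp add: f_bar_weight_def)
  qed
  then show ?thesis unfolding xi_submanifold_def by blast
qed

end
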